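(* Let $(A,S,P)$ be a $\mathbb P$-contraction on a Hilbert space $\mathcal H$. Then $\mathcal H=\mathcal H_u\oplus\mathcal H_c$ for closed subspaces $\mathcal H_u,\mathcal H_c$ reducing each of $A,S,P$, such that $(A|_{\mathcal H_u},S|_{\mathcal H_u},P|_{\mathcal H_u})$ is a $\mathbb P$-unitary and $(A|_{\mathcal H_c},S|_{\mathcal H_c},P|_{\mathcal H_c})$ is a completely non-unitary $\mathbb P$-contraction.
   Context: The pentablock is $\mathbb P=\{(a_{21},\operatorname{tr}A_0,\det A_0): A_0=[a_{ij}]\in M_2(\mathbb C),\ \|A_0\|<1\}\subset\mathbb C^3$ with closure $\overline{\mathbb P}$. A commuting triple $(A,S,P)$ of bounded operators is a $\mathbb P$-contraction if $\overline{\mathbb P}$ is a spectral set for it: its Taylor joint spectrum lies in $\overline{\mathbb P}$ and $\|f(A,S,P)\|\le\sup_{\overline{\mathbb P}}|f|$ for every rational function $f$ with no poles in $\overline{\mathbb P}$. With $b\Gamma=\{(z_1+z_2,z_1z_2):|z_1|=|z_2|=1\}$, the distinguished boundary of $\mathbb P$ is $b\mathbb P=\{(a,s,p):(s,p)\in b\Gamma,\ |a|^2+\frac14|s|^2=1\}$. A $\mathbb P$-unitary is a commuting triple of normal operators whose Taylor joint spectrum lies in $b\mathbb P$. A $\mathbb P$-contraction is completely non-unitary if there is no nonzero closed joint reducing subspace on which it restricts to a $\mathbb P$-unitary. *)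

theory Defs
  imports "HOL-Analysis.Analysis"
begin

class chilbert = banach +
  fixes scaleC :: "complex \<Rightarrow> 'a \<Rightarrow> 'a"
    and cinner :: "'a \<Rightarrow> 'a \<Rightarrow> complex"
  assumes scaleC_add_right: "scaleC c (x + y) = scaleC c x + scaleC c y"
    and scaleC_add_left: "scaleC (b + c) x = scaleC b x + scaleC c x"
    and scaleC_scaleC: "scaleC b (scaleC c x) = scaleC (b * c) x"
    and scaleC_one: "scaleC 1 x = x"
    and scaleC_of_real: "scaleC (complex_of_real r) x = scaleR r x"
    and cinner_commute: "cinner x y = cnj (cinner y x)"
    and cinner_add_left: "cinner (x + y) z = cinner x z + cinner y z"
    and cinner_scaleC_left: "cinner (scaleC c x) y = cnj c * cinner x y"
    and cinner_self_norm: "cinner x x = complex_of_real ((norm x)\<^sup>2)"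

definition csubspace :: "'a::chilbert set \<Rightarrow> bool" where
  "csubspace M \<longleftrightarrow> 0 \<in> M \<and> (\<forall>x\<in>M. \<forall>y\<in>M. x + y \<in> M) \<and> (\<forall>c. \<forall>x\<in>M. scaleC c x \<in> M)"

definition closed_csubspace :: "'a::chilbert set \<Rightarrow> bool" where
  "closed_csubspace M \<longleftrightarrow> csubspace M \<and> closed M"

definition orth_in :: "'a::chilbert set \<Rightarrow> 'a set \<Rightarrow> 'a set" where
  "orth_in M N = {x\<in>M. \<forall>y\<in>N. cinner y x = 0}"

definition bounded_clinear_on :: "'a::chilbert set \<Rightarrow> ('a \<Rightarrow> 'a) \<Rightarrow> bool" where
  "bounded_clinear_on M T \<longleftrightarrow> T ` M \<subseteq> M
     \<and> (\<forall>x\<in>M. \<forall>y\<in>M. T (x + y) = T x + T y)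
     \<and> (\<forall>c. \<forall>x\<in>M. T (scaleC c x) = scaleC c (T x))
     \<and> (\<exists>K. \<forall>x\<in>M. norm (T x) \<le> K * norm x)"

definition reduces_in :: "'a::chilbert set \<Rightarrow> 'a set \<Rightarrow> ('a \<Rightarrow> 'a) \<Rightarrow> bool" where
  "reduces_in M N T \<longleftrightarrow> N \<subseteq> M \<and> T ` N \<subseteq> N \<and> T ` (orth_in M N) \<subseteq> orth_in M N"

definition normal_on :: "'a::chilbert set \<Rightarrow> ('a \<Rightarrow> 'a) \<Rightarrow> bool" where
  "normal_on M T \<longleftrightarrow> bounded_clinear_on M T \<and>
     (\<exists>T'. T' ` M \<subseteq> M \<and> (\<forall>x\<in>M. \<forall>y\<in>M. cinner (T x) y = cinner x (T' y))
           \<and> (\<forall>x\<in>M. T (T' x) = T' (T x)))"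

definition commuting_on :: "'a::chilbert set \<Rightarrow> ('a \<Rightarrow> 'a) \<Rightarrow> ('a \<Rightarrow> 'a) \<Rightarrow> ('a \<Rightarrow> 'a) \<Rightarrow> bool" where
  "commuting_on M T1 T2 T3 \<longleftrightarrow>
     (\<forall>x\<in>M. T1 (T2 x) = T2 (T1 x) \<and> T1 (T3 x) = T3 (T1 x) \<and> T2 (T3 x) = T3 (T2 x))"

text \<open>Koszul complex of a commuting triple on M:
  0 -> M -> M^3 -> M^3 -> M -> 0 with
  d1 x = (T1 x, T2 x, T3 x),
  d2 (x1,x2,x3) = (T2 x3 - T3 x2, T3 x1 - T1 x3, T1 x2 - T2 x1),
  d3 (y1,y2,y3) = T1 y1 + T2 y2 + T3 y3.
  The triple is Taylor-regular iff this complex is exact.\<close>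
definition taylor_regular :: "'a::chilbert set \<Rightarrow> ('a \<Rightarrow> 'a) \<Rightarrow> ('a \<Rightarrow> 'a) \<Rightarrow> ('a \<Rightarrow> 'a) \<Rightarrow> bool" where
  "taylor_regular M T1 T2 T3 \<longleftrightarrow>
     (\<forall>x\<in>M. T1 x = 0 \<and> T2 x = 0 \<and> T3 x = 0 \<longrightarrow> x = 0)
   \<and> (\<forall>x1\<in>M. \<forall>x2\<in>M. \<forall>x3\<in>M.
        T2 x3 - T3 x2 = 0 \<and> T3 x1 - T1 x3 = 0 \<and> T1 x2 - T2 x1 = 0 \<longrightarrow>
        (\<exists>x\<in>M. x1 = T1 x \<and> x2 = T2 x \<and> x3 = T3 x))
   \<and> (\<forall>y1\<in>M. \<forall>y2\<in>M. \<forall>y3\<in>M. T1 y1 + T2 y2 + T3 y3 = 0 \<longrightarrow>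
        (\<exists>x1\<in>M. \<exists>x2\<in>M. \<exists>x3\<in>M.
           y1 = T2 x3 - T3 x2 \<and> y2 = T3 x1 - T1 x3 \<and> y3 = T1 x2 - T2 x1))
   \<and> (\<forall>w\<in>M. \<exists>y1\<in>M. \<exists>y2\<in>M. \<exists>y3\<in>M. w = T1 y1 + T2 y2 + T3 y3)"

definition taylor_spectrum ::
  "'a::chilbert set \<Rightarrow> ('a \<Rightarrow> 'a) \<Rightarrow> ('a \<Rightarrow> 'a) \<Rightarrow> ('a \<Rightarrow> 'a) \<Rightarrow> (complex \<times> complex \<times> complex) set" where
  "taylor_spectrum M T1 T2 T3 = {(z1, z2, z3).
     \<not> taylor_regular M (\<lambda>x. T1 x - scaleC z1 x) (\<lambda>x. T2 x - scaleC z2 x) (\<lambda>x. T3 x - scaleC z3 x)}"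

definition poly3 :: "(nat \<times> nat \<times> nat \<Rightarrow> complex) \<Rightarrow> bool" where
  "poly3 c \<longleftrightarrow> finite {k. c k \<noteq> 0}"

definition poly3_eval :: "(nat \<times> nat \<times> nat \<Rightarrow> complex) \<Rightarrow> complex \<times> complex \<times> complex \<Rightarrow> complex" where
  "poly3_eval c z = (\<Sum>k\<in>{k. c k \<noteq> 0}. case k of (i, j, l) \<Rightarrow>
      c k * fst z ^ i * fst (snd z) ^ j * snd (snd z) ^ l)"

definition poly3_op :: "(nat \<times> nat \<times> nat \<Rightarrow> complex) \<Rightarrow> ('a::chilbert \<Rightarrow> 'a) \<Rightarrow> ('a \<Rightarrow> 'a) \<Rightarrow> ('a \<Rightarrow> 'a) \<Rightarrow> 'a \<Rightarrow> 'a" where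
  "poly3_op c T1 T2 T3 x = (\<Sum>k\<in>{k. c k \<noteq> 0}. case k of (i, j, l) \<Rightarrow>
      scaleC (c k) ((T1 ^^ i) ((T2 ^^ j) ((T3 ^^ l) x))))"

definition pentablock :: "(complex \<times> complex \<times> complex) set" where
  "pentablock = {(A0 $ 2 $ 1, trace A0, det A0) | A0 :: complex^2^2.
                   onorm (\<lambda>v::complex^2. A0 *v v) < 1}"

definition bGamma :: "(complex \<times> complex) set" where
  "bGamma = {(z1 + z2, z1 * z2) | z1 z2. cmod z1 = 1 \<and> cmod z2 = 1}"

definition bPenta :: "(complex \<times> complex \<times> complex) set" where
  "bPenta = {(a, s, p). (s, p) \<in> bGamma \<and> (cmod a)\<^sup>2 + (cmod s)\<^sup>2 / 4 = 1}"

text \<open>closure(pentablock) is a spectral set for (A,S,P)|M: Taylor spectrum inside it, and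
for every rational function f = p/q with q zero-free on closure(pentablock),
f(A,S,P) = p(A,S,P) q(A,S,P)^{-1} satisfies the von Neumann type bound.\<close>
definition penta_contraction_on ::
  "'a::chilbert set \<Rightarrow> ('a \<Rightarrow> 'a) \<Rightarrow> ('a \<Rightarrow> 'a) \<Rightarrow> ('a \<Rightarrow> 'a) \<Rightarrow> bool" where
  "penta_contraction_on M A S P \<longleftrightarrow>
     bounded_clinear_on M A \<and> bounded_clinear_on M S \<and> bounded_clinear_on M P
   \<and> commuting_on M A S P
   \<and> taylor_spectrum M A S P \<subseteq> closure pentablock
   \<and> (\<forall>p q. poly3 p \<and> poly3 q \<and> (\<forall>z\<in>closure pentablock. poly3_eval q z \<noteq> 0) \<longrightarrow>
        bij_betw (poly3_op q A S P) M M
      \<and> (\<forall>y\<in>M. norm (poly3_op p A S P (the_inv_into M (poly3_op q A S P) y))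
             \<le> (SUP z\<in>closure pentablock. cmod (poly3_eval p z / poly3_eval q z)) * norm y))"

definition penta_unitary_on ::
  "'a::chilbert set \<Rightarrow> ('a \<Rightarrow> 'a) \<Rightarrow> ('a \<Rightarrow> 'a) \<Rightarrow> ('a \<Rightarrow> 'a) \<Rightarrow> bool" where
  "penta_unitary_on M A S P \<longleftrightarrow>
     normal_on M A \<and> normal_on M S \<and> normal_on M P \<and> commuting_on M A S P
   \<and> taylor_spectrum M A S P \<subseteq> bPenta"

definition penta_cnu_on ::
  "'a::chilbert set \<Rightarrow> ('a \<Rightarrow> 'a) \<Rightarrow> ('a \<Rightarrow> 'a) \<Rightarrow> ('a \<Rightarrow> 'a) \<Rightarrow> bool" where
  "penta_cnu_on M A S P \<longleftrightarrow> penta_contraction_on M A S P \<and>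
     \<not> (\<exists>N. closed_csubspace N \<and> N \<noteq> {0} \<and>
            reduces_in M N A \<and> reduces_in M N S \<and> reduces_in M N P \<and>
            penta_unitary_on N A S P)"

end

theory Submission
  imports Defs
begin

text \<open>A commuting triple of normal operators has its Taylor spectrum in the distinguished boundary
  iff $P$ is unitary, $S = S^* P$ and $A^* A + S^* S / 4 = 1$: these are the equations of the
  boundary read as operator identities. Hence the largest subspace that is invariant under
  $A, S, P$ and their adjoints and on which these identities and $A A^* = A^* A$ hold is the largest
  reducing subspace on which the triple is a pentablock unitary, and its orthogonal complement
  carries the completely non-unitary part.

  If the identities hold, then the triple is doubly commuting, so every point of the Taylor spectrum
  is a limit of approximate joint eigenvalues and satisfies the equations. Conversely, if an
  identity $Q = 0$ fails for a unitary triple, we cut the space into ever thinner joint spectral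
  subspaces on which $Q$ is not small; they shrink to a point of the Taylor spectrum at which the
  corresponding equation fails. The spectral subspaces come from the sign decomposition of
  $D^* D - r^2$ for the normal operators $D = T - \lambda$.\<close>

section \<open>Complex Hilbert spaces\<close>

lemma cinner_add_right: "cinner x (y + z) = cinner x y + cinner x (z::'a::chilbert)"
  by (metis cinner_add_left cinner_commute complex_cnj_add)

lemma cinner_scaleC_right: "cinner x (scaleC c y) = c * cinner x (y::'a::chilbert)"
  by (metis cinner_commute cinner_scaleC_left complex_cnj_cnj complex_cnj_mult)

lemma scaleC_zero_left [simp]: "scaleC 0 (x::'a::chilbert) = 0"
  using scaleC_of_real[of 0 x] by simp

lemma scaleC_zero_right [simp]: "scaleC c (0::'a::chilbert) = 0"
  using scaleC_add_right[of c 0 0] by simp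

lemma scaleC_minus_one: "scaleC (- 1) (x::'a::chilbert) = - x"
  using scaleC_of_real[of "-1" x] by simp

lemma scaleC_minus_left: "scaleC (- c) (x::'a::chilbert) = - scaleC c x"
  by (metis mult_minus1 scaleC_minus_one scaleC_scaleC)

lemma scaleC_minus_right: "scaleC c (- x) = - scaleC c (x::'a::chilbert)"
  by (metis add.right_inverse add_eq_0_iff scaleC_add_right scaleC_zero_right)

lemma scaleC_diff_left: "scaleC (b - c) (x::'a::chilbert) = scaleC b x - scaleC c x"
  by (metis diff_conv_add_uminus scaleC_add_left scaleC_minus_left)

lemma scaleC_diff_right: "scaleC c (x - y) = scaleC c x - scaleC c (y::'a::chilbert)"
  by (metis diff_conv_add_uminus scaleC_add_right scaleC_minus_right)

lemma scaleC_scaleR: "scaleC c (r *\<^sub>R x) = r *\<^sub>R scaleC c (x::'a::chilbert)"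
  by (metis mult.commute scaleC_of_real scaleC_scaleC)

lemma cinner_zero_left [simp]: "cinner 0 (x::'a::chilbert) = 0"
  using cinner_add_left[of 0 0 x] by simp

lemma cinner_zero_right [simp]: "cinner (x::'a::chilbert) 0 = 0"
  using cinner_add_right[of x 0 0] by simp

lemma cinner_minus_left [simp]: "cinner (- x) (y::'a::chilbert) = - cinner x y"
  using cinner_add_left[of x "- x" y] by (simp add: eq_neg_iff_add_eq_0 add.commute)

lemma cinner_minus_right [simp]: "cinner x (- y::'a::chilbert) = - cinner x y"
  using cinner_add_right[of x y "- y"] by (simp add: eq_neg_iff_add_eq_0 add.commute)

lemma cinner_diff_left: "cinner (x - y) (z::'a::chilbert) = cinner x z - cinner y z"
  by (metis cinner_add_left cinner_minus_left diff_conv_add_uminus)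

lemma cinner_diff_right: "cinner x (y - z::'a::chilbert) = cinner x y - cinner x z"
  by (metis cinner_add_right cinner_minus_right diff_conv_add_uminus)

lemma cinner_scaleR_left: "cinner (r *\<^sub>R x) (y::'a::chilbert) = r * cinner x y"
  by (metis cinner_scaleC_left complex_cnj_complex_of_real scaleC_of_real)

lemma cinner_scaleR_right: "cinner x (r *\<^sub>R y::'a::chilbert) = r * cinner x y"
  by (metis cinner_scaleC_right scaleC_of_real)

lemmas cinner_simps = cinner_add_left cinner_add_right cinner_diff_left cinner_diff_right
  cinner_scaleC_left cinner_scaleC_right cinner_scaleR_left cinner_scaleR_right

lemma cinner_eq_zero_commute: "cinner x y = 0 \<longleftrightarrow> cinner y (x::'a::chilbert) = 0"
  by (metis cinner_commute complex_cnj_zero_iff)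

lemma Re_cinner_commute: "Re (cinner x y) = Re (cinner y (x::'a::chilbert))"
  by (metis cinner_commute cnj.simps(1))

lemma norm_sq_cinner: "(norm (x::'a::chilbert))\<^sup>2 = Re (cinner x x)"
  by (simp add: cinner_self_norm)

lemma cinner_self_eq_zero [simp]: "cinner x x = 0 \<longleftrightarrow> x = (0::'a::chilbert)"
  by (simp add: cinner_self_norm)

lemma cinner_eqI: "(\<And>y. cinner y x = cinner y z) \<Longrightarrow> x = (z::'a::chilbert)"
  by (metis cinner_diff_right cinner_self_eq_zero eq_iff_diff_eq_0)

lemma norm_add_sq: "(norm (x + y::'a::chilbert))\<^sup>2 = (norm x)\<^sup>2 + 2 * Re (cinner x y) + (norm y)\<^sup>2"
  unfolding norm_sq_cinner using Re_cinner_commute[of y x] by (simp add: cinner_simps)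

lemma norm_diff_sq: "(norm (x - y::'a::chilbert))\<^sup>2 = (norm x)\<^sup>2 - 2 * Re (cinner x y) + (norm y)\<^sup>2"
  using norm_add_sq[of x "- y"] by simp

lemma pythagoras: "cinner x y = 0 \<Longrightarrow> (norm (x + y::'a::chilbert))\<^sup>2 = (norm x)\<^sup>2 + (norm y)\<^sup>2"
  by (simp add: norm_add_sq)

lemma parallelogram_law:
  "(norm (x + y::'a::chilbert))\<^sup>2 + (norm (x - y))\<^sup>2 = 2 * ((norm x)\<^sup>2 + (norm y)\<^sup>2)"
  by (simp add: norm_add_sq norm_diff_sq)

lemma norm_scaleC [simp]: "norm (scaleC c (x::'a::chilbert)) = cmod c * norm x"
proof -
  have "complex_of_real ((norm (scaleC c x))\<^sup>2) = complex_of_real ((cmod c)\<^sup>2 * (norm x)\<^sup>2)"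
    unfolding cinner_self_norm[symmetric] of_real_mult complex_norm_square
    by (simp add: cinner_simps algebra_simps)
  then have "(norm (scaleC c x))\<^sup>2 = (cmod c * norm x)\<^sup>2"
    by (simp add: power_mult_distrib flip: of_real_power of_real_mult)
  then show ?thesis by (simp add: power2_eq_iff_nonneg)
qed

lemma norm_minus_component_sq:
  fixes x y :: "'a::chilbert"
  assumes "x \<noteq> 0"
  shows "(norm (y - scaleC (cinner x y / (norm x)\<^sup>2) x))\<^sup>2 = (norm y)\<^sup>2
      - (cmod (cinner x y))\<^sup>2 / (norm x)\<^sup>2"
proof -
  define c where "c = cinner x y / (norm x)\<^sup>2"
  have "c * cinner y x = complex_of_real ((cmod (cinner x y))\<^sup>2 / (norm x)\<^sup>2)"
    using cinner_commute[of y x] complex_norm_square[of "cinner x y"] by (simp add: c_def)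
  moreover have "(cmod c * norm x)\<^sup>2 = (cmod (cinner x y))\<^sup>2 / (norm x)\<^sup>2"
    using assms
    by (simp add: c_def norm_divide power_divide power_mult_distrib field_simps norm_power)
  ultimately show ?thesis
    unfolding norm_diff_sq c_def[symmetric] by (simp add: cinner_simps)
qed

lemma cinner_cauchy_schwarz: "cmod (cinner x y) \<le> norm x * norm (y::'a::chilbert)"
proof (cases "x = 0")
  case False
  have "(cmod (cinner x y))\<^sup>2 / (norm x)\<^sup>2 \<le> (norm y)\<^sup>2"
    using norm_minus_component_sq[OF False, of y] by (metis diff_ge_0_iff_ge zero_le_power2)
  then have "(cmod (cinner x y))\<^sup>2 \<le> (norm x * norm y)\<^sup>2"
    using False by (simp add: field_simps)
  then show ?thesis by (simp add: power2_le_iff_abs_le)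
qed simp

lemma Re_cinner_le: "Re (cinner x y) \<le> norm x * norm (y::'a::chilbert)"
  by (meson cinner_cauchy_schwarz complex_Re_le_cmod order_trans)

lemma bounded_linear_cinner_right: "bounded_linear (\<lambda>y. cinner x (y::'a::chilbert))"
  by (rule bounded_linear_intro[where K = "norm x"])
    (simp_all add: cinner_simps scaleR_conv_of_real cinner_cauchy_schwarz
        mult.commute[of "norm _" "norm x"])

lemma bounded_linear_cinner_left: "bounded_linear (\<lambda>x. cinner x (y::'a::chilbert))"
  by (rule bounded_linear_intro[where K = "norm y"])
    (simp_all add: cinner_simps scaleR_conv_of_real cinner_cauchy_schwarz)

lemma bounded_linear_scaleC: "bounded_linear (scaleC c :: 'a::chilbert \<Rightarrow> 'a)"
  by (rule bounded_linear_intro[where K = "cmod c"])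
    (simp_all add: scaleC_add_right scaleC_scaleR mult.commute)

section \<open>Closed subspaces and orthogonal projections\<close>

lemma csubspace_scaleC: "csubspace M \<Longrightarrow> x \<in> M \<Longrightarrow> scaleC c x \<in> M"
  by (simp add: csubspace_def)

lemma csubspace_imp_subspace: "csubspace M \<Longrightarrow> subspace M"
  unfolding csubspace_def subspace_def by (metis scaleC_of_real)

lemma sgn_in_subspace_sphere:
  fixes x :: "'a::real_normed_vector"
  shows "subspace M \<Longrightarrow> x \<in> M \<Longrightarrow> x \<noteq> 0 \<Longrightarrow> sgn x \<in> M \<inter> sphere 0 1"
  using norm_sgn[of x] by (simp add: sgn_div_norm subspace_scale)

lemma closed_csubspaceD:
  assumes "closed_csubspace M"
  shows "csubspace M" "subspace M" "closed M"
  using assms by (auto simp: closed_csubspace_def csubspace_imp_subspace)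

lemma closed_csubspace_Int:
  "closed_csubspace M \<Longrightarrow> closed_csubspace N \<Longrightarrow> closed_csubspace (M \<inter> N)"
  by (auto simp: closed_csubspace_def csubspace_def)

abbreviation orth :: "'a::chilbert set \<Rightarrow> 'a set" where
  "orth M \<equiv> orth_in UNIV M"

lemma orthD: "x \<in> orth M \<Longrightarrow> m \<in> M \<Longrightarrow> cinner m x = 0"
  by (simp add: orth_in_def)

lemma closed_csubspace_orth: "closed_csubspace (orth M)"
proof -
  have "orth M = (\<Inter>y\<in>M. {x. cinner y x = 0})" by (auto simp: orth_in_def)
  moreover have "closed {x. cinner y x = 0}" for y :: 'a
    by (intro closed_Collect_eq continuous_intros
        bounded_linear.continuous_on[OF bounded_linear_cinner_right])
  ultimately show ?thesis
    by (auto simp: closed_csubspace_def csubspace_def orth_in_def cinner_simps)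
qed

lemma dist_sq_le_of_near_infdist:
  fixes x :: "'a::chilbert"
  assumes "convex C" and C: "u \<in> C" "v \<in> C" and near: "dist x u \<le> r" "dist x v \<le> r"
  shows "(dist u v)\<^sup>2 \<le> 4 * (r\<^sup>2 - (infdist x C)\<^sup>2)"
proof -
  have "midpoint u v \<in> C"
    using convexD[OF \<open>convex C\<close> C, of "1/2" "1/2"] by (simp add: midpoint_def scaleR_add_right)
  then have "infdist x C \<le> norm (x - midpoint u v)" by (metis infdist_le dist_norm)
  then have "2 * infdist x C \<le> norm (2 *\<^sub>R (x - midpoint u v))" by simp
  also have "2 *\<^sub>R (x - midpoint u v) = (x - u) + (x - v)"
    by (simp add: midpoint_def algebra_simps scaleR_2)
  finally have "(2 * infdist x C)\<^sup>2 \<le> (norm ((x - u) + (x - v)))\<^sup>2"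
    by (intro power_mono) (simp_all add: infdist_nonneg)
  moreover have "(norm (x - u))\<^sup>2 \<le> r\<^sup>2" "(norm (x - v))\<^sup>2 \<le> r\<^sup>2"
    using near by (simp_all add: dist_norm power_mono)
  ultimately show ?thesis
    using parallelogram_law[of "x - u" "x - v"]
    by (simp add: dist_norm norm_minus_commute power_mult_distrib)
qed

lemma diameter_near_points_small:
  fixes x :: "'a::chilbert"
  assumes "convex C" and e: "0 < e"
  shows "\<exists>n. \<forall>u\<in>C \<inter> cball x (infdist x C + 1 / real (Suc n)).
    \<forall>v\<in>C \<inter> cball x (infdist x C + 1 / real (Suc n)). dist u v < e"
proof -
  define d where "d = infdist x C"
  have "(\<lambda>n. 4 * ((d + 1 / real (Suc n))\<^sup>2 - d\<^sup>2)) \<longlonglongrightarrow> 4 * ((d + 0)\<^sup>2 - d\<^sup>2)"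
    by (intro tendsto_mult tendsto_diff tendsto_power tendsto_add tendsto_const
        LIMSEQ_Suc[OF lim_1_over_n])
  then have "\<forall>\<^sub>F n in sequentially. 4 * ((d + 1 / real (Suc n))\<^sup>2 - d\<^sup>2) < e\<^sup>2"
    by (rule order_tendstoD) (use e in simp)
  then obtain n where n: "4 * ((d + 1 / real (Suc n))\<^sup>2 - d\<^sup>2) < e\<^sup>2"
    by (auto simp: eventually_sequentially)
  have "dist u v < e"
    if "u \<in> C \<inter> cball x (d + 1 / real (Suc n))" "v \<in> C \<inter> cball x (d + 1 / real (Suc n))" for u v
  proof -
    have "(dist u v)\<^sup>2 \<le> 4 * ((d + 1 / real (Suc n))\<^sup>2 - d\<^sup>2)"
      using that dist_sq_le_of_near_infdist[OF \<open>convex C\<close>, of u v x] by (simp add: d_def)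
    with n show ?thesis using e by (intro power_less_imp_less_base[of "dist u v" 2 e]) simp_all
  qed
  then show ?thesis unfolding d_def by blast
qed

lemma closest_point_exists:
  fixes C :: "'a::chilbert set"
  assumes "closed C" "convex C" "C \<noteq> {}"
  obtains u where "u \<in> C" "\<And>v. v \<in> C \<Longrightarrow> dist x u \<le> dist x v"
proof -
  define d where "d = infdist x C"
  define S where "S n = C \<inter> cball x (d + 1 / real (Suc n))" for n
  have "\<exists>u. \<forall>n. u \<in> S n"
  proof (rule decreasing_closed_nest[of S])
    show "closed (S n)" for n unfolding S_def by (intro closed_Int \<open>closed C\<close> closed_cball)
    show "S n \<noteq> {}" for n
    proof -
      have "Inf (dist x ` C) < d + 1 / real (Suc n)"
        using \<open>C \<noteq> {}\<close> by (simp add: d_def infdist_notempty)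
      then obtain u where "u \<in> C" "dist x u < d + 1 / real (Suc n)"
        using cInf_lessD[of "dist x ` C"] \<open>C \<noteq> {}\<close> by blast
      then show ?thesis by (auto simp: S_def)
    qed
    show "S n \<subseteq> S m" if "m \<le> n" for m n
    proof -
      have "1 / real (Suc n) \<le> 1 / real (Suc m)" using that by (simp add: frac_le)
      then show ?thesis by (auto simp: S_def)
    qed
    show "\<exists>n. \<forall>u\<in>S n. \<forall>v\<in>S n. dist u v < e" if "0 < e" for e
      unfolding S_def d_def by (rule diameter_near_points_small[OF \<open>convex C\<close> that])
  qed blast
  then obtain u where u: "u \<in> C" "\<And>n. dist x u \<le> d + 1 / real (Suc n)" by (auto simp: S_def)
  have "(\<lambda>n. d + 1 / real (Suc n)) \<longlonglongrightarrow> d + 0"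
    by (intro tendsto_add tendsto_const LIMSEQ_Suc[OF lim_1_over_n])
  from LIMSEQ_le_const[OF this] have "dist x u \<le> d" using u(2) by auto
  also have "d \<le> dist x v" if "v \<in> C" for v
    unfolding d_def using that by (rule infdist_le)
  finally show thesis by (rule that[OF u(1)])
qed

lemma minimal_norm_imp_orthogonal:
  fixes v :: "'a::chilbert"
  assumes "csubspace M" "m \<in> M" and min: "\<And>u. u \<in> M \<Longrightarrow> norm v \<le> norm (v - u)"
  shows "cinner m v = 0"
proof (rule ccontr)
  assume ne: "cinner m v \<noteq> 0"
  then have "m \<noteq> 0" by auto
  have "(norm v)\<^sup>2 \<le> (norm (v - scaleC (cinner m v / (norm m)\<^sup>2) m))\<^sup>2"
    by (intro power_mono min csubspace_scaleC assms) simp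
  moreover have "0 < (cmod (cinner m v))\<^sup>2 / (norm m)\<^sup>2" using ne \<open>m \<noteq> 0\<close> by simp
  ultimately show False unfolding norm_minus_component_sq[OF \<open>m \<noteq> 0\<close>] by simp
qed

lemma orthogonal_decomposition:
  fixes x :: "'a::chilbert"
  assumes M: "closed_csubspace M"
  shows "\<exists>u\<in>M. x - u \<in> orth M"
proof -
  note sub = closed_csubspaceD[OF M]
  have "M \<noteq> {}" using subspace_0[OF sub(2)] by blast
  then obtain u where u: "u \<in> M" "\<And>v. v \<in> M \<Longrightarrow> dist x u \<le> dist x v"
    using closest_point_exists[OF sub(3) subspace_imp_convex[OF sub(2)]] by blast
  have "cinner m (x - u) = 0" if "m \<in> M" for m
  proof (rule minimal_norm_imp_orthogonal[OF sub(1) that])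
    fix v assume "v \<in> M"
    then have "dist x u \<le> dist x (u + v)" by (intro u subspace_add[OF sub(2)])
    then show "norm (x - u) \<le> norm (x - u - v)" by (simp add: dist_norm algebra_simps)
  qed
  then show ?thesis using u by (auto simp: orth_in_def)
qed

definition proj :: "'a::chilbert set \<Rightarrow> 'a \<Rightarrow> 'a" where
  "proj M x = (SOME u. u \<in> M \<and> x - u \<in> orth M)"

context
  fixes M :: "'a::chilbert set"
  assumes M: "closed_csubspace M"
begin

lemma proj_in: "proj M x \<in> M" and diff_proj_in_orth: "x - proj M x \<in> orth M"
proof -
  have "proj M x \<in> M \<and> x - proj M x \<in> orth M"
    unfolding proj_def by (rule someI_ex) (use orthogonal_decomposition[OF M, of x] in blast)
  then show "proj M x \<in> M" "x - proj M x \<in> orth M" by auto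
qed

lemma cinner_proj_right: "m \<in> M \<Longrightarrow> cinner m (proj M x) = cinner m x"
  using orthD[OF diff_proj_in_orth, of m x] by (simp add: cinner_diff_right)

lemma proj_add_orth:
  assumes u: "u \<in> M" and v: "v \<in> orth M"
  shows "proj M (u + v) = u"
proof -
  let ?w = "proj M (u + v) - u"
  have "?w \<in> M" by (rule subspace_diff[OF closed_csubspaceD(2)[OF M] proj_in u])
  then have "cinner ?w ?w = 0"
    using orthD[OF v] by (simp add: cinner_diff_right cinner_proj_right cinner_add_right)
  then show ?thesis by simp
qed

lemma proj_id: "u \<in> M \<Longrightarrow> proj M u = u"
  using proj_add_orth[of u 0] by (simp add: orth_in_def)

lemma orth_orth: "orth (orth M) = M"
proof
  show "M \<subseteq> orth (orth M)"
    by (auto simp: orth_in_def) (metis cinner_eq_zero_commute)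
  show "orth (orth M) \<subseteq> M"
  proof
    fix x assume "x \<in> orth (orth M)"
    then have "cinner (x - proj M x) x = 0"
      by (rule orthD) (rule diff_proj_in_orth)
    moreover have "cinner (x - proj M x) (proj M x) = 0"
      using orthD[OF diff_proj_in_orth proj_in] by (metis cinner_eq_zero_commute)
    ultimately have "cinner (x - proj M x) (x - proj M x) = 0" by (simp add: cinner_diff_right)
    then show "x \<in> M" using proj_in[of x] by simp
  qed
qed

lemma norm_proj_le: "norm (proj M x) \<le> norm x"
proof -
  have "cinner (proj M x) (x - proj M x) = 0"
    by (rule orthD[OF diff_proj_in_orth proj_in])
  then have "(norm (proj M x + (x - proj M x)))\<^sup>2 = (norm (proj M x))\<^sup>2 + (norm (x - proj M x))\<^sup>2"
    by (rule pythagoras)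
  then have "(norm (proj M x))\<^sup>2 \<le> (norm x)\<^sup>2" by simp
  then show ?thesis by (simp add: power2_le_iff_abs_le)
qed

lemma cinner_proj_swap: "cinner (proj M x) y = cinner x (proj M y)"
  by (metis cinner_commute cinner_proj_right proj_in)

end

section \<open>Bounded operators and their adjoints\<close>

abbreviation bounded_clinear :: "('a::chilbert \<Rightarrow> 'a) \<Rightarrow> bool" where
  "bounded_clinear \<equiv> bounded_clinear_on UNIV"

lemma bounded_clinearI:
  assumes "\<And>x y. T (x + y) = T x + T y" "\<And>c x. T (scaleC c x) = scaleC c (T x)"
    "\<And>x. norm (T x) \<le> K * norm x"
  shows "bounded_clinear T"
  using assms unfolding bounded_clinear_on_def by blast

lemma bounded_clinear_bounded_linear: "bounded_clinear T \<Longrightarrow> bounded_linear T"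
proof -
  assume T: "bounded_clinear T"
  then obtain K where K: "\<And>x. norm (T x) \<le> K * norm x" by (auto simp: bounded_clinear_on_def)
  have "T (r *\<^sub>R x) = r *\<^sub>R T x" for r x
    using T unfolding scaleC_of_real[symmetric] by (simp add: bounded_clinear_on_def)
  then show ?thesis
    using T K
    by (intro bounded_linear_intro[where K = K]) (auto simp: bounded_clinear_on_def mult.commute)
qed

lemma bounded_clinear_bound:
  assumes "bounded_clinear T"
  obtains K where "0 < K" "\<And>x. norm (T x) \<le> K * norm x"
  using bounded_linear.pos_bounded[OF bounded_clinear_bounded_linear[OF assms]]
  by (metis mult.commute)

lemma bounded_clinear_simps:
  assumes "bounded_clinear T"
  shows "T (x + y) = T x + T y" "T (x - y) = T x - T y" "T (scaleC c x) = scaleC c (T x)"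
    "T (r *\<^sub>R x) = r *\<^sub>R T x" "T (- x) = - T x" "T 0 = 0"
proof -
  have lin: "linear T"
    using bounded_clinear_bounded_linear[OF assms] by (rule bounded_linear.linear)
  show "T (x + y) = T x + T y" "T (x - y) = T x - T y" "T (r *\<^sub>R x) = r *\<^sub>R T x" "T (- x) = - T x"
      "T 0 = 0"
    by (simp_all add: lin linear_add linear_diff linear_scale linear_neg linear_0)
  show "T (scaleC c x) = scaleC c (T x)" using assms by (simp add: bounded_clinear_on_def)
qed

lemma norm_apply_sgn: "bounded_clinear T \<Longrightarrow> norm (T (sgn x)) = norm (T x) / norm x"
  by (simp add: sgn_div_norm bounded_clinear_simps divide_inverse mult.commute)

lemma bounded_clinear_ident: "bounded_clinear (\<lambda>x. x)"
  by (rule bounded_clinearI[where K = 1]) simp_all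

lemma bounded_clinear_scaleC: "bounded_clinear (scaleC c)"
  by (rule bounded_clinearI[where K = "cmod c"])
      (simp_all add: scaleC_add_right scaleC_scaleC mult.commute)

lemma bounded_clinear_compose:
  assumes "bounded_clinear T" "bounded_clinear U"
  shows "bounded_clinear (\<lambda>x. T (U x))"
proof -
  obtain K where "0 < K" "\<And>x. norm (T x) \<le> K * norm x"
    by (rule bounded_clinear_bound[OF assms(1)]) blast
  moreover obtain L where "\<And>x. norm (U x) \<le> L * norm x"
    by (rule bounded_clinear_bound[OF assms(2)]) blast
  ultimately have "norm (T (U x)) \<le> (K * L) * norm x" for x
    by (metis mult.assoc mult_le_cancel_left_pos order_trans)
  then show ?thesis by (intro bounded_clinearI) (simp_all add: assms[THEN bounded_clinear_simps(1)]
        assms[THEN bounded_clinear_simps(3)])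
qed

lemma bounded_clinear_add:
  assumes "bounded_clinear T" "bounded_clinear U"
  shows "bounded_clinear (\<lambda>x. T x + U x)"
proof -
  obtain K where K: "\<And>x. norm (T x) \<le> K * norm x" by (rule bounded_clinear_bound[OF assms(1)]) blast
  obtain L where L: "\<And>x. norm (U x) \<le> L * norm x" by (rule bounded_clinear_bound[OF assms(2)]) blast
  have "norm (T x + U x) \<le> (K + L) * norm x" for x
    using norm_triangle_mono[OF K L] by (simp add: distrib_right)
  then show ?thesis by (intro bounded_clinearI)
      (simp_all add: assms[THEN bounded_clinear_simps(1)] assms[THEN bounded_clinear_simps(3)]
          scaleC_add_right)
qed

lemma bounded_clinear_diff:
  assumes "bounded_clinear T" "bounded_clinear U"
  shows "bounded_clinear (\<lambda>x. T x - U x)"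
  using bounded_clinear_add[OF assms(1)
      bounded_clinear_compose[OF bounded_clinear_scaleC assms(2), of "-1"]]
  by (simp add: scaleC_minus_one)

lemma bounded_clinear_proj: "closed_csubspace M \<Longrightarrow> bounded_clinear (proj M)"
proof (rule bounded_clinearI[where K = 1])
  assume M: "closed_csubspace M"
  have swap: "cinner y (proj M x) = cinner (proj M y) x" for x y
    by (rule cinner_proj_swap[OF M, symmetric])
  show "proj M (x + y) = proj M x + proj M y" for x y
    by (rule cinner_eqI) (simp add: swap cinner_simps)
  show "proj M (scaleC c x) = scaleC c (proj M x)" for c x
    by (rule cinner_eqI) (simp add: swap cinner_simps)
  show "norm (proj M x) \<le> 1 * norm x" for x using norm_proj_le[OF M] by simp
qed

lemma closed_csubspace_Collect_eq:
  assumes "bounded_clinear T" "bounded_clinear U"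
  shows "closed_csubspace {x. T x = U x}"
  unfolding closed_csubspace_def csubspace_def
  using assms[THEN bounded_clinear_bounded_linear, THEN bounded_linear.continuous_on,
      OF continuous_on_id]
  by (auto simp: assms[THEN bounded_clinear_simps(1)] assms[THEN bounded_clinear_simps(3)]
      assms[THEN bounded_clinear_simps(6)] intro!: closed_Collect_eq)

lemma riesz_representation:
  fixes f :: "'a::chilbert \<Rightarrow> complex"
  assumes add: "\<And>x y. f (x + y) = f x + f y" and scale: "\<And>c x. f (scaleC c x) = c * f x"
    and bound: "\<And>x. cmod (f x) \<le> K * norm x"
  shows "\<exists>v. \<forall>x. f x = cinner v x"
proof (cases "\<forall>x. f x = 0")
  case False
  then obtain x0 where x0: "f x0 \<noteq> 0" by blast
  have f: "bounded_linear f"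
    by (rule bounded_linear_intro[where K = K])
      (use add scale bound in \<open>simp_all add: mult.commute scaleR_conv_of_real flip: scaleC_of_real\<close>)
  have f0: "f 0 = 0" by (rule linear_0[OF bounded_linear.linear[OF f]])
  define M where "M = {x. f x = 0}"
  have "closed M"
    unfolding M_def
    by (intro closed_Collect_eq continuous_intros bounded_linear.continuous_on[OF f])
  then have M: "closed_csubspace M"
    by (auto simp: closed_csubspace_def csubspace_def add scale f0 M_def)
  define z where "z = x0 - proj M x0"
  have z_orth: "cinner z m = 0" if "f m = 0" for m
    using orthD[OF diff_proj_in_orth[OF M], of m x0] that
    by (simp add: M_def z_def cinner_eq_zero_commute)
  have "f x0 = f (z + proj M x0)" by (simp add: z_def)
  also have "\<dots> = f z" using proj_in[OF M, of x0] by (simp add: add M_def)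
  finally have fz: "f z \<noteq> 0" using x0 by simp
  then have z: "cinner z z \<noteq> 0" using f0 by auto
  have "f x = cinner (scaleC (cnj (f z / cinner z z)) z) x" for x
  proof -
    have "cinner z (x + scaleC (- (f x / f z)) z) = 0"
      using fz by (intro z_orth) (simp add: add scale)
    then have "cinner z x = f x / f z * cinner z z" by (simp add: cinner_simps)
    then show ?thesis using fz z by (simp add: cinner_simps)
  qed
  then show ?thesis by blast
qed (auto intro: exI[of _ 0])

definition adj :: "('a::chilbert \<Rightarrow> 'a) \<Rightarrow> 'a \<Rightarrow> 'a" ("_\<^sup>\<dagger>" [1000] 1000) where
  "T\<^sup>\<dagger> y = (THE v. \<forall>x. cinner (T x) y = cinner x v)"

lemma adj_eqI:
  assumes "\<And>x y. cinner (T x) y = cinner x (U y)"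
  shows "T\<^sup>\<dagger> = U"
  unfolding adj_def by (rule ext, rule the_equality) (use assms in \<open>auto intro: cinner_eqI\<close>)

lemma adj_ident [simp]: "(\<lambda>x. x)\<^sup>\<dagger> = (\<lambda>x. x)"
  by (rule adj_eqI) simp

lemma adj_scaleC [simp]: "(scaleC c)\<^sup>\<dagger> = scaleC (cnj c)"
  by (rule adj_eqI) (simp add: cinner_simps)

lemma adj_proj: "closed_csubspace M \<Longrightarrow> (proj M)\<^sup>\<dagger> = proj M"
  by (rule adj_eqI) (rule cinner_proj_swap)

context
  fixes T :: "'a::chilbert \<Rightarrow> 'a"
  assumes T: "bounded_clinear T"
begin

lemma cinner_adj_right: "cinner x (T\<^sup>\<dagger> y) = cinner (T x) y"
proof -
  obtain K where K: "\<And>x. norm (T x) \<le> K * norm x" by (rule bounded_clinear_bound[OF T]) blast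
  have "\<exists>v. \<forall>x. cinner y (T x) = cinner v x" for y
  proof (rule riesz_representation[where K = "norm y * K"])
    fix x
    have "cmod (cinner y (T x)) \<le> norm y * norm (T x)" by (rule cinner_cauchy_schwarz)
    also have "\<dots> \<le> norm y * (K * norm x)" by (intro mult_left_mono K) auto
    finally show "cmod (cinner y (T x)) \<le> norm y * K * norm x" by (simp add: mult_ac)
  qed (simp_all add: bounded_clinear_simps[OF T] cinner_simps)
  then obtain U where "\<And>x y. cinner y (T x) = cinner (U y) x" by metis
  then have U: "cinner (T x) y = cinner x (U y)" for x y by (metis cinner_commute)
  then have "T\<^sup>\<dagger> = U" by (rule adj_eqI)
  then show ?thesis by (simp add: U)
qed

lemma cinner_adj_left: "cinner (T\<^sup>\<dagger> x) y = cinner x (T y)"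
  by (metis cinner_adj_right cinner_commute)

lemma adj_adj [simp]: "T\<^sup>\<dagger>\<^sup>\<dagger> = T"
  by (rule adj_eqI) (rule cinner_adj_left)

lemma bounded_clinear_adj: "bounded_clinear (T\<^sup>\<dagger>)"
proof -
  obtain K where K: "0 < K" "\<And>x. norm (T x) \<le> K * norm x"
    by (rule bounded_clinear_bound[OF T]) blast
  have "norm (T\<^sup>\<dagger> y) \<le> K * norm y" for y
  proof -
    have "norm (T\<^sup>\<dagger> y) * norm (T\<^sup>\<dagger> y) = Re (cinner (T (T\<^sup>\<dagger> y)) y)"
      by (simp add: norm_sq_cinner cinner_adj_right flip: power2_eq_square)
    also have "\<dots> \<le> norm (T (T\<^sup>\<dagger> y)) * norm y" by (rule Re_cinner_le)
    also have "\<dots> \<le> K * norm (T\<^sup>\<dagger> y) * norm y" by (intro mult_right_mono K) simp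
    finally have "norm (T\<^sup>\<dagger> y) * norm (T\<^sup>\<dagger> y) \<le> norm (T\<^sup>\<dagger> y) * (K * norm y)" by (simp add: mult_ac)
    then show ?thesis using K(1) by (cases "T\<^sup>\<dagger> y = 0") (simp_all add: mult_le_cancel_left)
  qed
  then show ?thesis
    by (rule bounded_clinearI[rotated 2]; intro cinner_eqI)
      (simp_all add: cinner_adj_right cinner_simps)
qed

lemma norm_sq_eq_cinner_adj: "(norm (T x))\<^sup>2 = Re (cinner (T\<^sup>\<dagger> (T x)) x)"
  by (simp add: norm_sq_cinner cinner_adj_left)

end

lemma adj_compose:
  assumes "bounded_clinear T" "bounded_clinear U"
  shows "(\<lambda>x. U (T x))\<^sup>\<dagger> = (\<lambda>x. T\<^sup>\<dagger> (U\<^sup>\<dagger> x))"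
  by (rule adj_eqI) (simp add: assms cinner_adj_right)

lemma adj_diff:
  assumes "bounded_clinear T" "bounded_clinear U"
  shows "(\<lambda>x. T x - U x)\<^sup>\<dagger> = (\<lambda>x. T\<^sup>\<dagger> x - U\<^sup>\<dagger> x)"
  by (rule adj_eqI) (simp add: assms cinner_simps cinner_adj_right)

lemma norm_adj_eq_norm:
  assumes T: "bounded_clinear T" and comm: "T (T\<^sup>\<dagger> x) = T\<^sup>\<dagger> (T x)"
  shows "norm (T\<^sup>\<dagger> x) = norm (T x)"
proof -
  have "(norm (T\<^sup>\<dagger> x))\<^sup>2 = (norm (T x))\<^sup>2"
    using norm_sq_eq_cinner_adj[OF T, of x]
        norm_sq_eq_cinner_adj[OF bounded_clinear_adj[OF T], of x]
    by (simp add: adj_adj[OF T] comm)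
  then show ?thesis by simp
qed

abbreviation shift :: "('a::chilbert \<Rightarrow> 'a) \<Rightarrow> complex \<Rightarrow> 'a \<Rightarrow> 'a" where
  "shift T z \<equiv> \<lambda>x. T x - scaleC z x"

lemma bounded_clinear_shift: "bounded_clinear T \<Longrightarrow> bounded_clinear (shift T z)"
  by (intro bounded_clinear_diff bounded_clinear_scaleC)

lemma adj_shift: "bounded_clinear T \<Longrightarrow> (shift T z)\<^sup>\<dagger> = shift (T\<^sup>\<dagger>) (cnj z)"
  by (simp add: adj_diff bounded_clinear_scaleC)

lemma shift_commute:
  assumes "bounded_clinear T" "bounded_clinear U" "T (U x) = U (T x)"
  shows "shift T z (shift U w x) = shift U w (shift T z x)"
  using assms(3)
  by (simp add: assms(1,2) bounded_clinear_simps scaleC_diff_right scaleC_scaleC mult.commute)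

lemma adj_commute:
  assumes T: "bounded_clinear T" and U: "bounded_clinear U" and comm: "\<And>x. T (U x) = U (T x)"
  shows "T\<^sup>\<dagger> (U\<^sup>\<dagger> x) = U\<^sup>\<dagger> (T\<^sup>\<dagger> x)"
  by (rule cinner_eqI) (simp add: T U comm cinner_adj_right)

section \<open>Reducing subspaces\<close>

lemma reduces_in_UNIV_iff:
  assumes T: "bounded_clinear T" and M: "closed_csubspace M"
  shows "reduces_in UNIV M T \<longleftrightarrow> (\<forall>x\<in>M. T x \<in> M \<and> T\<^sup>\<dagger> x \<in> M)"
proof (intro iffI ballI conjI)
  fix x assume red: "reduces_in UNIV M T" and x: "x \<in> M"
  then show "T x \<in> M" by (auto simp: reduces_in_def)
  have "T y \<in> orth M" if "y \<in> orth M" for y using red that by (auto simp: reduces_in_def)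
  then have "T\<^sup>\<dagger> x \<in> orth (orth M)"
    using x by (simp add: orth_in_def cinner_adj_right[OF T]) (metis cinner_eq_zero_commute)
  then show "T\<^sup>\<dagger> x \<in> M" by (simp add: orth_orth[OF M])
next
  assume "\<forall>x\<in>M. T x \<in> M \<and> T\<^sup>\<dagger> x \<in> M"
  then show "reduces_in UNIV M T"
    by (auto simp: reduces_in_def orth_in_def cinner_adj_left[OF T, symmetric])
qed

lemma reduces_in_UNIV_D:
  assumes "reduces_in UNIV M T"
  shows "x \<in> M \<Longrightarrow> T x \<in> M" "x \<in> orth M \<Longrightarrow> T x \<in> orth M"
  using assms by (auto simp: reduces_in_def)

lemma reduces_in_UNIV_adj:
  "bounded_clinear T \<Longrightarrow> closed_csubspace M \<Longrightarrow> reduces_in UNIV M T \<Longrightarrow> reduces_in UNIV M (T\<^sup>\<dagger>)"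
  by (simp add: reduces_in_UNIV_iff bounded_clinear_adj)

lemma reduces_in_UNIV_orth:
  "closed_csubspace M \<Longrightarrow> reduces_in UNIV M T \<Longrightarrow> reduces_in UNIV (orth M) T"
  by (simp add: reduces_in_def orth_orth)

lemma reduces_in_UNIV_Int:
  assumes "bounded_clinear T" "closed_csubspace M" "closed_csubspace N"
    "reduces_in UNIV M T" "reduces_in UNIV N T"
  shows "reduces_in UNIV (M \<inter> N) T"
  using assms by (simp add: reduces_in_UNIV_iff closed_csubspace_Int)

lemma reduces_in_UNIV_shift:
  assumes "csubspace M" "reduces_in UNIV M T"
  shows "reduces_in UNIV M (shift T z)"
proof -
  have "csubspace (orth M)" by (rule closed_csubspaceD(1)[OF closed_csubspace_orth])
  then show ?thesis
    using assms
    by (auto simp: reduces_in_def image_subset_iff intro!: subspace_diff csubspace_imp_subspace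
        csubspace_scaleC)
qed

lemma proj_commute:
  assumes T: "bounded_clinear T" and M: "closed_csubspace M" and red: "reduces_in UNIV M T"
  shows "proj M (T x) = T (proj M x)"
proof -
  have "proj M (T (proj M x) + T (x - proj M x)) = T (proj M x)"
    by (intro proj_add_orth[OF M] reduces_in_UNIV_D[OF red] proj_in[OF M] diff_proj_in_orth[OF M])
  then show ?thesis by (simp flip: bounded_clinear_simps(1)[OF T])
qed

lemma reduces_in_trans:
  assumes T: "bounded_clinear T" and H: "closed_csubspace H" "reduces_in UNIV H T"
    and N: "reduces_in H N T"
  shows "reduces_in UNIV N T"
proof -
  have NH: "N \<subseteq> H" using N by (simp add: reduces_in_def)
  have "T x \<in> orth N" if x: "x \<in> orth N" for x
  proof -
    have "proj H x \<in> orth_in H N"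
      using x NH proj_in[OF H(1)] by (auto simp: orth_in_def cinner_proj_right[OF H(1)])
    then have "T (proj H x) \<in> orth N" using N by (auto simp: reduces_in_def orth_in_def)
    moreover have "T (x - proj H x) \<in> orth N"
      using reduces_in_UNIV_D(2)[OF H(2) diff_proj_in_orth[OF H(1)]] NH by (auto simp: orth_in_def)
    ultimately have "T (proj H x) + T (x - proj H x) \<in> orth N"
      by (rule subspace_add[OF closed_csubspaceD(2)[OF closed_csubspace_orth]])
    then show ?thesis by (simp flip: bounded_clinear_simps(1)[OF T])
  qed
  then show ?thesis using N by (auto simp: reduces_in_def)
qed

lemma normal_on_iff:
  assumes T: "bounded_clinear T" and M: "closed_csubspace M" and red: "reduces_in UNIV M T"
  shows "normal_on M T \<longleftrightarrow> (\<forall>x\<in>M. T (T\<^sup>\<dagger> x) = T\<^sup>\<dagger> (T x))"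
proof
  have inv: "T x \<in> M" "T\<^sup>\<dagger> x \<in> M" if "x \<in> M" for x
    using red that by (auto simp: reduces_in_UNIV_iff[OF T M])
  show "normal_on M T" if "\<forall>x\<in>M. T (T\<^sup>\<dagger> x) = T\<^sup>\<dagger> (T x)"
  proof -
    have "bounded_clinear_on M T" using T inv by (auto simp: bounded_clinear_on_def)
    then show ?thesis
      unfolding normal_on_def using inv that
      by (intro conjI exI[of _ "T\<^sup>\<dagger>"]) (auto simp: cinner_adj_right[OF T])
  qed
  assume "normal_on M T"
  then obtain T' where T': "T' ` M \<subseteq> M" "\<And>x y. x \<in> M \<Longrightarrow> y \<in> M \<Longrightarrow> cinner (T x) y = cinner x (T' y)"
    "\<And>x. x \<in> M \<Longrightarrow> T (T' x) = T' (T x)" by (auto simp: normal_on_def)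
  have "T' y = T\<^sup>\<dagger> y" if y: "y \<in> M" for y
  proof -
    let ?v = "T' y - T\<^sup>\<dagger> y"
    have "?v \<in> M" using T'(1) inv y by (intro subspace_diff[OF closed_csubspaceD(2)[OF M]]) auto
    then have "cinner ?v ?v = 0"
      using T'(2)[of ?v y] y by (simp add: cinner_diff_right cinner_adj_right[OF T])
    then show ?thesis by simp
  qed
  then show "\<forall>x\<in>M. T (T\<^sup>\<dagger> x) = T\<^sup>\<dagger> (T x)" using T'(3) inv by metis
qed

lemma normal_on_UNIV_iff:
  fixes T :: "'a::chilbert \<Rightarrow> 'a"
  shows "normal_on UNIV T \<longleftrightarrow> bounded_clinear T \<and> (\<forall>x. T (T\<^sup>\<dagger> x) = T\<^sup>\<dagger> (T x))"
proof -
  have UNIV: "closed_csubspace (UNIV :: 'a set)" by (simp add: closed_csubspace_def csubspace_def)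
  have "normal_on UNIV T \<longleftrightarrow> (\<forall>x. T (T\<^sup>\<dagger> x) = T\<^sup>\<dagger> (T x))" if "bounded_clinear T"
    using normal_on_iff[OF that UNIV] by (simp add: reduces_in_UNIV_iff[OF that UNIV])
  moreover have "normal_on UNIV T \<Longrightarrow> bounded_clinear T" by (simp add: normal_on_def)
  ultimately show ?thesis by blast
qed

section \<open>Splitting the space by the sign of a self-adjoint operator\<close>

text \<open>The square root of \<open>1 - W\<close> is \<open>1 - Y\<close>, where \<open>Y\<close> is the fixed point of the map
  \<open>Y \<mapsto> (W + Y\<^sup>2) / 2\<close> reached from 0. The same recursion for \<open>W = 1\<close> in the reals bounds the
  iterates.\<close>

primrec sqrt_iter :: "('a::chilbert \<Rightarrow> 'a) \<Rightarrow> nat \<Rightarrow> 'a \<Rightarrow> 'a" where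
  "sqrt_iter W 0 = (\<lambda>x. 0)"
| "sqrt_iter W (Suc n) = (\<lambda>x. (1/2) *\<^sub>R (W x + sqrt_iter W n (sqrt_iter W n x)))"

primrec sqrt_iter_bound :: "nat \<Rightarrow> real" where
  "sqrt_iter_bound 0 = 0"
| "sqrt_iter_bound (Suc n) = (1 + (sqrt_iter_bound n)\<^sup>2) / 2"

lemma sqrt_iter_bound_nonneg: "0 \<le> sqrt_iter_bound n"
  by (induction n) auto

lemma sqrt_iter_bound_le_1: "sqrt_iter_bound n \<le> 1"
  by (induction n) (auto simp: power_le_one sqrt_iter_bound_nonneg)

lemma sqrt_iter_bound_mono: "m \<le> n \<Longrightarrow> sqrt_iter_bound m \<le> sqrt_iter_bound n"
proof (rule lift_Suc_mono_le)
  fix n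
  have "0 \<le> (1 - sqrt_iter_bound n)\<^sup>2" by simp
  then show "sqrt_iter_bound n \<le> sqrt_iter_bound (Suc n)"
    by (simp add: power2_eq_square algebra_simps)
qed

lemma Cauchy_sqrt_iter_bound: "Cauchy sqrt_iter_bound"
  by (intro convergent_Cauchy Bseq_monoseq_convergent)
    (auto intro!: BseqI'[where K = 1] monoI1 sqrt_iter_bound_mono
      simp: sqrt_iter_bound_nonneg sqrt_iter_bound_le_1)

definition sqrt_one_minus :: "('a::chilbert \<Rightarrow> 'a) \<Rightarrow> 'a \<Rightarrow> 'a" where
  "sqrt_one_minus W x = x - lim (\<lambda>n. sqrt_iter W n x)"

lemma bounded_clinear_sqrt_iter: "bounded_clinear W \<Longrightarrow> bounded_clinear (sqrt_iter W n)"
proof (induction n)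
  case 0
  show ?case by (rule bounded_clinearI[where K = 0]) simp_all
next
  case (Suc n)
  have "bounded_clinear (\<lambda>x. scaleC (1/2) (W x + sqrt_iter W n (sqrt_iter W n x)))"
    by (rule bounded_clinear_compose[OF bounded_clinear_scaleC
          bounded_clinear_add[OF Suc.prems
              bounded_clinear_compose[OF Suc.IH[OF Suc.prems] Suc.IH[OF Suc.prems]]]])
  then show ?case using scaleC_of_real[where r = "1/2" and 'a = 'a] by simp
qed

lemma sqrt_iter_commute:
  assumes "bounded_clinear X" "\<And>x. X (W x) = W (X x)"
  shows "X (sqrt_iter W n x) = sqrt_iter W n (X x)"
  by (induction n arbitrary: x) (simp_all add: assms bounded_clinear_simps)

context
  fixes W :: "'a::chilbert \<Rightarrow> 'a"
  assumes W: "bounded_clinear W" and contraction: "\<And>x. norm (W x) \<le> norm x"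
begin

lemma norm_sqrt_iter_le: "norm (sqrt_iter W n x) \<le> sqrt_iter_bound n * norm x"
proof (induction n arbitrary: x)
  case (Suc n)
  have "norm (sqrt_iter W n (sqrt_iter W n x)) \<le> sqrt_iter_bound n * (sqrt_iter_bound n * norm x)"
    using Suc[of "sqrt_iter W n x"] Suc[of x] sqrt_iter_bound_nonneg[of n]
    by (meson mult_left_mono order_trans)
  then have "norm (W x + sqrt_iter W n (sqrt_iter W n x))
      \<le> norm x + sqrt_iter_bound n * (sqrt_iter_bound n * norm x)"
    using contraction[of x] norm_triangle_mono by blast
  then show ?case by (simp add: power2_eq_square distrib_right mult.assoc)
qed simp

lemma norm_sqrt_iter_le_norm: "norm (sqrt_iter W n x) \<le> norm x"
  using norm_sqrt_iter_le[of n x] mult_right_mono[OF sqrt_iter_bound_le_1[of n] norm_ge_zero[of x]]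
  by simp

lemma norm_sqrt_iter_Suc_diff_le:
  "norm (sqrt_iter W (Suc n) x - sqrt_iter W n x)
      \<le> (sqrt_iter_bound (Suc n) - sqrt_iter_bound n) * norm x"
proof (induction n arbitrary: x)
  case 0
  then show ?case using contraction[of x] by simp
next
  case (Suc n)
  define U where "U = sqrt_iter W (Suc n)"
  define V where "V = sqrt_iter W n"
  define a where "a = sqrt_iter_bound (Suc n)"
  define b where "b = sqrt_iter_bound n"
  have IH: "norm (U y - V y) \<le> (a - b) * norm y" for y
    unfolding U_def V_def a_def b_def by (rule Suc)
  have ab: "0 \<le> a" "0 \<le> a - b"
    using sqrt_iter_bound_nonneg[of "Suc n"] sqrt_iter_bound_mono[of n "Suc n"]
    by (simp_all add: a_def b_def)
  have "sqrt_iter W (Suc (Suc n)) x = (1/2) *\<^sub>R (W x + U (U x))"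
    unfolding U_def by (rule sqrt_iter.simps(2)[THEN fun_cong])
  moreover have "U x = (1/2) *\<^sub>R (W x + V (V x))" by (simp add: U_def V_def)
  ultimately have "sqrt_iter W (Suc (Suc n)) x - sqrt_iter W (Suc n) x
      = (1/2) *\<^sub>R ((W x + U (U x)) - (W x + V (V x)))"
    unfolding U_def[symmetric] scaleR_diff_right by (rule arg_cong2)
  also have "(W x + U (U x)) - (W x + V (V x)) = U (U x - V x) + (U (V x) - V (V x))"
    by (simp add: bounded_clinear_simps(2)[OF bounded_clinear_sqrt_iter[OF W, of "Suc n"],
        folded U_def])
  also have "norm ((1/2) *\<^sub>R \<dots>) \<le> (1/2) * (norm (U (U x - V x)) + norm (U (V x) - V (V x)))"
    by (simp add: norm_triangle_ineq)
  also have "\<dots> \<le> (1/2) * (a * ((a - b) * norm x) + (a - b) * (b * norm x))"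
  proof (intro mult_left_mono add_mono)
    have "norm (U (U x - V x)) \<le> a * norm (U x - V x)"
      unfolding a_def U_def by (rule norm_sqrt_iter_le)
    also have "\<dots> \<le> a * ((a - b) * norm x)" using ab by (intro mult_left_mono IH)
    finally show "norm (U (U x - V x)) \<le> a * ((a - b) * norm x)" .
    have "norm (U (V x) - V (V x)) \<le> (a - b) * norm (V x)" by (rule IH)
    also have "\<dots> \<le> (a - b) * (b * norm x)"
      unfolding V_def b_def using ab(2)
      by (intro mult_left_mono norm_sqrt_iter_le) (simp add: b_def)
    finally show "norm (U (V x) - V (V x)) \<le> (a - b) * (b * norm x)" .
  qed simp
  also have "\<dots> = ((1 + a\<^sup>2) / 2 - (1 + b\<^sup>2) / 2) * norm x"
    by (simp add: power2_eq_square algebra_simps)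
  finally show ?case by (simp add: a_def b_def)
qed

lemma norm_sqrt_iter_diff_le:
  "n \<le> m \<Longrightarrow> norm (sqrt_iter W m x - sqrt_iter W n x)
      \<le> (sqrt_iter_bound m - sqrt_iter_bound n) * norm x"
proof (induction m rule: dec_induct)
  case (step m)
  have "norm (sqrt_iter W (Suc m) x - sqrt_iter W n x)
     \<le> norm (sqrt_iter W (Suc m) x - sqrt_iter W m x) + norm (sqrt_iter W m x - sqrt_iter W n x)"
    by (rule norm_diff_triangle_le[OF order_refl order_refl])
  also have "\<dots> \<le> (sqrt_iter_bound (Suc m) - sqrt_iter_bound m) * norm x
      + (sqrt_iter_bound m - sqrt_iter_bound n) * norm x"
    by (rule add_mono[OF norm_sqrt_iter_Suc_diff_le step.IH])
  finally show ?case by (simp only: algebra_simps)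
qed simp

lemma sqrt_iter_tendsto: "(\<lambda>n. sqrt_iter W n x) \<longlonglongrightarrow> x - sqrt_one_minus W x"
proof -
  have dist_le:
      "dist (sqrt_iter W m x) (sqrt_iter W n x)
      \<le> dist (sqrt_iter_bound m) (sqrt_iter_bound n) * norm x"
    for m n
  proof (induction m n rule: linorder_wlog)
    case (le n m)
    then show ?case
      using norm_sqrt_iter_diff_le[OF le] sqrt_iter_bound_mono[OF le]
      by (simp add: dist_norm dist_real_def norm_minus_commute)
  qed (simp add: dist_commute)
  have "Cauchy (\<lambda>n. sqrt_iter W n x)"
  proof (rule metric_CauchyI)
    fix e :: real assume "0 < e"
    define d where "d = e / (norm x + 1)"
    have "0 < d" using \<open>0 < e\<close> by (simp add: d_def add_nonneg_pos)
    then obtain N where N: "\<And>m n. m \<ge> N \<Longrightarrow> n \<ge> N \<Longrightarrow> dist (sqrt_iter_bound m) (sqrt_iter_bound n) < d"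
      using metric_CauchyD[OF Cauchy_sqrt_iter_bound] by blast
    have "dist (sqrt_iter W m x) (sqrt_iter W n x) < e" if "m \<ge> N" "n \<ge> N" for m n
    proof -
      have "dist (sqrt_iter W m x) (sqrt_iter W n x) \<le> d * norm x"
        using dist_le[of m n] mult_right_mono[OF less_imp_le[OF N[OF that]] norm_ge_zero[of x]]
        by simp
      also have "\<dots> < d * (norm x + 1)" using \<open>0 < d\<close> by simp
      also have "\<dots> = e" unfolding d_def using norm_ge_zero[of x] by (simp add: add_nonneg_eq_0_iff)
      finally show ?thesis .
    qed
    then show "\<exists>N. \<forall>m\<ge>N. \<forall>n\<ge>N. dist (sqrt_iter W m x) (sqrt_iter W n x) < e" by blast
  qed
  then show ?thesis by (simp add: sqrt_one_minus_def Cauchy_convergent_iff convergent_LIMSEQ_iff)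
qed

lemma norm_diff_sqrt_one_minus_le: "norm (x - sqrt_one_minus W x) \<le> norm x"
  by (rule tendsto_upperbound[OF tendsto_norm[OF sqrt_iter_tendsto]])
      (simp_all add: norm_sqrt_iter_le_norm)

lemma bounded_clinear_sqrt_one_minus: "bounded_clinear (sqrt_one_minus W)"
proof -
  note lin = bounded_clinear_simps[OF bounded_clinear_sqrt_iter[OF W]]
  have "bounded_clinear (\<lambda>x. x - sqrt_one_minus W x)"
  proof (rule bounded_clinearI[where K = 1])
    show "x + y - sqrt_one_minus W (x + y) = x - sqrt_one_minus W x + (y - sqrt_one_minus W y)"
      for x y
      by (rule LIMSEQ_unique[OF sqrt_iter_tendsto]) (simp only: lin tendsto_add sqrt_iter_tendsto)
    show "scaleC c x - sqrt_one_minus W (scaleC c x) = scaleC c (x - sqrt_one_minus W x)" for c x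
      by (rule LIMSEQ_unique[OF sqrt_iter_tendsto])
        (simp only: lin bounded_linear.tendsto[OF bounded_linear_scaleC] sqrt_iter_tendsto)
  qed (simp add: norm_diff_sqrt_one_minus_le)
  from bounded_clinear_diff[OF bounded_clinear_ident this] show ?thesis by simp
qed

lemma sqrt_one_minus_commute:
  assumes X: "bounded_clinear X" and "\<And>x. X (W x) = W (X x)"
  shows "X (sqrt_one_minus W x) = sqrt_one_minus W (X x)"
proof -
  have "X (x - sqrt_one_minus W x) = X x - sqrt_one_minus W (X x)"
  proof (rule LIMSEQ_unique)
    show "(\<lambda>n. X (sqrt_iter W n x)) \<longlonglongrightarrow> X (x - sqrt_one_minus W x)"
      by (rule bounded_linear.tendsto[OF bounded_clinear_bounded_linear[OF X] sqrt_iter_tendsto])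
    show "(\<lambda>n. X (sqrt_iter W n x)) \<longlonglongrightarrow> X x - sqrt_one_minus W (X x)"
      using sqrt_iter_tendsto by (simp add: sqrt_iter_commute[of X W, OF assms])
  qed
  then show ?thesis by (simp add: bounded_clinear_simps[OF X])
qed

lemma sqrt_one_minus_square: "sqrt_one_minus W (sqrt_one_minus W x) = x - W x"
proof -
  define Y where "Y x = x - sqrt_one_minus W x" for x
  note lim = sqrt_iter_tendsto[folded Y_def]
  have "Y x = (1/2) *\<^sub>R (W x + Y (Y x))"
  proof (rule LIMSEQ_unique[OF LIMSEQ_Suc[OF lim]])
    have "(\<lambda>n. norm (sqrt_iter W n x - Y x)) \<longlonglongrightarrow> 0"
      by (intro tendsto_norm_zero LIM_zero lim)
    then have "(\<lambda>n. sqrt_iter W n (sqrt_iter W n x - Y x)) \<longlonglongrightarrow> 0"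
      by (rule Lim_null_comparison[rotated]) (simp add: norm_sqrt_iter_le_norm)
    from tendsto_add[OF this lim[of "Y x"]] have "(\<lambda>n. sqrt_iter W n (sqrt_iter W n x)) \<longlonglongrightarrow> Y (Y x)"
      by (simp add: bounded_clinear_simps[OF bounded_clinear_sqrt_iter[OF W]])
    then show "(\<lambda>n. sqrt_iter W (Suc n) x) \<longlonglongrightarrow> (1/2) *\<^sub>R (W x + Y (Y x))"
      unfolding sqrt_iter.simps by (intro tendsto_scaleR tendsto_add tendsto_const)
  qed
  then have "2 *\<^sub>R Y x = W x + Y (Y x)" by (metis scaleR_half_double scaleR_2 scaleR_add_right)
  then show ?thesis
    by (simp add: Y_def scaleR_2 bounded_clinear_simps[OF bounded_clinear_sqrt_one_minus]
        algebra_simps)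
qed

lemma sqrt_one_minus_nonneg: "0 \<le> Re (cinner (sqrt_one_minus W x) x)"
proof -
  have "Re (cinner (x - sqrt_one_minus W x) x) \<le> norm (x - sqrt_one_minus W x) * norm x"
    by (rule Re_cinner_le)
  also have "\<dots> \<le> norm x * norm x" by (intro mult_right_mono norm_diff_sqrt_one_minus_le) simp
  finally show ?thesis by (simp add: cinner_simps cinner_self_norm power2_eq_square)
qed

lemma sqrt_one_minus_eq_0:
  assumes "Re (cinner (sqrt_one_minus W x) x) = 0"
  shows "sqrt_one_minus W x = 0"
proof -
  have "(norm (sqrt_one_minus W x))\<^sup>2 + (norm x)\<^sup>2 = (norm (x - sqrt_one_minus W x))\<^sup>2"
    using assms by (simp add: norm_diff_sq Re_cinner_commute[of x])
  also have "\<dots> \<le> (norm x)\<^sup>2" by (rule power_mono[OF norm_diff_sqrt_one_minus_le]) simp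
  finally show ?thesis by simp
qed

lemma adj_sqrt_one_minus:
  assumes "W\<^sup>\<dagger> = W"
  shows "(sqrt_one_minus W)\<^sup>\<dagger> = sqrt_one_minus W"
proof (rule adj_eqI)
  have W_swap: "cinner (W x) y = cinner x (W y)" for x y using cinner_adj_right[OF W] assms by simp
  have iter_swap: "cinner (sqrt_iter W n x) y = cinner x (sqrt_iter W n y)" for n x y
    by (induction n arbitrary: x y) (simp_all add: cinner_simps W_swap)
  fix x y
  have "cinner (x - sqrt_one_minus W x) y = cinner x (y - sqrt_one_minus W y)"
  proof (rule LIMSEQ_unique)
    show "(\<lambda>n. cinner (sqrt_iter W n x) y) \<longlonglongrightarrow> cinner (x - sqrt_one_minus W x) y"
      by (rule bounded_linear.tendsto[OF bounded_linear_cinner_left sqrt_iter_tendsto])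
    show "(\<lambda>n. cinner (sqrt_iter W n x) y) \<longlonglongrightarrow> cinner x (y - sqrt_one_minus W y)"
      unfolding iter_swap
      by (rule bounded_linear.tendsto[OF bounded_linear_cinner_right sqrt_iter_tendsto])
  qed
  then show "cinner (sqrt_one_minus W x) y = cinner x (sqrt_one_minus W y)"
    by (simp add: cinner_simps)
qed

end

definition absolute_value :: "('a::chilbert \<Rightarrow> 'a) \<Rightarrow> 'a \<Rightarrow> 'a" where
  "absolute_value C = sqrt_one_minus (\<lambda>x. x - C (C x))"

context
  fixes C :: "'a::chilbert \<Rightarrow> 'a"
  assumes C: "bounded_clinear C" "C\<^sup>\<dagger> = C" and contraction: "\<And>x. norm (C x) \<le> norm x"
begin

lemma bounded_clinear_diff_square: "bounded_clinear (\<lambda>x. x - C (C x))"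
  by (rule bounded_clinear_diff[OF bounded_clinear_ident bounded_clinear_compose[OF C(1) C(1)]])

lemma norm_diff_square_le: "norm (x - C (C x)) \<le> norm x"
proof -
  have "(norm (x - C (C x)))\<^sup>2 = (norm x)\<^sup>2 - 2 * (norm (C x))\<^sup>2 + (norm (C (C x)))\<^sup>2"
    using cinner_adj_right[OF C(1), of x "C x"] by (simp add: norm_diff_sq C(2) cinner_self_norm)
  also have "\<dots> \<le> (norm x)\<^sup>2"
    using power_mono[OF contraction[of "C x"] norm_ge_zero, of 2] zero_le_power2[of "norm (C x)"]
    by linarith
  finally show ?thesis by (simp add: power2_le_iff_abs_le)
qed

lemma bounded_clinear_absolute_value: "bounded_clinear (absolute_value C)"
  unfolding absolute_value_def
  by (rule bounded_clinear_sqrt_one_minus[OF bounded_clinear_diff_square norm_diff_square_le])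

lemma adj_absolute_value: "(absolute_value C)\<^sup>\<dagger> = absolute_value C"
  unfolding absolute_value_def
proof (rule adj_sqrt_one_minus[OF bounded_clinear_diff_square norm_diff_square_le])
  show "(\<lambda>x. x - C (C x))\<^sup>\<dagger> = (\<lambda>x. x - C (C x))"
    by (simp add: adj_diff bounded_clinear_ident bounded_clinear_compose[OF C(1) C(1)]
        adj_compose C)
qed

lemma absolute_value_square: "absolute_value C (absolute_value C x) = C (C x)"
  unfolding absolute_value_def
  by (simp add: sqrt_one_minus_square[OF bounded_clinear_diff_square norm_diff_square_le])

lemma absolute_value_commute:
  assumes X: "bounded_clinear X" "\<And>y. X (C y) = C (X y)"
  shows "X (absolute_value C x) = absolute_value C (X x)"
  unfolding absolute_value_def
  by (rule sqrt_one_minus_commute[OF bounded_clinear_diff_square norm_diff_square_le X(1)])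
    (simp add: X(2) bounded_clinear_simps[OF X(1)])

lemma absolute_value_nonneg: "0 \<le> Re (cinner (absolute_value C x) x)"
  unfolding absolute_value_def
  by (rule sqrt_one_minus_nonneg[OF bounded_clinear_diff_square norm_diff_square_le])

lemma absolute_value_eq_0: "Re (cinner (absolute_value C x) x) = 0 \<Longrightarrow> absolute_value C x = 0"
  unfolding absolute_value_def
  by (rule sqrt_one_minus_eq_0[OF bounded_clinear_diff_square norm_diff_square_le])

lemma absolute_value_eq_on_orth:
  assumes "x \<in> orth {x. absolute_value C x + C x = 0}"
  shows "absolute_value C x = C x"
proof -
  note R = bounded_clinear_absolute_value
  have "absolute_value C (absolute_value C y - C y) + C (absolute_value C y - C y) = 0" for y
    by (simp add: bounded_clinear_simps[OF C(1)] bounded_clinear_simps[OF R] absolute_value_square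
        absolute_value_commute[OF C(1) refl])
  then have "cinner (absolute_value C y - C y) x = 0" for y using orthD[OF assms] by simp
  then have "cinner y (absolute_value C x - C x) = 0" for y
    using C R adj_absolute_value by (simp add: cinner_simps flip: cinner_adj_right)
  then show ?thesis by (metis cinner_self_eq_zero eq_iff_diff_eq_0)
qed

lemma sign_splitting_contraction:
  obtains M where "closed_csubspace M"
    "\<And>x. x \<in> M \<Longrightarrow> Re (cinner (C x) x) \<le> 0"
    "\<And>x. x \<in> orth M \<Longrightarrow> x \<noteq> 0 \<Longrightarrow> 0 < Re (cinner (C x) x)"
    "\<And>X x. bounded_clinear X \<Longrightarrow> (\<And>y. X (C y) = C (X y)) \<Longrightarrow> x \<in> M \<Longrightarrow> X x \<in> M"
proof -
  define R where "R = absolute_value C"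
  note R = bounded_clinear_absolute_value[folded R_def]
    and R_commute = absolute_value_commute[folded R_def]
    and R_nonneg = absolute_value_nonneg[folded R_def]
    and R_eq_0 = absolute_value_eq_0[folded R_def]
  define M where "M = {x. R x + C x = 0}"
  have "M = {x. R x + C x = scaleC 0 x}" by (simp add: M_def)
  also have "closed_csubspace \<dots>"
    by (rule closed_csubspace_Collect_eq[OF bounded_clinear_add[OF R C(1)] bounded_clinear_scaleC])
  finally show thesis
  proof (rule that)
    show "Re (cinner (C x) x) \<le> 0" if "x \<in> M" for x
      using that R_nonneg[of x] by (simp add: M_def add_eq_0_iff[of "R x"])
    show "0 < Re (cinner (C x) x)" if x: "x \<in> orth M" "x \<noteq> 0" for x
    proof -
      have RC: "R x = C x"
        using x(1) unfolding M_def R_def by (rule absolute_value_eq_on_orth)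
      have "R x \<noteq> 0"
      proof
        assume "R x = 0"
        then have "x \<in> M" using RC by (simp add: M_def)
        then show False using orthD[OF x(1)] x(2) by force
      qed
      then show ?thesis
        using R_nonneg[of x] R_eq_0[of x] unfolding RC[symmetric] by linarith
    qed
    show "X x \<in> M" if X: "bounded_clinear X" "\<And>y. X (C y) = C (X y)" and x: "x \<in> M" for X x
    proof -
      have "R (X x) + C (X x) = X (R x + C x)"
        by (simp add: bounded_clinear_simps(1)[OF X(1)] R_commute[OF X] X(2))
      also have "\<dots> = 0" using x by (simp add: M_def bounded_clinear_simps(6)[OF X(1)])
      finally show ?thesis by (simp add: M_def)
    qed
  qed
qed

end

lemma sign_splitting:
  fixes B :: "'a::chilbert \<Rightarrow> 'a"
  assumes B: "bounded_clinear B" "B\<^sup>\<dagger> = B"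
  obtains M where "closed_csubspace M"
    "\<And>x. x \<in> M \<Longrightarrow> Re (cinner (B x) x) \<le> 0"
    "\<And>x. x \<in> orth M \<Longrightarrow> x \<noteq> 0 \<Longrightarrow> 0 < Re (cinner (B x) x)"
    "\<And>X x. bounded_clinear X \<Longrightarrow> (\<And>y. X (B y) = B (X y)) \<Longrightarrow> x \<in> M \<Longrightarrow> X x \<in> M"
proof -
  obtain K where K: "0 < K" "\<And>x. norm (B x) \<le> K * norm x"
    by (rule bounded_clinear_bound[OF B(1)]) blast
  define C where "C x = scaleC (of_real (1/K)) (B x)" for x
  have C: "bounded_clinear C"
    unfolding C_def by (rule bounded_clinear_compose[OF bounded_clinear_scaleC B(1)])
  have C_adj: "C\<^sup>\<dagger> = C"
    unfolding C_def[abs_def] adj_compose[OF B(1) bounded_clinear_scaleC] using B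
    by (simp add: bounded_clinear_simps)
  have C_contraction: "norm (C x) \<le> norm x" for x
    using K by (simp add: C_def norm_divide field_simps)
  have C_form: "Re (cinner (C x) x) = Re (cinner (B x) x) / K" for x
    by (simp add: C_def cinner_simps Re_divide_of_real)
  obtain M where M: "closed_csubspace M"
    "\<And>x. x \<in> M \<Longrightarrow> Re (cinner (C x) x) \<le> 0"
    "\<And>x. x \<in> orth M \<Longrightarrow> x \<noteq> 0 \<Longrightarrow> 0 < Re (cinner (C x) x)"
    "\<And>X x. bounded_clinear X \<Longrightarrow> (\<And>y. X (C y) = C (X y)) \<Longrightarrow> x \<in> M \<Longrightarrow> X x \<in> M"
    by (rule sign_splitting_contraction[OF C C_adj C_contraction]) blast
  show thesis
  proof (rule that[OF M(1)])
    show "X x \<in> M" if X: "bounded_clinear X" "\<And>y. X (B y) = B (X y)" and x: "x \<in> M" for X x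
      using M(4)[OF X(1) _ x] by (simp add: C_def bounded_clinear_simps[OF X(1)] X(2))
  qed (use M(2,3) K(1) C_form in \<open>simp_all add: zero_less_divide_iff divide_le_0_iff\<close>)
qed

section \<open>Spectral subspaces of normal operators\<close>

lemma log_convex_imp_geometric_growth:
  fixes a :: "nat \<Rightarrow> real"
  assumes nonneg: "\<And>n. 0 \<le> a n" and conv: "\<And>n. (a (Suc n))\<^sup>2 \<le> a n * a (Suc (Suc n))"
    and pos: "0 < a 0"
  shows "a 0 * (a 1 / a 0) ^ n \<le> a n"
proof -
  define q where "q = a 1 / a 0"
  have q: "0 \<le> q" using nonneg by (simp add: q_def)
  have ratio: "q * a n \<le> a (Suc n)" for n
  proof (induction n)
    case 0
    show ?case using pos by (simp add: q_def)
  next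
    case (Suc n)
    show ?case
    proof (cases "a n = 0")
      case True
      then have "a (Suc n) = 0" using conv[of n] by simp
      then show ?thesis by (simp add: nonneg)
    next
      case False
      have "a n * (q * a (Suc n)) = (q * a n) * a (Suc n)" by simp
      also have "\<dots> \<le> a (Suc n) * a (Suc n)" by (intro mult_right_mono Suc nonneg)
      also have "\<dots> \<le> a n * a (Suc (Suc n))" using conv[of n] by (simp add: power2_eq_square)
      finally show ?thesis using False nonneg[of n] by (simp add: mult_le_cancel_left)
    qed
  qed
  show ?thesis
    unfolding q_def[symmetric]
  proof (induction n)
    case (Suc n)
    have "a 0 * q ^ Suc n = q * (a 0 * q ^ n)" by simp
    also have "\<dots> \<le> q * a n" by (intro mult_left_mono Suc q)
    also have "\<dots> \<le> a (Suc n)" by (rule ratio)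
    finally show ?case .
  qed simp
qed

lemma log_convex_first_ratio_le:
  fixes a :: "nat \<Rightarrow> real"
  assumes nonneg: "\<And>n. 0 \<le> a n" and conv: "\<And>n. (a (Suc n))\<^sup>2 \<le> a n * a (Suc (Suc n))"
    and bound: "\<And>n. a n \<le> C * r ^ n" and r: "0 \<le> r"
  shows "a 1 \<le> r * a 0"
proof (cases "a 0 = 0 \<or> r = 0")
  case True
  then show ?thesis using conv[of 0] bound[of 1] by auto
next
  case False
  then have a0: "0 < a 0" and r0: "0 < r" using nonneg[of 0] r by auto
  show ?thesis
  proof (rule ccontr)
    assume "\<not> ?thesis"
    then have "1 < a 1 / a 0 / r" using a0 r0 by (simp add: field_simps)
    then obtain n where "C / a 0 < (a 1 / a 0 / r) ^ n" using real_arch_pow by blast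
    then have "C * r ^ n < a 0 * (a 1 / a 0) ^ n"
      using a0 r0 by (simp add: power_divide field_simps)
    with log_convex_imp_geometric_growth[OF nonneg conv a0, of n] bound[of n] show False by simp
  qed
qed

text \<open>The spectral subspace of a normal operator for the closed disc of radius \<open>r\<close> about 0. The
  definition by growth makes it invariant under all operators that commute with \<open>D\<close>, and since
  \<open>D\<close> and \<open>D\<^sup>\<dagger>\<close> have the same growth, also under their adjoints; this replaces Fuglede's
  theorem.\<close>

definition disc_subspace :: "('a::chilbert \<Rightarrow> 'a) \<Rightarrow> real \<Rightarrow> 'a set" where
  "disc_subspace D r = {x. \<exists>C. \<forall>n. norm ((D ^^ n) x) \<le> C * r ^ n}"

lemma funpow_commute_apply: "(\<And>x. X (D x) = D (X x)) \<Longrightarrow> X ((D ^^ n) x) = (D ^^ n) (X x)"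
  by (induction n arbitrary: x) auto

lemma disc_subspace_diff:
  assumes D: "bounded_clinear D" and "x \<in> disc_subspace D r" "y \<in> disc_subspace D r"
  shows "x - y \<in> disc_subspace D r"
proof -
  obtain B C where "\<And>n. norm ((D ^^ n) x) \<le> B * r ^ n" "\<And>n. norm ((D ^^ n) y) \<le> C * r ^ n"
    using assms by (auto simp: disc_subspace_def)
  moreover have "(D ^^ n) (x - y) = (D ^^ n) x - (D ^^ n) y" for n
    by (induction n arbitrary: x y) (simp_all add: bounded_clinear_simps[OF D])
  ultimately have "norm ((D ^^ n) (x - y)) \<le> (B + C) * r ^ n" for n
    by (metis distrib_right norm_triangle_le_diff add_mono)
  then show ?thesis by (auto simp: disc_subspace_def)
qed

lemma disc_subspaceI:
  assumes M: "\<And>x. x \<in> M \<Longrightarrow> D x \<in> M" and contr: "\<And>x. x \<in> M \<Longrightarrow> norm (D x) \<le> r * norm x"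
    and r: "0 \<le> r" and x: "x \<in> M"
  shows "x \<in> disc_subspace D r"
proof -
  have "(D ^^ n) x \<in> M \<and> norm ((D ^^ n) x) \<le> norm x * r ^ n" for n
  proof (induction n)
    case (Suc n)
    have "norm ((D ^^ Suc n) x) \<le> r * norm ((D ^^ n) x)" using contr Suc by simp
    also have "\<dots> \<le> r * (norm x * r ^ n)" using Suc r by (intro mult_left_mono) auto
    finally show ?case using Suc M by (simp add: mult_ac)
  qed (simp add: x)
  then show ?thesis by (auto simp: disc_subspace_def)
qed

lemma disc_subspace_eq_UNIV:
  assumes "bounded_clinear D"
  obtains K where "0 < K" "\<And>r. K \<le> r \<Longrightarrow> disc_subspace D r = UNIV"
proof -
  obtain K where K: "0 < K" "\<And>x. norm (D x) \<le> K * norm x"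
    by (rule bounded_clinear_bound[OF assms]) blast
  show thesis
  proof (rule that[OF K(1)])
    fix r assume r: "K \<le> r"
    have "norm (D x) \<le> r * norm x" for x
      by (rule order_trans[OF K(2) mult_right_mono[OF r norm_ge_zero]])
    then show "disc_subspace D r = UNIV" using disc_subspaceI[of UNIV D r] K(1) r by auto
  qed
qed

context
  fixes D :: "'a::chilbert \<Rightarrow> 'a"
  assumes normal: "normal_on UNIV D"
begin

lemma normal_bounded_clinear: "bounded_clinear D" and normal_adj_commute: "D (D\<^sup>\<dagger> x) = D\<^sup>\<dagger> (D x)"
  using normal by (simp_all add: normal_on_UNIV_iff)

lemma normal_norm_adj: "norm (D\<^sup>\<dagger> x) = norm (D x)"
  by (rule norm_adj_eq_norm[OF normal_bounded_clinear normal_adj_commute])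

lemma normal_norm_funpow_adj: "norm ((D\<^sup>\<dagger> ^^ n) x) = norm ((D ^^ n) x)"
proof (induction n arbitrary: x)
  case (Suc n)
  have "norm ((D ^^ Suc n) x) = norm (D\<^sup>\<dagger> ((D ^^ n) x))" by (simp add: normal_norm_adj)
  also have "D\<^sup>\<dagger> ((D ^^ n) x) = (D ^^ n) (D\<^sup>\<dagger> x)"
    by (rule funpow_commute_apply) (simp add: normal_adj_commute)
  also have "norm \<dots> = norm ((D\<^sup>\<dagger> ^^ n) (D\<^sup>\<dagger> x))" by (rule Suc[symmetric])
  finally show ?case by (simp add: funpow_swap1)
qed simp

lemma disc_subspace_invariant:
  assumes X: "bounded_clinear X" and XD: "\<And>y. X (D y) = D (X y)" and x: "x \<in> disc_subspace D r"
  shows "X x \<in> disc_subspace D r" "X\<^sup>\<dagger> x \<in> disc_subspace D r"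
proof -
  obtain C where C: "\<And>n. norm ((D ^^ n) x) \<le> C * r ^ n" using x by (auto simp: disc_subspace_def)
  have bound: "\<exists>B. \<forall>n. norm (Y ((E ^^ n) x)) \<le> B * r ^ n"
    if Y: "bounded_clinear Y" and E: "\<And>n. norm ((E ^^ n) x) = norm ((D ^^ n) x)" for Y E
  proof -
    obtain K where K: "0 < K" "\<And>y. norm (Y y) \<le> K * norm y"
      by (rule bounded_clinear_bound[OF Y]) blast
    have "norm (Y ((E ^^ n) x)) \<le> (K * C) * r ^ n" for n
    proof -
      have "norm (Y ((E ^^ n) x)) \<le> K * norm ((D ^^ n) x)"
        using K(2)[of "(E ^^ n) x"] by (simp add: E)
      also have "\<dots> \<le> K * (C * r ^ n)" using K(1) by (intro mult_left_mono C) simp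
      finally show ?thesis by (simp add: mult.assoc)
    qed
    then show ?thesis by blast
  qed
  show "X x \<in> disc_subspace D r"
    using bound[OF X refl] by (simp add: disc_subspace_def funpow_commute_apply[of X D, OF XD])
  have "norm (X\<^sup>\<dagger> ((D\<^sup>\<dagger> ^^ n) x)) = norm ((D ^^ n) (X\<^sup>\<dagger> x))" for n
    using funpow_commute_apply[of "X\<^sup>\<dagger>" "D\<^sup>\<dagger>" n x, OF adj_commute[OF X normal_bounded_clinear XD]]
    by (simp add: normal_norm_funpow_adj)
  then show "X\<^sup>\<dagger> x \<in> disc_subspace D r"
    using bound[OF bounded_clinear_adj[OF X] normal_norm_funpow_adj]
    by (simp add: disc_subspace_def)
qed

context
  fixes r :: real
  assumes r: "0 \<le> r"
begin

lemma norm_le_of_disc_subspace: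
  assumes "x \<in> disc_subspace D r"
  shows "norm (D x) \<le> r * norm x"
proof -
  obtain C where C: "\<And>n. norm ((D ^^ n) x) \<le> C * r ^ n"
    using assms by (auto simp: disc_subspace_def)
  have "norm ((D ^^ 1) x) \<le> r * norm ((D ^^ 0) x)"
  proof (rule log_convex_first_ratio_le[OF _ _ C r])
    fix n
    define y where "y = (D ^^ n) x"
    have "(norm (D y))\<^sup>2 \<le> norm (D\<^sup>\<dagger> (D y)) * norm y"
      unfolding norm_sq_eq_cinner_adj[OF normal_bounded_clinear] by (rule Re_cinner_le)
    then show "(norm ((D ^^ Suc n) x))\<^sup>2 \<le> norm ((D ^^ n) x) * norm ((D ^^ Suc (Suc n)) x)"
      by (simp add: y_def normal_norm_adj mult.commute)
  qed simp
  then show ?thesis by simp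
qed

lemma disc_subspace_splitting:
  "closed_csubspace (disc_subspace D r)" "x \<in> orth (disc_subspace D r) \<Longrightarrow> r * norm x \<le> norm (D x)"
proof -
  note D = normal_bounded_clinear
  define B where "B = shift (\<lambda>x. D\<^sup>\<dagger> (D x)) (of_real (r\<^sup>2))"
  have DD: "bounded_clinear (\<lambda>x. D\<^sup>\<dagger> (D x))"
    by (rule bounded_clinear_compose[OF bounded_clinear_adj[OF D] D])
  have B: "bounded_clinear B" "B\<^sup>\<dagger> = B"
    unfolding B_def adj_shift[OF DD] using bounded_clinear_shift[OF DD]
    by (simp_all add: adj_compose D bounded_clinear_adj)
  have B_form: "Re (cinner (B x) x) = (norm (D x))\<^sup>2 - (r * norm x)\<^sup>2" for x
    by (simp add: B_def cinner_simps norm_sq_eq_cinner_adj[OF D] cinner_self_norm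
        power_mult_distrib)
  obtain M where M: "closed_csubspace M"
    "\<And>x. x \<in> M \<Longrightarrow> Re (cinner (B x) x) \<le> 0"
    "\<And>x. x \<in> orth M \<Longrightarrow> x \<noteq> 0 \<Longrightarrow> 0 < Re (cinner (B x) x)"
    "\<And>X x. bounded_clinear X \<Longrightarrow> (\<And>y. X (B y) = B (X y)) \<Longrightarrow> x \<in> M \<Longrightarrow> X x \<in> M"
    by (rule sign_splitting[OF B]) blast
  have DB: "D (B x) = B (D x)" for x
    by (simp add: B_def bounded_clinear_simps[OF D] normal_adj_commute)
  have M_le: "norm (D x) \<le> r * norm x" if "x \<in> M" for x
    using M(2)[OF that] r by (simp add: B_form power2_le_iff_abs_le)
  have M_sub: "M \<subseteq> disc_subspace D r"
    using disc_subspaceI[of M D r] M(4)[OF D DB] M_le r by blast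
  moreover have "disc_subspace D r \<subseteq> M"
  proof
    fix x assume x: "x \<in> disc_subspace D r"
    define y where "y = x - proj M x"
    have "y \<in> disc_subspace D r"
      unfolding y_def using M_sub proj_in[OF M(1)] by (intro disc_subspace_diff[OF D] x) blast
    then have "(norm (D y))\<^sup>2 \<le> (r * norm y)\<^sup>2"
      by (intro power_mono norm_le_of_disc_subspace) simp_all
    moreover have "y \<in> orth M" unfolding y_def by (rule diff_proj_in_orth[OF M(1)])
    ultimately have "y = 0" using M(3)[of y] by (auto simp: B_form)
    then show "x \<in> M" using proj_in[OF M(1), of x] by (simp add: y_def)
  qed
  ultimately have M_eq: "disc_subspace D r = M" by blast
  show "closed_csubspace (disc_subspace D r)" using M(1) by (simp add: M_eq)
  assume x: "x \<in> orth (disc_subspace D r)"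
  then show "r * norm x \<le> norm (D x)"
    using M(3)[of x] power2_less_imp_less[of "r * norm x" "norm (D x)"]
    by (cases "x = 0") (auto simp: M_eq B_form)
qed

end

end

section \<open>Joint approximate eigenvectors of commuting normal operators\<close>

lemma polarization_identity:
  fixes x y :: "'a::chilbert"
  assumes "bounded_clinear U"
  shows "4 * cinner (U x) y = cinner (U (x + y)) (x + y) - cinner (U (x - y)) (x - y)
    - \<i> * (cinner (U (x + scaleC \<i> y)) (x + scaleC \<i> y)
      - cinner (U (x - scaleC \<i> y)) (x - scaleC \<i> y))"
  by (simp add: bounded_clinear_simps[OF assms] cinner_simps algebra_simps)

lemma norm_le_numerical_radius:
  assumes U: "bounded_clinear U" and M: "csubspace M" and inv: "\<And>x. x \<in> M \<Longrightarrow> U x \<in> M"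
    and form: "\<And>x. x \<in> M \<Longrightarrow> cmod (cinner (U x) x) \<le> e * (norm x)\<^sup>2" and x: "x \<in> M"
  shows "norm (U x) \<le> 2 * e * norm x"
proof (cases "U x = 0")
  case True
  have "0 \<le> e * (norm x)\<^sup>2" using form[OF x] norm_ge_zero order_trans by blast
  then have "x = 0 \<or> 0 \<le> e" by (auto simp: zero_le_mult_iff)
  then show ?thesis using True by auto
next
  case False
  note sub = csubspace_imp_subspace[OF M]
  define y where "y = (norm x / norm (U x)) *\<^sub>R U x"
  have y: "y \<in> M" "norm y = norm x"
    unfolding y_def using False by (auto intro: subspace_scale[OF sub] inv x)
  have iy: "scaleC \<i> y \<in> M" by (rule csubspace_scaleC[OF M y(1)])
  have triangle4: "cmod (a - b - \<i> * (c - d)) \<le> cmod a + cmod b + (cmod c + cmod d)" for a b c d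
    by (metis add_mono norm_ii norm_mult mult_1 norm_triangle_ineq4 norm_triangle_le_diff)
  have "cinner (U x) y = complex_of_real (norm x * norm (U x))"
    unfolding y_def using False by (simp add: cinner_simps cinner_self_norm power2_eq_square)
  then have "4 * (norm x * norm (U x)) = cmod (4 * cinner (U x) y)" by (simp add: norm_mult)
  also have "\<dots> \<le> e * (norm (x + y))\<^sup>2 + e * (norm (x - y))\<^sup>2
      + (e * (norm (x + scaleC \<i> y))\<^sup>2 + e * (norm (x - scaleC \<i> y))\<^sup>2)"
    unfolding polarization_identity[OF U]
    by (rule order_trans[OF triangle4])
      (intro add_mono form subspace_add[OF sub] subspace_diff[OF sub] x y(1) iy)
  also have "\<dots> = e * ((norm (x + y))\<^sup>2 + (norm (x - y))\<^sup>2)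
      + e * ((norm (x + scaleC \<i> y))\<^sup>2 + (norm (x - scaleC \<i> y))\<^sup>2)" by (simp add: distrib_left)
  also have "\<dots> = 4 * (norm x * (2 * e * norm x))"
    unfolding parallelogram_law by (simp add: y(2) power2_eq_square)
  finally have "norm x * norm (U x) \<le> norm x * (2 * e * norm x)"
    by (simp only: mult_le_cancel_left_pos)
  moreover have "x \<noteq> 0" using False bounded_clinear_simps(6)[OF U] by auto
  ultimately show ?thesis by (simp add: mult_le_cancel_left)
qed

definition annular :: "real \<Rightarrow> ('a::chilbert \<Rightarrow> 'a) \<Rightarrow> 'a set \<Rightarrow> bool" where
  "annular d D M \<longleftrightarrow> (\<exists>c. \<forall>x\<in>M. (norm (D x))\<^sup>2 \<in> {c * (norm x)\<^sup>2 .. (c + d) * (norm x)\<^sup>2})"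

definition near_scalar :: "real \<Rightarrow> ('a::chilbert \<Rightarrow> 'a) \<Rightarrow> complex \<Rightarrow> 'a set \<Rightarrow> bool" where
  "near_scalar e T z M \<longleftrightarrow> (\<forall>x\<in>M. norm (shift T z x) \<le> e * norm x)"

lemma annular_subset: "annular d D M \<Longrightarrow> L \<subseteq> M \<Longrightarrow> annular d D L"
  unfolding annular_def by blast

lemma annular_disc_subspace_difference:
  assumes D: "normal_on UNIV D" and c: "0 \<le> c" and d: "0 \<le> d"
  shows "annular d D (disc_subspace D (sqrt (c + d)) \<inter> orth (disc_subspace D (sqrt c)))"
  unfolding annular_def
proof (intro exI ballI)
  fix x assume x: "x \<in> disc_subspace D (sqrt (c + d)) \<inter> orth (disc_subspace D (sqrt c))"
  have "(norm (D x))\<^sup>2 \<le> (sqrt (c + d) * norm x)\<^sup>2"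
    using x c d by (intro power_mono norm_le_of_disc_subspace[OF D]) auto
  moreover have "(sqrt c * norm x)\<^sup>2 \<le> (norm (D x))\<^sup>2"
    using x c by (intro power_mono disc_subspace_splitting(2)[OF D]) auto
  ultimately show "(norm (D x))\<^sup>2 \<in> {c * (norm x)\<^sup>2 .. (c + d) * (norm x)\<^sup>2}"
    using c d by (simp add: power_mult_distrib)
qed

text \<open>If \<open>|T|\<close>, \<open>|T - 1|\<close> and \<open>|T - \<i>|\<close> are nearly constant on the unit sphere of \<open>M\<close>, then so are
  the real and the imaginary part of the quadratic form of \<open>T\<close>.\<close>

lemma near_scalar_of_annular:
  assumes T: "bounded_clinear T" and M: "csubspace M" and inv: "\<And>x. x \<in> M \<Longrightarrow> T x \<in> M"
    and annular: "\<And>l. l \<in> {0, 1, \<i>} \<Longrightarrow> annular d (shift T l) M"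
  shows "\<exists>z. near_scalar (2 * d) T z M"
proof -
  note sub = csubspace_imp_subspace[OF M]
  obtain a where a: "\<And>x. x \<in> M \<Longrightarrow> (norm (T x))\<^sup>2 \<in> {a * (norm x)\<^sup>2 .. (a + d) * (norm x)\<^sup>2}"
    using annular[of 0] by (auto simp: annular_def)
  obtain b where b: "\<And>x. x \<in> M \<Longrightarrow> (norm (T x - x))\<^sup>2 \<in> {b * (norm x)\<^sup>2 .. (b + d) * (norm x)\<^sup>2}"
    using annular[of 1] by (auto simp: annular_def scaleC_one)
  obtain c where c: "\<And>x. x \<in> M \<Longrightarrow> (norm (shift T \<i> x))\<^sup>2 \<in> {c * (norm x)\<^sup>2 .. (c + d) * (norm x)\<^sup>2}"
    using annular[of \<i>] by (auto simp: annular_def)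
  define w where "w = Complex ((a + 1 - b) / 2) ((c - a - 1) / 2)"
  have "norm (shift T (cnj w) x) \<le> 2 * d * norm x" if x: "x \<in> M" for x
  proof (rule norm_le_numerical_radius[OF bounded_clinear_shift[OF T] M _ _ x])
    show "shift T (cnj w) x \<in> M" if "x \<in> M" for x
      using that by (intro subspace_diff[OF sub] inv csubspace_scaleC[OF M])
  next
    fix x assume x: "x \<in> M"
    define n t u where "n = (norm x)\<^sup>2" and "t = (norm (T x))\<^sup>2" and "u = cinner (T x) x"
    have "a * n \<le> t" "t \<le> a * n + d * n"
      using a[OF x] by (simp_all add: n_def t_def distrib_right)
    moreover have "b * n \<le> t - 2 * Re u + n" "t - 2 * Re u + n \<le> b * n + d * n"
      using b[OF x] by (simp_all add: norm_diff_sq n_def t_def u_def distrib_right)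
    moreover have "c * n \<le> t + 2 * Im u + n" "t + 2 * Im u + n \<le> c * n + d * n"
      using c[OF x] by (simp_all add: norm_diff_sq n_def t_def u_def distrib_right cinner_simps)
    moreover have "Re w * n = (a * n + n - b * n) / 2" "Im w * n = (c * n - a * n - n) / 2"
      by (simp_all add: w_def field_simps)
    ultimately have "\<bar>Re u - Re w * n\<bar> \<le> d * n / 2" "\<bar>Im u - Im w * n\<bar> \<le> d * n / 2"
      by argo+
    moreover have "cinner (shift T (cnj w) x) x = u - w * n"
      by (simp add: cinner_simps u_def n_def cinner_self_norm)
    then have "cmod (cinner (shift T (cnj w) x) x) \<le> \<bar>Re u - Re w * n\<bar> + \<bar>Im u - Im w * n\<bar>"
      using cmod_le[of "u - w * n"] by simp
    ultimately show "cmod (cinner (shift T (cnj w) x) x) \<le> d * (norm x)\<^sup>2"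
      unfolding n_def[symmetric] by linarith
  qed
  then show ?thesis unfolding near_scalar_def by blast
qed

lemma near_scalar_dist_le:
  assumes "near_scalar d T z M" "near_scalar e T w M" and x: "x \<in> M" "norm x = 1"
  shows "dist z w \<le> d + e"
proof -
  have "scaleC (z - w) x = shift T w x - shift T z x" by (simp add: scaleC_diff_left)
  then have "dist z w * norm x \<le> norm (shift T w x) + norm (shift T z x)"
    unfolding dist_norm by (metis norm_scaleC norm_triangle_ineq4)
  moreover have "norm (shift T z x) \<le> d" "norm (shift T w x) \<le> e"
    using assms(1,2) x unfolding near_scalar_def by (metis mult.right_neutral)+
  ultimately show ?thesis using x(2) by simp
qed

definition approx_eigen :: "('a::chilbert \<Rightarrow> 'a) \<Rightarrow> complex \<Rightarrow> (nat \<Rightarrow> 'a) \<Rightarrow> bool" where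
  "approx_eigen T z X \<longleftrightarrow> (\<lambda>n. shift T z (X n)) \<longlonglongrightarrow> 0"

lemma approx_eigenI:
  assumes z: "w \<longlonglongrightarrow> z" and e: "e \<longlonglongrightarrow> (0::real)"
    and X: "\<And>n. norm (X n) = 1" "\<And>n. norm (shift T (w n) (X n)) \<le> e n"
  shows "approx_eigen T z X"
  unfolding approx_eigen_def
proof (rule Lim_null_comparison[OF always_eventually, OF allI])
  fix n
  have "shift T z (X n) = shift T (w n) (X n) + scaleC (w n - z) (X n)"
    by (simp add: scaleC_diff_left)
  then have "norm (shift T z (X n)) \<le> norm (shift T (w n) (X n)) + cmod (w n - z) * norm (X n)"
    by (metis norm_triangle_ineq norm_scaleC)
  then show "norm (shift T z (X n)) \<le> e n + cmod (w n - z)" using X(1,2)[of n] by simp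
next
  have "(\<lambda>n. e n + cmod (w n - z)) \<longlonglongrightarrow> 0 + 0" by (intro tendsto_add e tendsto_norm_zero LIM_zero z)
  then show "(\<lambda>n. e n + cmod (w n - z)) \<longlonglongrightarrow> 0" by simp
qed

definition jointly_reducing :: "('i \<Rightarrow> 'a::chilbert \<Rightarrow> 'a) \<Rightarrow> 'a set \<Rightarrow> bool" where
  "jointly_reducing T M \<longleftrightarrow> closed_csubspace M \<and> (\<forall>i. reduces_in UNIV M (T i))"

definition commuting_normal_family :: "('i \<Rightarrow> 'a::chilbert \<Rightarrow> 'a) \<Rightarrow> bool" where
  "commuting_normal_family T \<longleftrightarrow> (\<forall>i. normal_on UNIV (T i)) \<and> (\<forall>i j x. T i (T j x) = T j (T i x))"

lemma jointly_reducingD: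
  assumes "jointly_reducing T M"
  shows "closed_csubspace M" "reduces_in UNIV M (T i)"
  using assms by (simp_all add: jointly_reducing_def)

lemma jointly_reducing_orth: "jointly_reducing T M \<Longrightarrow> jointly_reducing T (orth M)"
  by (simp add: jointly_reducing_def closed_csubspace_orth reduces_in_UNIV_orth)

lemma jointly_reducing_Int:
  "(\<And>i. bounded_clinear (T i)) \<Longrightarrow> jointly_reducing T M \<Longrightarrow> jointly_reducing T N
      \<Longrightarrow> jointly_reducing T (M \<inter> N)"
  by (simp add: jointly_reducing_def closed_csubspace_Int reduces_in_UNIV_Int)

lemma normal_on_UNIV_shift:
  assumes "normal_on UNIV T"
  shows "normal_on UNIV (shift T z)"
proof -
  have T: "bounded_clinear T" and comm: "\<And>x. T (T\<^sup>\<dagger> x) = T\<^sup>\<dagger> (T x)"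
    using assms by (simp_all add: normal_on_UNIV_iff)
  show ?thesis
    unfolding normal_on_UNIV_iff adj_shift[OF T]
    by (intro conjI allI bounded_clinear_shift T shift_commute bounded_clinear_adj comm)
qed

definition exceeds :: "('a::chilbert \<Rightarrow> 'a) \<Rightarrow> real \<Rightarrow> 'a set \<Rightarrow> bool" where
  "exceeds Q q M \<longleftrightarrow> (\<exists>x\<in>M. q * norm x < norm (Q x))"

lemma exceeds_unit_vector:
  assumes Q: "bounded_clinear Q" and M: "subspace M" and "exceeds Q q M"
  obtains x where "x \<in> M \<inter> sphere 0 1" "q < norm (Q x)"
proof -
  obtain x where x: "x \<in> M" "q * norm x < norm (Q x)" using assms(3) by (auto simp: exceeds_def)
  then have "x \<noteq> 0" by (auto simp: bounded_clinear_simps[OF Q])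
  then have "q < norm (Q (sgn x))" using x(2) by (simp add: norm_apply_sgn[OF Q] field_simps)
  with sgn_in_subspace_sphere[OF M x(1) \<open>x \<noteq> 0\<close>] show thesis by (rule that)
qed

lemma exceeds_orthogonal_split:
  assumes Q: "bounded_clinear Q" and q: "0 \<le> q" and E: "closed_csubspace E" "reduces_in UNIV E Q"
    and M: "subspace M" "\<And>x. x \<in> M \<Longrightarrow> proj E x \<in> M" and exceeds: "exceeds Q q M"
  shows "exceeds Q q (M \<inter> E) \<or> exceeds Q q (M \<inter> orth E)"
proof (rule ccontr)
  assume not_exceeds: "\<not> ?thesis"
  obtain x where x: "x \<in> M" "q * norm x < norm (Q x)" using exceeds by (auto simp: exceeds_def)
  define u v where "u = proj E x" and "v = x - u"
  have u: "u \<in> M \<inter> E" and v: "v \<in> M \<inter> orth E"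
    using x(1) M
    by (auto simp: u_def v_def proj_in[OF E(1)] diff_proj_in_orth[OF E(1)] subspace_diff)
  have "norm (Q u) \<le> q * norm u" "norm (Q v) \<le> q * norm v"
    using not_exceeds u v by (auto simp: exceeds_def not_less)
  then have Q_le: "(norm (Q u))\<^sup>2 \<le> q\<^sup>2 * (norm u)\<^sup>2" "(norm (Q v))\<^sup>2 \<le> q\<^sup>2 * (norm v)\<^sup>2"
    by (metis norm_ge_zero power_mono power_mult_distrib)+
  have "Q u \<in> E" "Q v \<in> orth E" using u v reduces_in_UNIV_D[OF E(2)] by auto
  then have "(norm (Q u + Q v))\<^sup>2 = (norm (Q u))\<^sup>2 + (norm (Q v))\<^sup>2"
    by (intro pythagoras orthD)
  also have "\<dots> \<le> q\<^sup>2 * ((norm u)\<^sup>2 + (norm v)\<^sup>2)" using Q_le by (simp add: distrib_left)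
  also have "(norm u)\<^sup>2 + (norm v)\<^sup>2 = (norm (u + v))\<^sup>2"
    using u v by (intro pythagoras[symmetric] orthD) auto
  finally have "(norm (Q x))\<^sup>2 \<le> (q * norm x)\<^sup>2"
    by (simp add: v_def power_mult_distrib flip: bounded_clinear_simps(1)[OF Q])
  then show False using x(2) q by (simp add: power2_le_iff_abs_le)
qed

context
  fixes T :: "'i \<Rightarrow> 'a::chilbert \<Rightarrow> 'a"
  assumes T: "commuting_normal_family T"
begin

lemma commuting_normal_family_normal: "normal_on UNIV (T i)"
  and commuting_normal_family_bounded: "bounded_clinear (T i)"
  and commuting_normal_family_commute: "T i (T j x) = T j (T i x)"
  using T by (simp_all add: commuting_normal_family_def normal_on_UNIV_iff)

lemma jointly_reducing_disc_subspace:
  assumes "0 \<le> r"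
  shows "jointly_reducing T (disc_subspace (shift (T i) l) r)"
proof -
  note normal = normal_on_UNIV_shift[OF commuting_normal_family_normal[of i], of l]
  have closed: "closed_csubspace (disc_subspace (shift (T i) l) r)"
    by (rule disc_subspace_splitting(1)[OF normal assms])
  have "T j (shift (T i) l x) = shift (T i) l (T j x)" for j x
    by (simp add: bounded_clinear_simps[OF commuting_normal_family_bounded]
        commuting_normal_family_commute)
  then show ?thesis
    using disc_subspace_invariant[OF normal commuting_normal_family_bounded]
    by (simp add: jointly_reducing_def closed
        reduces_in_UNIV_iff[OF commuting_normal_family_bounded closed])
qed

lemma proj_disc_subspace_in:
  assumes N: "jointly_reducing T N" and r: "0 \<le> r" and x: "x \<in> N"
  shows "proj (disc_subspace (shift (T i) l) r) x \<in> N"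
proof -
  define D where "D = shift (T i) l"
  define E where "E = disc_subspace D r"
  have normal: "normal_on UNIV D"
    unfolding D_def by (rule normal_on_UNIV_shift[OF commuting_normal_family_normal])
  have E: "closed_csubspace E" unfolding E_def by (rule disc_subspace_splitting(1)[OF normal r])
  note Nc = jointly_reducingD(1)[OF N]
  have "reduces_in UNIV N D"
    unfolding D_def
    by (rule reduces_in_UNIV_shift[OF closed_csubspaceD(1)[OF Nc] jointly_reducingD(2)[OF N]])
  then have "proj N (D y) = D (proj N y)" for y
    by (rule proj_commute[OF normal_bounded_clinear[OF normal] Nc])
  from disc_subspace_invariant(1)[OF normal bounded_clinear_proj[OF Nc] this]
  have "reduces_in UNIV E (proj N)"
    by (simp add: E_def reduces_in_UNIV_iff[OF bounded_clinear_proj[OF Nc] E, unfolded E_def]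
        adj_proj[OF Nc])
  then have "proj E (proj N x) = proj N (proj E x)"
    by (rule proj_commute[OF bounded_clinear_proj[OF Nc] E])
  then have "proj E x \<in> N" using proj_in[OF Nc, of "proj E x"] x by (simp add: proj_id[OF Nc])
  then show ?thesis by (simp add: E_def D_def)
qed

context
  fixes Q :: "'a \<Rightarrow> 'a" and q :: real
  assumes Q: "bounded_clinear Q" and q: "0 \<le> q"
    and Q_inv: "\<And>M x. jointly_reducing T M \<Longrightarrow> x \<in> M \<Longrightarrow> Q x \<in> M"
begin

lemma exceeds_outside_disc_subspace:
  assumes M: "jointly_reducing T M" "exceeds Q q M" and r: "0 \<le> r"
    and inside: "\<not> exceeds Q q (M \<inter> disc_subspace (shift (T i) l) r)"
  shows "exceeds Q q (M \<inter> orth (disc_subspace (shift (T i) l) r))"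
proof -
  note E = jointly_reducing_disc_subspace[OF r, of i l]
  have "reduces_in UNIV (disc_subspace (shift (T i) l) r) Q"
    using Q_inv[OF E] Q_inv[OF jointly_reducing_orth[OF E]] by (auto simp: reduces_in_def)
  from exceeds_orthogonal_split[OF Q q jointly_reducingD(1)[OF E] this
      closed_csubspaceD(2)[OF jointly_reducingD(1)[OF M(1)]] proj_disc_subspace_in[OF M(1) r]
          M(2)] inside
  show ?thesis by blast
qed

text \<open>Among the discs of squared radii \<open>0, d, 2 d, \<dots>\<close> take the first one on which \<open>Q\<close> exceeds \<open>q\<close>
  and remove the preceding one.\<close>

lemma annular_slice:
  assumes M: "jointly_reducing T M" "exceeds Q q M" and d: "0 < d"
  shows "\<exists>L\<subseteq>M. jointly_reducing T L \<and> exceeds Q q L \<and> annular d (shift (T i) l) L"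
proof -
  define D where "D = shift (T i) l"
  define E where "E n = disc_subspace D (sqrt (real n * d))" for n
  have radius: "0 \<le> sqrt (real n * d)" for n using d by simp
  have D: "normal_on UNIV D"
    unfolding D_def by (rule normal_on_UNIV_shift[OF commuting_normal_family_normal])
  have E_red: "jointly_reducing T (E n)" for n
    unfolding E_def D_def by (rule jointly_reducing_disc_subspace[OF radius])
  obtain K where K: "0 < K" "\<And>r. K \<le> r \<Longrightarrow> disc_subspace D r = UNIV"
    by (rule disc_subspace_eq_UNIV[OF normal_bounded_clinear[OF D]]) blast
  obtain N where "K\<^sup>2 / d < real N" using reals_Archimedean2 by blast
  then have "K \<le> sqrt (real N * d)" using d K(1) by (intro real_le_rsqrt) (simp add: field_simps)
  then have exceeds_disc: "\<exists>n. exceeds Q q (M \<inter> E n)"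
    using K(2) M(2) by (intro exI[of _ N]) (simp add: E_def)
  define m where "m = (LEAST n. exceeds Q q (M \<inter> E n))"
  have m: "exceeds Q q (M \<inter> E m)" unfolding m_def by (rule LeastI_ex[OF exceeds_disc])
  have ME: "jointly_reducing T (M \<inter> E m)"
    by (rule jointly_reducing_Int[of T, OF commuting_normal_family_bounded M(1) E_red])
  show ?thesis
  proof (cases m)
    case 0
    have "D x = 0" if "x \<in> E 0" for x
      using norm_le_of_disc_subspace[OF D radius that[unfolded E_def]] by simp
    then have "annular d D (M \<inter> E m)"
      unfolding annular_def 0 using d by (intro exI[of _ 0]) simp
    then show ?thesis using m ME by (intro exI[of _ "M \<inter> E m"]) (simp add: D_def)
  next
    case (Suc n)
    let ?L = "M \<inter> E m \<inter> orth (E n)"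
    have "\<not> exceeds Q q (M \<inter> E n)"
      using Suc not_less_Least[of n "\<lambda>n. exceeds Q q (M \<inter> E n)"] by (simp add: m_def)
    then have "\<not> exceeds Q q (M \<inter> E m \<inter> E n)" by (auto simp: exceeds_def)
    then have "exceeds Q q ?L"
      using exceeds_outside_disc_subspace[OF ME m radius] unfolding E_def[of n] D_def by blast
    moreover have "annular d D ?L"
    proof (rule annular_subset)
      show "annular d D (disc_subspace D (sqrt (real n * d + d))
          \<inter> orth (disc_subspace D (sqrt (real n * d))))"
        using d by (intro annular_disc_subspace_difference[OF D]) simp_all
      show "?L \<subseteq> disc_subspace D (sqrt (real n * d + d))
          \<inter> orth (disc_subspace D (sqrt (real n * d)))"
        by (auto simp: E_def Suc distrib_right add.commute)
    qed
    moreover have "jointly_reducing T ?L"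
      by (rule jointly_reducing_Int[of T, OF commuting_normal_family_bounded ME
          jointly_reducing_orth[OF E_red]])
    ultimately show ?thesis unfolding D_def by (intro exI[of _ ?L]) blast
  qed
qed

lemma annular_slices:
  assumes "finite K" and M: "jointly_reducing T M" "exceeds Q q M" and d: "0 < d"
  shows "\<exists>L\<subseteq>M. jointly_reducing T L \<and> exceeds Q q L \<and> (\<forall>(i, l)\<in>K. annular d (shift (T i) l) L)"
  using \<open>finite K\<close>
proof induction
  case empty
  show ?case using M by auto
next
  case (insert k K)
  obtain L where L: "L \<subseteq> M" "jointly_reducing T L" "exceeds Q q L"
      "\<forall>(i, l)\<in>K. annular d (shift (T i) l) L"
    using insert.IH by blast
  obtain i l where k: "k = (i, l)" by (cases k)
  obtain L' where L': "L' \<subseteq> L" "jointly_reducing T L'" "exceeds Q q L'"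
      "annular d (shift (T i) l) L'"
    using annular_slice[OF L(2,3) d] by blast
  have "\<forall>(i, l)\<in>insert k K. annular d (shift (T i) l) L'"
    using L(4) L'(4) annular_subset[OF _ L'(1)] by (auto simp: k)
  then show ?case using L(1) L' by blast
qed

lemma near_scalar_slice:
  assumes finite: "finite (UNIV :: 'i set)" and M: "jointly_reducing T M" "exceeds Q q M"
    and e: "0 < e"
  shows "\<exists>L\<subseteq>M. jointly_reducing T L \<and> exceeds Q q L \<and> (\<forall>i. \<exists>z. near_scalar e (T i) z L)"
proof -
  have "finite ((UNIV :: 'i set) \<times> {0, 1, \<i>})" using finite by simp
  then obtain L where L: "L \<subseteq> M" "jointly_reducing T L" "exceeds Q q L"
    and annular: "\<forall>(i, l)\<in>UNIV \<times> {0, 1, \<i>}. annular (e / 2) (shift (T i) l) L"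
    using annular_slices[OF _ M half_gt_zero[OF e]] by blast
  have "\<exists>z. near_scalar (2 * (e / 2)) (T i) z L" for i
  proof (rule near_scalar_of_annular[OF commuting_normal_family_bounded])
    show "csubspace L" by (rule closed_csubspaceD(1)[OF jointly_reducingD(1)[OF L(2)]])
    show "T i x \<in> L" if "x \<in> L" for x
      by (rule reduces_in_UNIV_D(1)[OF jointly_reducingD(2)[OF L(2)] that])
    show "annular (e / 2) (shift (T i) l) L" if "l \<in> {0, 1, \<i>}" for l using annular that by blast
  qed
  then show ?thesis using L by (intro exI[of _ L]) simp
qed

lemma nested_near_scalar_slices:
  assumes finite: "finite (UNIV :: 'i set)" and M: "jointly_reducing T M" "exceeds Q q M"
  obtains L z where "decseq L" "\<And>n. L n \<subseteq> M" "\<And>n. jointly_reducing T (L n)" "\<And>n. exceeds Q q (L n)"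
    "\<And>n i. near_scalar (1 / real (Suc n)) (T i) (z n i) (L n)"
proof -
  let ?slice = "\<lambda>n L. L \<subseteq> M \<and> jointly_reducing T L \<and> exceeds Q q L
    \<and> (\<forall>i. \<exists>z. near_scalar (1 / real (Suc n)) (T i) z L)"
  have "\<exists>L. \<forall>n. ?slice n (L n) \<and> L (Suc n) \<subseteq> L n"
  proof (rule dependent_nat_choice)
    show "\<exists>L. ?slice 0 L" by (rule near_scalar_slice[OF finite M]) simp
    show "\<exists>L'. ?slice (Suc n) L' \<and> L' \<subseteq> L" if "?slice n L" for L n
      using near_scalar_slice[OF finite, of L "1 / real (Suc (Suc n))"] that
      by (meson dual_order.trans of_nat_0_less_iff zero_less_Suc zero_less_divide_1_iff)
  qed
  then obtain L where L: "\<And>n. ?slice n (L n)" "\<And>n. L (Suc n) \<subseteq> L n" by blast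
  moreover obtain z where "\<And>n i. near_scalar (1 / real (Suc n)) (T i) (z n i) (L n)"
    using L(1) by metis
  ultimately show thesis using that[of L z] by (simp add: decseq_Suc_iff)
qed

text \<open>On ever thinner nested slices the approximate scalars form Cauchy sequences.\<close>

lemma joint_approx_eigenvectors:
  assumes finite: "finite (UNIV :: 'i set)" and M: "jointly_reducing T M" "exceeds Q q M"
  obtains z X where "\<And>n. X n \<in> M \<inter> sphere 0 1" "\<And>n. q < norm (Q (X n))"
      "\<And>i. approx_eigen (T i) (z i) X"
proof -
  obtain L w where L: "decseq L" "\<And>n. L n \<subseteq> M" "\<And>n. jointly_reducing T (L n)"
      "\<And>n. exceeds Q q (L n)"
    and near: "\<And>n i. near_scalar (1 / real (Suc n)) (T i) (w n i) (L n)"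
    by (rule nested_near_scalar_slices[OF assms]) blast
  have "\<exists>x. x \<in> L n \<inter> sphere 0 1 \<and> q < norm (Q x)" for n
    using exceeds_unit_vector[OF Q closed_csubspaceD(2)[OF jointly_reducingD(1)[OF L(3)]] L(4)]
    by blast
  then obtain X where X: "\<And>n. X n \<in> L n \<inter> sphere 0 1" "\<And>n. q < norm (Q (X n))" by metis
  have "Cauchy (\<lambda>n. w n i)" for i
  proof (rule CauchyI')
    fix e :: real assume "0 < e"
    then obtain N where N: "1 / real (Suc N) < e / 2" using nat_approx_posE[of "e / 2"] by auto
    have "dist (w m i) (w n i) < e" if "m \<ge> N" "n > m" for m n
    proof -
      have "L n \<subseteq> L m" using decseqD[OF L(1), of m n] that by simp
      then have "near_scalar (1 / real (Suc m)) (T i) (w m i) (L n)"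
        using near[of m i] unfolding near_scalar_def by blast
      then have "dist (w m i) (w n i) \<le> 1 / real (Suc m) + 1 / real (Suc n)"
        using X(1)[of n] by (intro near_scalar_dist_le[OF _ near]) auto
      also have "\<dots> \<le> 1 / real (Suc N) + 1 / real (Suc N)"
        using that by (intro add_mono) (simp_all add: frac_le)
      finally show ?thesis using N by simp
    qed
    then show "\<exists>N. \<forall>m\<ge>N. \<forall>n>m. dist (w m i) (w n i) < e" by blast
  qed
  then obtain z where z: "\<And>i. (\<lambda>n. w n i) \<longlonglongrightarrow> z i"
    unfolding Cauchy_convergent_iff convergent_def by metis
  have "approx_eigen (T i) (z i) X" for i
  proof (rule approx_eigenI[OF z LIMSEQ_Suc[OF lim_1_over_n]])
    show "norm (X n) = 1" for n using X(1)[of n] by simp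
    show "norm (shift (T i) (w n i) (X n)) \<le> 1 / real (Suc n)" for n
      using near[of n i] X(1)[of n] by (force simp: near_scalar_def)
  qed
  then show thesis using that X L(2) by blast
qed

end

end

section \<open>The Taylor spectrum of a commuting triple\<close>

text \<open>The index type \<open>3\<close> is the integers modulo 3, which makes the Koszul maps cyclic in the index.\<close>

definition triple :: "'b \<Rightarrow> 'b \<Rightarrow> 'b \<Rightarrow> 3 \<Rightarrow> 'b" where
  "triple x y z i = (if i = 1 then x else if i = 2 then y else z)"

lemma triple_simps [simp]: "triple x y z 1 = x" "triple x y z 2 = y" "triple x y z 3 = z"
  by (simp_all add: triple_def)

lemma numeral_mod_3 [simp]: "(4::3) = 1" "(5::3) = 2"
  by (simp_all add: eq_numeral_iff_iszero)

lemma sum_UNIV_3_cyclic: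
  fixes f :: "3 \<Rightarrow> 'a::comm_monoid_add"
  shows "sum f UNIV = f i + f (i + 1) + f (i + 2)"
  using exhaust_3[of i] by (auto simp: sum_3 ac_simps)

lemma baire_closed_cover:
  fixes A :: "nat \<Rightarrow> 'a::complete_space set"
  assumes "\<And>n. closed (A n)" "(\<Union>n. A n) = UNIV"
  obtains n where "interior (A n) \<noteq> {}"
proof -
  have "\<exists>n. interior (A n) \<noteq> {}"
  proof (rule ccontr)
    assume "\<not> ?thesis"
    then have "euclidean interior_of \<Union>(range A) = {}"
      using assms(1)
      by (intro Baire_category_alt) (auto simp: completely_metrizable_space_euclidean)
    then show False using assms(2) by simp
  qed
  then show thesis using that by blast
qed

lemma uniform_boundedness:
  fixes V :: "'a::chilbert set"
  assumes pointwise: "\<And>x. \<exists>K. \<forall>v\<in>V. cmod (cinner v x) \<le> K"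
  shows "\<exists>C. \<forall>v\<in>V. norm v \<le> C"
proof -
  define A where "A k = (\<Inter>v\<in>V. {x. cmod (cinner v x) \<le> real k})" for k :: nat
  have "closed (A k)" for k
    unfolding A_def by (intro closed_INT ballI closed_Collect_le continuous_intros
        bounded_linear.continuous_on[OF bounded_linear_cinner_right])
  moreover have "(\<Union>k. A k) = UNIV"
  proof -
    have "\<exists>k. x \<in> A k" for x
      using pointwise[of x] real_arch_simple unfolding A_def by (fastforce intro: order_trans)
    then show ?thesis by blast
  qed
  ultimately obtain k where "interior (A k) \<noteq> {}" by (rule baire_closed_cover)
  then obtain x0 e where e: "0 < e" "cball x0 e \<subseteq> A k" using mem_interior_cball by blast
  have "norm v \<le> 2 * real k / e" if v: "v \<in> V" for v
  proof (cases "v = 0")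
    case False
    define y where "y = (e / norm v) *\<^sub>R v"
    have "x0 + y \<in> A k" "x0 \<in> A k" using False e by (auto simp: y_def dist_norm)
    then have "cmod (cinner v (x0 + y)) \<le> real k" "cmod (cinner v x0) \<le> real k"
      using v by (auto simp: A_def)
    then have "cmod (cinner v y) \<le> 2 * real k"
      using norm_triangle_ineq4[of "cinner v (x0 + y)" "cinner v x0"]
      by (simp add: cinner_add_right)
    moreover have "cinner v y = complex_of_real (e * norm v)"
      using False by (simp add: y_def cinner_simps cinner_self_norm power2_eq_square)
    ultimately show ?thesis using e(1) by (simp add: field_simps norm_mult)
  qed (use e in simp)
  then show ?thesis by blast
qed

lemma cmod_cinner_sum_le:
  assumes "\<And>i. bounded_clinear (T i)"
  shows "cmod (cinner v (\<Sum>i\<in>I. T i (y i))) \<le> (\<Sum>i\<in>I. norm ((T i)\<^sup>\<dagger> v) * norm (y i))"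
  unfolding linear_sum[OF bounded_linear.linear[OF bounded_linear_cinner_right]]
  by (intro sum_norm_le) (simp add: cinner_cauchy_schwarz flip: cinner_adj_left[OF assms])

lemma adj_bounded_below_of_surj:
  fixes T :: "'i::finite \<Rightarrow> 'a::chilbert \<Rightarrow> 'a"
  assumes M: "closed_csubspace M" and T: "\<And>i. bounded_clinear (T i)"
    and surj: "\<And>w. w \<in> M \<Longrightarrow> \<exists>y. w = (\<Sum>i\<in>UNIV. T i (y i))"
  shows "\<exists>c>0. \<forall>v\<in>M. c * norm v \<le> (\<Sum>i\<in>UNIV. norm ((T i)\<^sup>\<dagger> v))"
proof -
  define f where "f v = (\<Sum>i\<in>UNIV. norm ((T i)\<^sup>\<dagger> v))" for v
  have "\<exists>K. \<forall>v\<in>{v\<in>M. f v \<le> 1}. cmod (cinner v x) \<le> K" for x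
  proof -
    obtain y where y: "proj M x = (\<Sum>i\<in>UNIV. T i (y i))" using surj[OF proj_in[OF M]] by blast
    have "cmod (cinner v x) \<le> (\<Sum>i\<in>UNIV. norm (y i))" if v: "v \<in> M" "f v \<le> 1" for v
    proof -
      have adj_le: "norm ((T i)\<^sup>\<dagger> v) \<le> 1" for i
        using v(2) member_le_sum[of i UNIV "\<lambda>i. norm ((T i)\<^sup>\<dagger> v)"] by (simp add: f_def)
      have "cmod (cinner v x) = cmod (cinner v (proj M x))"
        by (simp add: cinner_proj_right[OF M v(1)])
      also have "\<dots> \<le> (\<Sum>i\<in>UNIV. norm ((T i)\<^sup>\<dagger> v) * norm (y i))"
        unfolding y by (rule cmod_cinner_sum_le[OF T])
      also have "\<dots> \<le> (\<Sum>i\<in>UNIV. 1 * norm (y i))" by (intro sum_mono mult_right_mono adj_le) simp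
      also have "\<dots> = (\<Sum>i\<in>UNIV. norm (y i))" by simp
      finally show ?thesis .
    qed
    then show ?thesis by blast
  qed
  from uniform_boundedness[OF this] obtain C where C: "\<And>v. v \<in> M \<Longrightarrow> f v \<le> 1 \<Longrightarrow> norm v \<le> C" by blast
  have f_scale: "f (r *\<^sub>R v) = \<bar>r\<bar> * f v" for r v
    by (simp add: f_def bounded_clinear_simps[OF bounded_clinear_adj[OF T]] sum_distrib_left)
  have "norm v / max C 1 \<le> f v" if v: "v \<in> M" for v
  proof (rule dense_ge)
    fix t assume t: "f v < t"
    have "0 \<le> f v" by (simp add: f_def sum_nonneg)
    with t have "norm ((1 / t) *\<^sub>R v) \<le> C"
      by (intro C) (simp_all add: f_scale subspace_scale[OF closed_csubspaceD(2)[OF M] v])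
    with t \<open>0 \<le> f v\<close> have "norm v \<le> C * t" by (simp add: field_simps)
    also have "\<dots> \<le> max C 1 * t" using t \<open>0 \<le> f v\<close> by (intro mult_right_mono) auto
    finally show "norm v / max C 1 \<le> t" by (simp add: field_simps)
  qed
  then show ?thesis by (intro exI[of _ "1 / max C 1"]) (simp add: f_def)
qed

lemma taylor_spectrumI_approx_eigen:
  fixes T :: "3 \<Rightarrow> 'a::chilbert \<Rightarrow> 'a"
  assumes M: "closed_csubspace M" and T: "\<And>i. bounded_clinear (T i)"
    and X: "\<And>n. X n \<in> M \<inter> sphere 0 1" "\<And>i. approx_eigen ((T i)\<^sup>\<dagger>) (cnj (z i)) X"
  shows "(z 1, z 2, z 3) \<in> taylor_spectrum M (T 1) (T 2) (T 3)"
proof (rule ccontr)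
  let ?U = "\<lambda>i. shift (T i) (z i)"
  assume "\<not> ?thesis"
  then have "taylor_regular M (?U 1) (?U 2) (?U 3)" by (simp add: taylor_spectrum_def)
  then have surj: "\<exists>y. w = (\<Sum>i\<in>UNIV. ?U i (y i))" if "w \<in> M" for w
  proof -
    obtain y1 y2 y3 where "w = ?U 1 y1 + ?U 2 y2 + ?U 3 y3"
      using \<open>taylor_regular M (?U 1) (?U 2) (?U 3)\<close> \<open>w \<in> M\<close> unfolding taylor_regular_def by metis
    then show ?thesis by (intro exI[of _ "triple y1 y2 y3"]) (simp add: sum_3)
  qed
  obtain c where c: "0 < c"
      "\<And>v. v \<in> M \<Longrightarrow> c * norm v \<le> (\<Sum>i\<in>UNIV. norm (shift ((T i)\<^sup>\<dagger>) (cnj (z i)) v))"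
    using adj_bounded_below_of_surj[OF M bounded_clinear_shift[OF T] surj]
    by (auto simp: adj_shift[OF T])
  have "(\<lambda>n. \<Sum>i\<in>UNIV. norm (shift ((T i)\<^sup>\<dagger>) (cnj (z i)) (X n))) \<longlonglongrightarrow> (\<Sum>i\<in>(UNIV :: 3 set). 0)"
    using X(2) unfolding approx_eigen_def by (intro tendsto_sum tendsto_norm_zero)
  moreover have "c \<le> (\<Sum>i\<in>UNIV. norm (shift ((T i)\<^sup>\<dagger>) (cnj (z i)) (X n)))" for n
    using c(2)[of "X n"] X(1)[of n] by simp
  ultimately have "c \<le> (\<Sum>i\<in>(UNIV :: 3 set). 0)" by (intro tendsto_lowerbound) auto
  then show False using c(1) by simp
qed

context
  fixes T b :: "3 \<Rightarrow> 'a::chilbert \<Rightarrow> 'a" and M :: "'a set"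
  assumes M: "subspace M"
    and lin: "\<And>i. linear (T i)" "\<And>i. linear (b i)"
    and inv: "\<And>i x. x \<in> M \<Longrightarrow> T i x \<in> M" "\<And>i x. x \<in> M \<Longrightarrow> b i x \<in> M"
    and comm: "\<And>i j x. x \<in> M \<Longrightarrow> b i (T j x) = T j (b i x)"
    and homotopy: "\<And>x. x \<in> M \<Longrightarrow> (\<Sum>i\<in>UNIV. b i (T i x)) = x"
begin

lemma koszul_exact_1:
  assumes x: "\<And>j. x j \<in> M" and cycle: "\<And>j k. T j (x k) = T k (x j)"
  shows "T i (\<Sum>j\<in>UNIV. b j (x j)) = x i"
proof -
  have "T i (\<Sum>j\<in>UNIV. b j (x j)) = (\<Sum>j\<in>UNIV. T i (b j (x j)))" by (rule linear_sum[OF lin(1)])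
  also have "\<dots> = (\<Sum>j\<in>UNIV. b j (T j (x i)))" by (simp add: comm[OF x, symmetric] cycle[of i])
  also have "\<dots> = x i" by (rule homotopy[OF x])
  finally show ?thesis .
qed

lemma koszul_exact_2:
  assumes y: "\<And>j. y j \<in> M" and cycle: "(\<Sum>j\<in>UNIV. T j (y j)) = 0"
  shows "T (i + 1) (b (i + 1) (y i) - b i (y (i + 1)))
      - T (i + 2) (b i (y (i + 2)) - b (i + 2) (y i)) = y i"
    (is "?boundary = _")
proof -
  note simps = lin[THEN linear_add] lin[THEN linear_diff] lin[THEN linear_0]
  have homotopy_y:
      "b i (T i (y i)) + b (i + 1) (T (i + 1) (y i)) + b (i + 2) (T (i + 2) (y i)) = y i"
    using homotopy[OF y[of i]] by (simp add: sum_UNIV_3_cyclic[of _ i])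
  have cycle_b: "b i (T i (y i)) + b i (T (i + 1) (y (i + 1))) + b i (T (i + 2) (y (i + 2))) = 0"
    using cycle by (simp add: sum_UNIV_3_cyclic[of _ i] simps flip: simps(2))
  have "?boundary = (b i (T i (y i)) + b (i + 1) (T (i + 1) (y i)) + b (i + 2) (T (i + 2) (y i)))
      - (b i (T i (y i)) + b i (T (i + 1) (y (i + 1))) + b i (T (i + 2) (y (i + 2))))"
    by (simp add: simps comm[OF y, symmetric])
  then show ?thesis by (simp only: homotopy_y cycle_b diff_zero)
qed

lemma taylor_regular_of_homotopy: "taylor_regular M (T 1) (T 2) (T 3)"
  unfolding taylor_regular_def
proof (intro conjI ballI impI; (elim conjE)?)
  fix x assume x: "x \<in> M" "T 1 x = 0" "T 2 x = 0" "T 3 x = 0"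
  then show "x = 0" using homotopy[OF x(1)] by (simp add: sum_3 linear_0[OF lin(2)])
next
  fix x1 x2 x3 assume x: "x1 \<in> M" "x2 \<in> M" "x3 \<in> M"
    and cycle: "T 2 x3 - T 3 x2 = 0" "T 3 x1 - T 1 x3 = 0" "T 1 x2 - T 2 x1 = 0"
  define x where "x = triple x1 x2 x3"
  have xM: "x j \<in> M" for j using x exhaust_3[of j] by (auto simp: x_def)
  have "T j (x k) = T k (x j)" for j k
    using cycle exhaust_3[of j] exhaust_3[of k] by (auto simp: x_def)
  note exact = koszul_exact_1[OF xM this]
  show "\<exists>x\<in>M. x1 = T 1 x \<and> x2 = T 2 x \<and> x3 = T 3 x"
  proof (intro bexI conjI)
    show "(\<Sum>j\<in>UNIV. b j (x j)) \<in> M" by (intro subspace_sum[OF M] inv xM)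
  qed (simp_all add: exact, simp_all add: x_def)
next
  fix y1 y2 y3 assume y: "y1 \<in> M" "y2 \<in> M" "y3 \<in> M" and cycle: "T 1 y1 + T 2 y2 + T 3 y3 = 0"
  let ?y = "triple y1 y2 y3"
  have yM: "?y j \<in> M" for j using y exhaust_3[of j] by auto
  have "(\<Sum>j\<in>UNIV. T j (?y j)) = 0" using cycle by (simp add: sum_3)
  note exact = koszul_exact_2[of ?y, OF yM this]
  show "\<exists>x1\<in>M. \<exists>x2\<in>M. \<exists>x3\<in>M. y1 = T 2 x3 - T 3 x2 \<and> y2 = T 3 x1 - T 1 x3 \<and> y3 = T 1 x2 - T 2 x1"
  proof (intro bexI conjI)
    show "y1 = T 2 (b 2 y1 - b 1 y2) - T 3 (b 1 y3 - b 3 y1)" using exact[of 1] by simp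
    show "y2 = T 3 (b 3 y2 - b 2 y3) - T 1 (b 2 y1 - b 1 y2)" using exact[of 2] by simp
    show "y3 = T 1 (b 1 y3 - b 3 y1) - T 2 (b 3 y2 - b 2 y3)" using exact[of 3] by simp
  qed (intro subspace_diff[OF M] inv y)+
next
  fix w assume w: "w \<in> M"
  then have "w = T 1 (b 1 w) + T 2 (b 2 w) + T 3 (b 3 w)"
    using homotopy[OF w] by (simp add: sum_3 comm)
  then show "\<exists>y1\<in>M. \<exists>y2\<in>M. \<exists>y3\<in>M. w = T 1 y1 + T 2 y2 + T 3 y3" using inv(2)[OF w] by blast
qed

end

context
  fixes M :: "'a::chilbert set" and D :: "'a \<Rightarrow> 'a" and c :: real
  assumes M: "closed_csubspace M" and D: "bounded_clinear D" and inv: "\<And>x. x \<in> M \<Longrightarrow> D x \<in> M"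
    and c: "0 < c" and coercive: "\<And>x. x \<in> M \<Longrightarrow> c * (norm x)\<^sup>2 \<le> Re (cinner (D x) x)"
begin

text \<open>For a small step \<open>t\<close> the map \<open>x \<mapsto> x - t (D x - y)\<close> is a contraction of \<open>M\<close> with fixed
  point \<open>D\<^sup>-\<^sup>1 y\<close>.\<close>

lemma coercive_contraction:
  obtains t k where "0 < t" "0 \<le> k" "k < 1" "\<And>x. x \<in> M \<Longrightarrow> norm (x - t *\<^sub>R D x) \<le> k * norm x"
proof -
  obtain K0 where K0: "\<And>x. norm (D x) \<le> K0 * norm x" by (rule bounded_clinear_bound[OF D]) blast
  define K where "K = max (c + 1) K0"
  have K: "c < K" "0 < K" "norm (D x) \<le> K * norm x" for x
    using c order_trans[OF K0 mult_right_mono[OF max.cobounded2 norm_ge_zero]] by (auto simp: K_def)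
  define t where "t = c / K\<^sup>2"
  define k where "k = sqrt (1 - c\<^sup>2 / K\<^sup>2)"
  have t: "0 < t" using c K by (simp add: t_def)
  have "c\<^sup>2 / K\<^sup>2 \<le> 1" using c K by (simp add: power_mono)
  then have k: "0 \<le> k" "k < 1" "k\<^sup>2 = 1 - c\<^sup>2 / K\<^sup>2" using c K(2) by (auto simp: k_def)
  show thesis
  proof (rule that[OF t k(1,2)])
    fix x assume x: "x \<in> M"
    have "(norm (x - t *\<^sub>R D x))\<^sup>2 = (norm x)\<^sup>2 - 2 * t * Re (cinner (D x) x)
        + t\<^sup>2 * (norm (D x))\<^sup>2"
      by (simp add: norm_diff_sq cinner_simps power_mult_distrib Re_cinner_commute[of x])
    also have "\<dots> \<le> (norm x)\<^sup>2 - 2 * t * (c * (norm x)\<^sup>2) + t\<^sup>2 * (K * norm x)\<^sup>2"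
      using t coercive[OF x] K(3) by (intro add_mono diff_mono mult_left_mono power_mono) auto
    also have "\<dots> = (k * norm x)\<^sup>2"
      unfolding power_mult_distrib k t_def using K(2) by (simp add: field_simps power2_eq_square)
    finally show "norm (x - t *\<^sub>R D x) \<le> k * norm x" using k by (simp add: power2_le_iff_abs_le)
  qed
qed

lemma lax_milgram: "y \<in> M \<Longrightarrow> \<exists>!x. x \<in> M \<and> D x = y"
proof -
  assume y: "y \<in> M"
  note sub = closed_csubspaceD[OF M]
  obtain t k where t: "0 < t" and k: "0 \<le> k" "k < 1" "\<And>x. x \<in> M \<Longrightarrow> norm (x - t *\<^sub>R D x) \<le> k * norm x"
    by (rule coercive_contraction) blast
  have "\<exists>!x\<in>M. x - t *\<^sub>R (D x - y) = x"
  proof (rule Banach_fix[OF _ _ k(1,2)])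
    show "complete M" using sub(3) by (simp add: complete_eq_closed)
    show "M \<noteq> {}" using subspace_0[OF sub(2)] by blast
    show "(\<lambda>x. x - t *\<^sub>R (D x - y)) ` M \<subseteq> M"
      using inv y by (auto intro!: subspace_diff[OF sub(2)] subspace_scale[OF sub(2)])
    fix u v assume "u \<in> M" "v \<in> M"
    then have "norm ((u - v) - t *\<^sub>R D (u - v)) \<le> k * norm (u - v)"
      by (intro k(3) subspace_diff[OF sub(2)])
    then show "dist (u - t *\<^sub>R (D u - y)) (v - t *\<^sub>R (D v - y)) \<le> k * dist u v"
      by (simp add: dist_norm bounded_clinear_simps[OF D] algebra_simps)
  qed
  moreover have "x - t *\<^sub>R (D x - y) = x \<longleftrightarrow> D x = y" for x using t by auto
  ultimately show ?thesis by auto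
qed

lemma coercive_inverse:
  obtains G where "linear G" "\<And>x. G x \<in> M" "\<And>x. x \<in> M \<Longrightarrow> G (D x) = x" "\<And>x. x \<in> M \<Longrightarrow> D (G x) = x"
proof -
  define G where "G y = (THE x. x \<in> M \<and> D x = proj M y)" for y
  have G: "G y \<in> M" "D (G y) = proj M y" for y
    using theI'[OF lax_milgram[OF proj_in[OF M]], of y] by (simp_all add: G_def)
  have G_eq: "G y = x" if "x \<in> M" "D x = proj M y" for x y
    using lax_milgram[OF proj_in[OF M]] G that by blast
  note sub = closed_csubspaceD(2)[OF M]
    and projM = bounded_clinear_simps[OF bounded_clinear_proj[OF M]]
  have "linear G"
  proof (rule linearI)
    show "G (x + y) = G x + G y" for x y
      by (rule G_eq) (simp_all add: G subspace_add[OF sub] projM bounded_clinear_simps[OF D])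
    show "G (r *\<^sub>R x) = r *\<^sub>R G x" for r x
      by (rule G_eq) (simp_all add: G subspace_scale[OF sub] projM bounded_clinear_simps[OF D])
  qed
  then show thesis
    using that G G_eq by (simp add: proj_id[OF M] inv)
qed

end

definition doubly_commuting_on :: "'a::chilbert set \<Rightarrow> ('i \<Rightarrow> 'a \<Rightarrow> 'a) \<Rightarrow> bool" where
  "doubly_commuting_on M T \<longleftrightarrow>
     (\<forall>i j. \<forall>x\<in>M. T i (T j x) = T j (T i x) \<and> (T i)\<^sup>\<dagger> (T j x) = T j ((T i)\<^sup>\<dagger> x))"

lemma doubly_commuting_on_shift:
  assumes T: "\<And>i. bounded_clinear (T i)" and "doubly_commuting_on M T"
  shows "doubly_commuting_on M (\<lambda>i. shift (T i) (z i))"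
  using assms(2) unfolding doubly_commuting_on_def adj_shift[OF T]
  by (intro allI ballI conjI shift_commute T bounded_clinear_adj) auto

lemma taylor_regular_of_bounded_below:
  fixes T :: "3 \<Rightarrow> 'a::chilbert \<Rightarrow> 'a"
  assumes T: "\<And>i. bounded_clinear (T i)" and M: "jointly_reducing T M"
    and comm: "doubly_commuting_on M T"
    and c: "0 < c" "\<And>x. x \<in> M \<Longrightarrow> c * (norm x)\<^sup>2 \<le> (\<Sum>i\<in>UNIV. (norm (T i x))\<^sup>2)"
  shows "taylor_regular M (T 1) (T 2) (T 3)"
proof -
  note Mc = jointly_reducingD(1)[OF M]
  note sub = closed_csubspaceD(2)[OF Mc]
  have inv: "T i x \<in> M" "(T i)\<^sup>\<dagger> x \<in> M" if "x \<in> M" for i x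
    using jointly_reducingD(2)[OF M, of i] that by (auto simp: reduces_in_UNIV_iff[OF T Mc])
  have comm: "T i (T j x) = T j (T i x)" "(T i)\<^sup>\<dagger> (T j x) = T j ((T i)\<^sup>\<dagger> x)" if "x \<in> M" for i j x
    using comm that by (auto simp: doubly_commuting_on_def)
  define D where "D x = (\<Sum>i\<in>UNIV. (T i)\<^sup>\<dagger> (T i x))" for x
  have TT: "bounded_clinear (\<lambda>x. (T i)\<^sup>\<dagger> (T i x))" for i
    by (rule bounded_clinear_compose[OF bounded_clinear_adj[OF T] T])
  have D: "bounded_clinear D" unfolding D_def sum_3 by (intro bounded_clinear_add TT)
  have D_inv: "D x \<in> M" if "x \<in> M" for x
    unfolding D_def by (intro subspace_sum[OF sub] inv that)
  have "Re (cinner (D x) x) = (\<Sum>i\<in>UNIV. (norm (T i x))\<^sup>2)" for x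
    by (simp add: D_def sum_3 cinner_add_left norm_sq_eq_cinner_adj[OF T])
  then have coercive: "c * (norm x)\<^sup>2 \<le> Re (cinner (D x) x)" if "x \<in> M" for x
    using c(2)[OF that] by simp
  obtain G where G: "linear G" "\<And>x. G x \<in> M" "\<And>x. x \<in> M \<Longrightarrow> G (D x) = x" "\<And>x. x \<in> M \<Longrightarrow> D (G x) = x"
    by (rule coercive_inverse[OF Mc D D_inv c(1) coercive]) blast+
  have DT: "D (T j x) = T j (D x)" if x: "x \<in> M" for j x
    by (simp add: D_def
        linear_sum[OF bounded_linear.linear[OF bounded_clinear_bounded_linear[OF T]]]
        comm[OF inv(1)[OF x]] comm(1)[OF x, of _ j])
  have GT: "G (T j x) = T j (G x)" if x: "x \<in> M" for j x
    using G(3)[OF inv(1)[OF G(2)], of j x] DT[OF G(2)] G(4)[OF x] by simp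
  show ?thesis
  proof (rule taylor_regular_of_homotopy[of M T "\<lambda>i x. G ((T i)\<^sup>\<dagger> x)"])
    show "linear (\<lambda>x. G ((T i)\<^sup>\<dagger> x))" for i
      using linear_compose[OF
          bounded_linear.linear[OF bounded_clinear_bounded_linear[OF bounded_clinear_adj[OF T]]]
          G(1)]
      by (simp add: o_def)
    show "G ((T i)\<^sup>\<dagger> (T j x)) = T j (G ((T i)\<^sup>\<dagger> x))" if "x \<in> M" for i j x
      by (simp add: comm(2)[OF that] GT[OF inv(2)[OF that]])
    show "(\<Sum>i\<in>UNIV. G ((T i)\<^sup>\<dagger> (T i x))) = x" if "x \<in> M" for x
      using G(3)[OF that] by (simp add: D_def linear_sum[OF G(1)])
  qed (simp_all add: sub inv G(2) bounded_linear.linear[OF bounded_clinear_bounded_linear[OF T]])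
qed

lemma approx_eigenvectors_of_taylor_spectrum:
  fixes T :: "3 \<Rightarrow> 'a::chilbert \<Rightarrow> 'a"
  assumes T: "\<And>i. bounded_clinear (T i)" and M: "jointly_reducing T M"
    and comm: "doubly_commuting_on M T"
    and z: "(z 1, z 2, z 3) \<in> taylor_spectrum M (T 1) (T 2) (T 3)"
  obtains X where "\<And>n. X n \<in> M \<inter> sphere 0 1" "\<And>i. approx_eigen (T i) (z i) X"
proof -
  define U where "U i = shift (T i) (z i)" for i
  note Mc = jointly_reducingD(1)[OF M]
  note sub = closed_csubspaceD[OF Mc]
  have U: "bounded_clinear (U i)" for i unfolding U_def by (rule bounded_clinear_shift[OF T])
  have U_red: "jointly_reducing U M"
    using Mc reduces_in_UNIV_shift[OF sub(1) jointly_reducingD(2)[OF M]]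
    by (simp add: jointly_reducing_def U_def)
  have U_comm: "doubly_commuting_on M U"
    unfolding U_def[abs_def] by (rule doubly_commuting_on_shift[OF T comm])
  have not_regular: "\<not> taylor_regular M (U 1) (U 2) (U 3)"
    using z by (simp add: taylor_spectrum_def U_def)
  have "\<exists>x. x \<in> M \<inter> sphere 0 1 \<and> (\<forall>i. norm (U i x) \<le> d)" if d: "0 < d" for d
  proof -
    have "\<not> (\<forall>x\<in>M. d\<^sup>2 * (norm x)\<^sup>2 \<le> (\<Sum>i\<in>UNIV. (norm (U i x))\<^sup>2))"
      using taylor_regular_of_bounded_below[OF U U_red U_comm, of "d\<^sup>2"] not_regular d by auto
    then obtain x where x: "x \<in> M" "(\<Sum>i\<in>UNIV. (norm (U i x))\<^sup>2) < (d * norm x)\<^sup>2"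
      by (auto simp: power_mult_distrib not_le)
    have U_le: "norm (U i x) \<le> d * norm x" for i
    proof (rule power2_le_imp_le)
      have "(norm (U i x))\<^sup>2 \<le> (\<Sum>i\<in>UNIV. (norm (U i x))\<^sup>2)" by (rule member_le_sum) simp_all
      then show "(norm (U i x))\<^sup>2 \<le> (d * norm x)\<^sup>2" using x(2) by simp
    qed (use d in simp)
    have "x \<noteq> 0" using x(2) by (auto simp: bounded_clinear_simps[OF U])
    moreover have "norm (U i (sgn x)) \<le> d" for i
      using U_le[of i] \<open>x \<noteq> 0\<close> by (simp add: norm_apply_sgn[OF U] divide_le_eq)
    ultimately show ?thesis using sgn_in_subspace_sphere[OF sub(2) x(1) \<open>x \<noteq> 0\<close>] by blast
  qed
  then have "\<exists>x. x \<in> M \<inter> sphere 0 1 \<and> (\<forall>i. norm (U i x) \<le> 1 / real (Suc n))" for n by simp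
  then obtain X where X: "\<And>n. X n \<in> M \<inter> sphere 0 1" "\<And>n i. norm (U i (X n)) \<le> 1 / real (Suc n)"
    by metis
  have "approx_eigen (T i) (z i) X" for i
    using X by (intro approx_eigenI[OF tendsto_const LIMSEQ_Suc[OF lim_1_over_n]])
        (auto simp: U_def)
  then show thesis using that X(1) by blast
qed

lemma taylor_spectrum_cong:
  assumes "\<And>x. x \<in> M \<Longrightarrow> T1 x = U1 x" "\<And>x. x \<in> M \<Longrightarrow> T2 x = U2 x" "\<And>x. x \<in> M \<Longrightarrow> T3 x = U3 x"
  shows "taylor_spectrum M T1 T2 T3 = taylor_spectrum M U1 U2 U3"
proof -
  have "taylor_regular M (shift T1 a) (shift T2 b) (shift T3 c)
     = taylor_regular M (shift U1 a) (shift U2 b) (shift U3 c)" for a b c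
    unfolding taylor_regular_def using assms by (simp cong: ball_cong bex_cong)
  then show ?thesis unfolding taylor_spectrum_def by simp
qed

section \<open>Calculus of approximate eigenvectors\<close>

lemma approx_eigen_ident: "approx_eigen (\<lambda>x. x) 1 X"
  by (simp add: approx_eigen_def scaleC_one)

lemma approx_eigen_scaleC:
  assumes "approx_eigen T z X"
  shows "approx_eigen (\<lambda>x. scaleC c (T x)) (c * z) X"
  using bounded_linear.tendsto[OF bounded_linear_scaleC assms[unfolded approx_eigen_def], of c]
  by (simp add: approx_eigen_def scaleC_diff_right scaleC_scaleC)

lemma approx_eigen_compose:
  assumes U: "bounded_clinear U" and "approx_eigen T z X" "approx_eigen U w X"
  shows "approx_eigen (\<lambda>x. U (T x)) (w * z) X"
proof -
  have "(\<lambda>n. U (shift T z (X n)) + scaleC z (shift U w (X n))) \<longlonglongrightarrow> U 0 + scaleC z 0"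
    using assms unfolding approx_eigen_def
    by (intro tendsto_add bounded_linear.tendsto[OF bounded_linear_scaleC]
        bounded_linear.tendsto[OF bounded_clinear_bounded_linear[OF U]])
  then show ?thesis
    by (simp add: approx_eigen_def bounded_clinear_simps[OF U] scaleC_diff_right scaleC_scaleC
        mult.commute)
qed

lemma approx_eigen_add:
  assumes "approx_eigen T z X" "approx_eigen U w X"
  shows "approx_eigen (\<lambda>x. T x + U x) (z + w) X"
  using tendsto_add[OF assms[unfolded approx_eigen_def]]
  by (simp add: approx_eigen_def scaleC_add_left algebra_simps)

lemma approx_eigen_diff:
  assumes "approx_eigen T z X" "approx_eigen U w X"
  shows "approx_eigen (\<lambda>x. T x - U x) (z - w) X"
  using tendsto_diff[OF assms[unfolded approx_eigen_def]]
  by (simp add: approx_eigen_def scaleC_diff_left algebra_simps)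

lemma approx_eigen_adj:
  assumes T: "bounded_clinear T" and normal: "\<And>n. T (T\<^sup>\<dagger> (X n)) = T\<^sup>\<dagger> (T (X n))"
    and z: "approx_eigen T z X"
  shows "approx_eigen (T\<^sup>\<dagger>) (cnj z) X"
proof -
  have "norm (shift (T\<^sup>\<dagger>) (cnj z) (X n)) = norm (shift T z (X n))" for n
    using norm_adj_eq_norm[OF bounded_clinear_shift[OF T], of z "X n"]
      shift_commute[OF T bounded_clinear_adj[OF T] normal] by (simp add: adj_shift[OF T])
  then show ?thesis
    using z unfolding approx_eigen_def
    by (simp add: tendsto_norm_zero_iff[symmetric, of "\<lambda>n. shift _ _ (X n)"])
qed

lemma approx_eigen_of_kernel:
  assumes "approx_eigen T z X" "\<And>n. T (X n) = 0" "\<And>n. norm (X n) = 1"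
  shows "z = 0"
proof -
  have "(\<lambda>n. norm (shift T z (X n))) \<longlonglongrightarrow> 0"
    using assms(1) unfolding approx_eigen_def by (rule tendsto_norm_zero)
  then show ?thesis using assms(2,3) by (simp add: LIMSEQ_const_iff)
qed

lemma vanishes_of_null_on_taylor_spectrum:
  fixes T :: "3 \<Rightarrow> 'a::chilbert \<Rightarrow> 'a"
  assumes T: "commuting_normal_family T" and M: "jointly_reducing T M"
    and Q: "bounded_clinear Q" and Q_inv: "\<And>L x. jointly_reducing T L \<Longrightarrow> x \<in> L \<Longrightarrow> Q x \<in> L"
    and null: "\<And>z X. (z 1, z 2, z 3) \<in> taylor_spectrum M (T 1) (T 2) (T 3) \<Longrightarrow>
      (\<And>i. approx_eigen (T i) (z i) X) \<Longrightarrow>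
          (\<And>i. approx_eigen ((T i)\<^sup>\<dagger>) (cnj (z i)) X) \<Longrightarrow> approx_eigen Q 0 X"
    and x: "x \<in> M"
  shows "Q x = 0"
proof (rule ccontr)
  assume Qx: "Q x \<noteq> 0"
  then have "x \<noteq> 0" by (auto simp: bounded_clinear_simps[OF Q])
  define q where "q = norm (Q x) / (2 * norm x)"
  have q: "0 < q" using Qx \<open>x \<noteq> 0\<close> by (simp add: q_def)
  have exceeds: "exceeds Q q M"
    unfolding exceeds_def using Qx \<open>x \<noteq> 0\<close> x by (intro bexI[of _ x]) (simp_all add: q_def)
  obtain z X where X: "\<And>n. X n \<in> M \<inter> sphere 0 1" "\<And>n. q < norm (Q (X n))"
    and z: "\<And>i. approx_eigen (T i) (z i) X"
    by (rule joint_approx_eigenvectors[OF T Q less_imp_le[OF q] Q_inv finite M exceeds]) blast+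
  have z_adj: "approx_eigen ((T i)\<^sup>\<dagger>) (cnj (z i)) X" for i
    using T by (intro approx_eigen_adj z)
        (simp_all add: commuting_normal_family_def normal_on_UNIV_iff)
  have "(z 1, z 2, z 3) \<in> taylor_spectrum M (T 1) (T 2) (T 3)"
    by (rule taylor_spectrumI_approx_eigen[OF jointly_reducingD(1)[OF M]
        commuting_normal_family_bounded[OF T] X(1) z_adj])
  from null[OF this z z_adj] have "(\<lambda>n. norm (Q (X n))) \<longlonglongrightarrow> 0"
    unfolding approx_eigen_def by (simp add: tendsto_norm_zero)
  then have "q \<le> 0" by (rule tendsto_lowerbound) (simp_all add: X(2) less_imp_le)
  then show False using q by simp
qed

section \<open>Compression to a reducing subspace\<close>

definition compress :: "'a::chilbert set \<Rightarrow> ('a \<Rightarrow> 'a) \<Rightarrow> 'a \<Rightarrow> 'a" where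
  "compress M T x = T (proj M x)"

lemma compress_eq: "closed_csubspace M \<Longrightarrow> x \<in> M \<Longrightarrow> compress M T x = T x"
  by (simp add: compress_def proj_id)

lemma bounded_clinear_compress:
  "bounded_clinear T \<Longrightarrow> closed_csubspace M \<Longrightarrow> bounded_clinear (compress M T)"
  unfolding compress_def by (rule bounded_clinear_compose[OF _ bounded_clinear_proj])

lemma adj_compress:
  assumes T: "bounded_clinear T" and M: "closed_csubspace M" and red: "reduces_in UNIV M T"
  shows "(compress M T)\<^sup>\<dagger> = compress M (T\<^sup>\<dagger>)"
proof (rule adj_eqI)
  fix x y
  have "proj M (T\<^sup>\<dagger> y) = T\<^sup>\<dagger> (proj M y)"
    by (rule proj_commute[OF bounded_clinear_adj[OF T] M reduces_in_UNIV_adj[OF T M red]])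
  then show "cinner (compress M T x) y = cinner x (compress M (T\<^sup>\<dagger>) y)"
    by (simp add: compress_def cinner_adj_right[OF T, symmetric] cinner_proj_swap[OF M])
qed

lemma jointly_reducing_compress:
  assumes T: "\<And>i. bounded_clinear (T i)" and M: "jointly_reducing T M"
  shows "jointly_reducing (\<lambda>i. compress M (T i)) M"
proof -
  note Mc = jointly_reducingD(1)[OF M]
  have "reduces_in UNIV M (compress M (T i))" for i
    using jointly_reducingD(2)[OF M, of i]
    by (simp add: reduces_in_UNIV_iff T Mc bounded_clinear_compress adj_compress compress_eq)
  then show ?thesis by (simp add: jointly_reducing_def Mc)
qed

lemma commuting_normal_family_compress:
  assumes T: "\<And>i. bounded_clinear (T i)" and M: "jointly_reducing T M"
    and normal: "\<And>i. normal_on M (T i)" and comm: "\<And>i j x. x \<in> M \<Longrightarrow> T i (T j x) = T j (T i x)"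
  shows "commuting_normal_family (\<lambda>i. compress M (T i))"
proof -
  note Mc = jointly_reducingD(1)[OF M] and red = jointly_reducingD(2)[OF M]
  have inv: "T i x \<in> M" "(T i)\<^sup>\<dagger> x \<in> M" if "x \<in> M" for i x
    using red[of i] that by (auto simp: reduces_in_UNIV_iff[OF T Mc])
  show ?thesis
    using normal
    by (simp add: commuting_normal_family_def normal_on_UNIV_iff bounded_clinear_compress T Mc
        adj_compress red normal_on_iff compress_def proj_id proj_in inv comm)
qed

lemma adj_commute_swap:
  assumes T: "bounded_clinear T" and U: "bounded_clinear U" and M: "closed_csubspace M"
    and inv: "\<And>y. y \<in> M \<Longrightarrow> U y \<in> M \<and> T\<^sup>\<dagger> y \<in> M"
    and comm: "\<And>y. y \<in> M \<Longrightarrow> U\<^sup>\<dagger> (T y) = T (U\<^sup>\<dagger> y)" and x: "x \<in> M"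
  shows "T\<^sup>\<dagger> (U x) = U (T\<^sup>\<dagger> x)"
proof -
  let ?v = "T\<^sup>\<dagger> (U x) - U (T\<^sup>\<dagger> x)"
  have "?v \<in> M" using inv x by (intro subspace_diff[OF closed_csubspaceD(2)[OF M]]) auto
  have "cinner ?v ?v = cinner x (U\<^sup>\<dagger> (T ?v)) - cinner x (T (U\<^sup>\<dagger> ?v))"
    unfolding cinner_diff_left
    by (simp only: cinner_adj_left[OF T] cinner_adj_right[OF U, symmetric])
  then have "cinner ?v ?v = 0" using comm[OF \<open>?v \<in> M\<close>] by simp
  then show ?thesis by simp
qed

section \<open>The distinguished boundary of the pentablock\<close>

lemma bGammaI:
  assumes p: "cmod p = 1" and s: "cnj s * p = s" and s2: "cmod s \<le> 2"
  shows "(s, p) \<in> bGamma"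
proof -
  define w where "w = csqrt p"
  have ww: "w * w = p" unfolding w_def by (metis power2_csqrt power2_eq_square)
  have w: "cmod w = 1" by (simp add: w_def p)
  then have w_cnj: "w * cnj w = 1" using complex_norm_square[of w] by simp
  have "cnj (s * cnj w) = cnj s * w * (w * cnj w)" by (simp add: w_cnj)
  also have "\<dots> = (cnj s * (w * w)) * cnj w" by (simp only: mult_ac)
  also have "\<dots> = s * cnj w" by (simp only: ww s)
  finally obtain r where r: "s * cnj w = complex_of_real r" by (metis Reals_cnj_iff Reals_cases)
  have "s = s * (w * cnj w)" by (simp add: w_cnj)
  also have "\<dots> = w * complex_of_real r" by (simp flip: r)
  finally have sr: "s = w * complex_of_real r" .
  define t where "t = arccos (r / 2)"
  have "\<bar>r / 2\<bar> \<le> 1" using s2 by (simp add: sr norm_mult w)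
  then have t: "cos t = r / 2" unfolding t_def by (intro cos_arccos) auto
  have "s = w * cis t + w * cis (- t)" by (simp add: sr complex_eq_iff t flip: distrib_left)
  moreover have "p = (w * cis t) * (w * cis (- t))" by (simp add: ww[symmetric] mult_ac cis_mult)
  ultimately show ?thesis
    unfolding bGamma_def
    by (intro CollectI exI[of _ "w * cis t"] exI[of _ "w * cis (- t)"]) (simp add: norm_mult w)
qed

lemma bPenta_iff:
  "(a, s, p) \<in> bPenta \<longleftrightarrow> cnj p * p = 1 \<and> cnj s * p = s \<and> cnj a * a + 1/4 * (cnj s * s) = 1"
proof -
  have sq: "cnj z * z = complex_of_real ((cmod z)\<^sup>2)" for z
    using complex_norm_square[of z] by (simp add: mult.commute)
  have p_iff: "cnj p * p = 1 \<longleftrightarrow> cmod p = 1"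
    unfolding sq of_real_eq_1_iff using power2_eq_iff_nonneg[of "cmod p" 1] by simp
  have "cnj a * a + 1/4 * (cnj s * s) = complex_of_real ((cmod a)\<^sup>2 + (cmod s)\<^sup>2 / 4)"
    unfolding sq by simp
  then have as_iff: "cnj a * a + 1/4 * (cnj s * s) = 1 \<longleftrightarrow> (cmod a)\<^sup>2 + (cmod s)\<^sup>2 / 4 = 1"
    by (metis of_real_eq_1_iff)
  have "cmod p = 1 \<and> cnj s * p = s" if sp: "(s, p) \<in> bGamma"
  proof -
    obtain z1 z2 where z: "s = z1 + z2" "p = z1 * z2" "cmod z1 = 1" "cmod z2 = 1"
      using sp by (auto simp: bGamma_def)
    then have "cnj z1 * z1 = 1" "cnj z2 * z2 = 1" by (simp_all add: sq)
    moreover have "cnj s * p = (cnj z1 * z1) * z2 + (cnj z2 * z2) * z1"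
      unfolding z by (simp add: algebra_simps)
    ultimately show ?thesis using z by (simp add: norm_mult add.commute)
  qed
  moreover have "cmod s \<le> 2" if "(cmod a)\<^sup>2 + (cmod s)\<^sup>2 / 4 = 1"
  proof (rule power2_le_imp_le)
    show "(cmod s)\<^sup>2 \<le> 2\<^sup>2"
      using that zero_le_power2[of "cmod a"] unfolding power2_eq_square[of "2::real"] by linarith
  qed simp
  ultimately show ?thesis
    unfolding p_iff as_iff bPenta_def using bGammaI[of p s] by blast
qed

text \<open>For commuting operators, these are the equations of \<open>bPenta_iff\<close> together with the normality
  that they do not imply.\<close>

definition penta_relations :: "('a::chilbert \<Rightarrow> 'a) \<Rightarrow> ('a \<Rightarrow> 'a) \<Rightarrow> ('a \<Rightarrow> 'a) \<Rightarrow> 'a set" where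
  "penta_relations A S P = {x. P\<^sup>\<dagger> (P x) = x \<and> P (P\<^sup>\<dagger> x) = x \<and> S\<^sup>\<dagger> (P x) = S x
     \<and> A (A\<^sup>\<dagger> x) = A\<^sup>\<dagger> (A x) \<and> A\<^sup>\<dagger> (A x) + scaleC (1/4) (S\<^sup>\<dagger> (S x)) = x}"

context
  fixes A S P :: "'a::chilbert \<Rightarrow> 'a"
  assumes A: "bounded_clinear A" and S: "bounded_clinear S" and P: "bounded_clinear P"
begin

lemma bounded_clinear_triple: "bounded_clinear (triple A S P i)"
  using exhaust_3[of i] A S P by auto

lemma closed_csubspace_penta_relations: "closed_csubspace (penta_relations A S P)"
proof -
  note adj = A[THEN bounded_clinear_adj] S[THEN bounded_clinear_adj] P[THEN bounded_clinear_adj]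
  note comp = bounded_clinear_compose and kernel = closed_csubspace_Collect_eq
  have "penta_relations A S P = {x. P\<^sup>\<dagger> (P x) = x} \<inter> {x. P (P\<^sup>\<dagger> x) = x} \<inter> {x. S\<^sup>\<dagger> (P x) = S x}
      \<inter> {x. A (A\<^sup>\<dagger> x) = A\<^sup>\<dagger> (A x)} \<inter> {x. A\<^sup>\<dagger> (A x) + scaleC (1/4) (S\<^sup>\<dagger> (S x)) = x}"
    by (auto simp: penta_relations_def)
  then show ?thesis
    using kernel[OF comp[OF adj(3) P] bounded_clinear_ident]
        kernel[OF comp[OF P adj(3)] bounded_clinear_ident]
      kernel[OF comp[OF adj(2) P] S] kernel[OF comp[OF A adj(1)] comp[OF adj(1) A]]
      kernel[OF bounded_clinear_add[OF comp[OF adj(1) A]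
          comp[OF bounded_clinear_scaleC comp[OF adj(2) S]]]
        bounded_clinear_ident]
    by (simp add: closed_csubspace_Int)
qed

lemma approx_eigen_penta_relations:
  assumes "approx_eigen A a X" "approx_eigen S s X" "approx_eigen P p X"
    "approx_eigen (A\<^sup>\<dagger>) (cnj a) X" "approx_eigen (S\<^sup>\<dagger>) (cnj s) X" "approx_eigen (P\<^sup>\<dagger>) (cnj p) X"
  shows "approx_eigen (\<lambda>x. P\<^sup>\<dagger> (P x) - x) (cnj p * p - 1) X"
    "approx_eigen (\<lambda>x. S\<^sup>\<dagger> (P x) - S x) (cnj s * p - s) X"
    "approx_eigen (\<lambda>x. A\<^sup>\<dagger> (A x) + scaleC (1/4) (S\<^sup>\<dagger> (S x)) - x)
      (cnj a * a + 1/4 * (cnj s * s) - 1) X"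
proof -
  note comp = A[THEN bounded_clinear_adj, THEN approx_eigen_compose]
    S[THEN bounded_clinear_adj, THEN approx_eigen_compose]
        P[THEN bounded_clinear_adj, THEN approx_eigen_compose]
  note diff = approx_eigen_diff[OF _ approx_eigen_ident]
  show "approx_eigen (\<lambda>x. P\<^sup>\<dagger> (P x) - x) (cnj p * p - 1) X"
    by (rule diff[OF comp(3)[OF assms(3,6)]])
  show "approx_eigen (\<lambda>x. S\<^sup>\<dagger> (P x) - S x) (cnj s * p - s) X"
    by (rule approx_eigen_diff[OF comp(2)[OF assms(3,5)] assms(2)])
  show "approx_eigen (\<lambda>x. A\<^sup>\<dagger> (A x) + scaleC (1/4) (S\<^sup>\<dagger> (S x)) - x)
      (cnj a * a + 1/4 * (cnj s * s) - 1) X"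
    by (rule diff[OF approx_eigen_add[OF comp(1)[OF assms(1,4)]
        approx_eigen_scaleC[OF comp(2)[OF assms(2,5)]]]])
qed

lemma doubly_commuting_on_penta_relations:
  assumes M: "jointly_reducing (triple A S P) M" and comm: "commuting_on M A S P"
    and rel: "M \<subseteq> penta_relations A S P"
  shows "doubly_commuting_on M (triple A S P)"
proof -
  note Mc = jointly_reducingD(1)[OF M] and red = jointly_reducingD(2)[OF M]
  have inv: "A x \<in> M" "S x \<in> M" "P x \<in> M" "A\<^sup>\<dagger> x \<in> M" "S\<^sup>\<dagger> x \<in> M" "P\<^sup>\<dagger> x \<in> M" if "x \<in> M" for x
    using red[of 1] red[of 2] red[of 3] that by (auto simp: reduces_in_UNIV_iff A S P Mc)
  have PP: "P\<^sup>\<dagger> (P x) = x" "P (P\<^sup>\<dagger> x) = x" and SP: "S\<^sup>\<dagger> (P x) = S x" and AA: "A\<^sup>\<dagger> (A x) = A (A\<^sup>\<dagger> x)"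
    if "x \<in> M" for x using rel that by (auto simp: penta_relations_def)
  have comm: "A (S x) = S (A x)" "A (P x) = P (A x)" "S (P x) = P (S x)" if "x \<in> M" for x
    using comm that by (auto simp: commuting_on_def)
  have P_adj: "P\<^sup>\<dagger> (A x) = A (P\<^sup>\<dagger> x)" "P\<^sup>\<dagger> (S x) = S (P\<^sup>\<dagger> x)" if "x \<in> M" for x
    by (metis PP comm(2,3) inv(1,2,6) that)+
  have S_adj_eq: "S\<^sup>\<dagger> x = S (P\<^sup>\<dagger> x)" if "x \<in> M" for x by (metis PP(2) SP inv(6) that)
  have S_adj: "S\<^sup>\<dagger> (A x) = A (S\<^sup>\<dagger> x)" "S\<^sup>\<dagger> (S x) = S (S\<^sup>\<dagger> x)" "S\<^sup>\<dagger> (P x) = P (S\<^sup>\<dagger> x)"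
    if "x \<in> M" for x
    by (simp_all add: S_adj_eq inv that P_adj comm PP flip: comm(3))
  have A_adj: "A\<^sup>\<dagger> (S x) = S (A\<^sup>\<dagger> x)" "A\<^sup>\<dagger> (P x) = P (A\<^sup>\<dagger> x)" if "x \<in> M" for x
    by (rule adj_commute_swap[OF A _ Mc]; simp add: S P inv S_adj(1) P_adj(1) that)+
  have "triple A S P i (triple A S P j x) = triple A S P j (triple A S P i x)" if "x \<in> M" for i j x
    using exhaust_3[of i] exhaust_3[of j] comm[OF that] by auto
  moreover have "(triple A S P i)\<^sup>\<dagger> (triple A S P j x) = triple A S P j ((triple A S P i)\<^sup>\<dagger> x)"
    if "x \<in> M" for i j x
    using exhaust_3[of i] exhaust_3[of j] AA[OF that] A_adj[OF that] S_adj[OF that] P_adj[OF that]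
        PP[OF that]
    by auto
  ultimately show ?thesis by (simp add: doubly_commuting_on_def)
qed

lemma penta_unitary_of_relations:
  assumes M: "jointly_reducing (triple A S P) M" and comm: "commuting_on M A S P"
    and rel: "M \<subseteq> penta_relations A S P"
  shows "penta_unitary_on M A S P"
proof -
  note Mc = jointly_reducingD(1)[OF M] and red = jointly_reducingD(2)[OF M]
  note dcomm = doubly_commuting_on_penta_relations[OF assms]
  have swap: "triple A S P i ((triple A S P i)\<^sup>\<dagger> x) = (triple A S P i)\<^sup>\<dagger> (triple A S P i x)"
    if "x \<in> M" for i x
    using dcomm that by (simp add: doubly_commuting_on_def)
  have normal: "normal_on M (triple A S P i)" for i
    using swap by (simp add: normal_on_iff[OF bounded_clinear_triple Mc red])
  have "z \<in> bPenta" if z: "z \<in> taylor_spectrum M A S P" for z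
  proof -
    obtain a s p where zz: "z = (a, s, p)" by (cases z)
    have "(triple a s p 1, triple a s p 2, triple a s p 3)
        \<in> taylor_spectrum M (triple A S P 1) (triple A S P 2) (triple A S P 3)"
      using z by (simp add: zz)
    then obtain X where X: "\<And>n. X n \<in> M \<inter> sphere 0 1"
      and eigen: "\<And>i. approx_eigen (triple A S P i) (triple a s p i) X"
      by (rule approx_eigenvectors_of_taylor_spectrum[OF bounded_clinear_triple M dcomm]) blast
    have XM: "X n \<in> M" and norm_X: "norm (X n) = 1" for n using X[of n] by auto
    have eigen_adj: "approx_eigen ((triple A S P i)\<^sup>\<dagger>) (cnj (triple a s p i)) X" for i
      by (rule approx_eigen_adj[OF bounded_clinear_triple swap[OF XM] eigen])
    have X_rel: "X n \<in> penta_relations A S P" for n using XM rel by blast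
    note limits = approx_eigen_penta_relations[OF
        eigen[of 1, simplified] eigen[of 2, simplified] eigen[of 3, simplified]
        eigen_adj[of 1, simplified] eigen_adj[of 2, simplified] eigen_adj[of 3, simplified]]
    have "cnj p * p - 1 = 0" "cnj s * p - s = 0" "cnj a * a + 1/4 * (cnj s * s) - 1 = 0"
      by (rule limits[THEN approx_eigen_of_kernel[OF _ _ norm_X]]; use X_rel in
          \<open>simp add: penta_relations_def\<close>)+
    then show ?thesis unfolding zz bPenta_iff by simp
  qed
  then show ?thesis
    unfolding penta_unitary_on_def using comm normal[of 1] normal[of 2] normal[of 3] by auto
qed

lemma penta_relations_of_commuting_normal_family:
  assumes family: "commuting_normal_family (triple A S P)"
    and M: "jointly_reducing (triple A S P) M"
    and spectrum: "taylor_spectrum M A S P \<subseteq> bPenta"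
  shows "M \<subseteq> penta_relations A S P"
proof
  fix x assume x: "x \<in> M"
  note adj = A[THEN bounded_clinear_adj] S[THEN bounded_clinear_adj] P[THEN bounded_clinear_adj]
  note comp = bounded_clinear_compose
  have null: "approx_eigen (\<lambda>x. P\<^sup>\<dagger> (P x) - x) 0 X" "approx_eigen (\<lambda>x. S\<^sup>\<dagger> (P x) - S x) 0 X"
      "approx_eigen (\<lambda>x. A\<^sup>\<dagger> (A x) + scaleC (1/4) (S\<^sup>\<dagger> (S x)) - x) 0 X"
    if "(z 1, z 2, z 3) \<in> taylor_spectrum M A S P"
      and eigen: "\<And>i. approx_eigen (triple A S P i) (z i) X"
      and eigen_adj: "\<And>i. approx_eigen ((triple A S P i)\<^sup>\<dagger>) (cnj (z i)) X" for z X
  proof -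
    have "(z 1, z 2, z 3) \<in> bPenta" using that(1) spectrum by blast
    with approx_eigen_penta_relations[OF
        eigen[of 1, simplified] eigen[of 2, simplified] eigen[of 3, simplified]
        eigen_adj[of 1, simplified] eigen_adj[of 2, simplified] eigen_adj[of 3, simplified]]
    show "approx_eigen (\<lambda>x. P\<^sup>\<dagger> (P x) - x) 0 X" "approx_eigen (\<lambda>x. S\<^sup>\<dagger> (P x) - S x) 0 X"
      "approx_eigen (\<lambda>x. A\<^sup>\<dagger> (A x) + scaleC (1/4) (S\<^sup>\<dagger> (S x)) - x) 0 X"
      by (simp_all add: bPenta_iff)
  qed
  have inv: "subspace L" "A y \<in> L" "S y \<in> L" "P y \<in> L" "A\<^sup>\<dagger> y \<in> L" "S\<^sup>\<dagger> y \<in> L" "P\<^sup>\<dagger> y \<in> L"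
      "scaleC c y \<in> L"
    if L: "jointly_reducing (triple A S P) L" and y: "y \<in> L" for L y c
    using jointly_reducingD(2)[OF L, of 1] jointly_reducingD(2)[OF L, of 2]
        jointly_reducingD(2)[OF L, of 3]
      closed_csubspaceD[OF jointly_reducingD(1)[OF L]] y
    by (simp_all add: reduces_in_UNIV_iff A S P jointly_reducingD(1)[OF L] csubspace_scaleC)
  note vanishes = vanishes_of_null_on_taylor_spectrum[OF family M _ _ _ x, simplified]
  have "P\<^sup>\<dagger> (P x) - x = 0"
    by (rule vanishes[OF bounded_clinear_diff[OF comp[OF adj(3) P] bounded_clinear_ident] _
        null(1)])
      (auto intro!: subspace_diff inv)
  moreover have "S\<^sup>\<dagger> (P x) - S x = 0"
    by (rule vanishes[OF bounded_clinear_diff[OF comp[OF adj(2) P] S] _ null(2)])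
      (auto intro!: subspace_diff inv)
  moreover have "A\<^sup>\<dagger> (A x) + scaleC (1/4) (S\<^sup>\<dagger> (S x)) - x = 0"
    by (rule vanishes[OF bounded_clinear_diff[OF bounded_clinear_add[OF comp[OF adj(1) A]
              comp[OF bounded_clinear_scaleC comp[OF adj(2) S]]] bounded_clinear_ident] _ null(3)])
      (auto intro!: subspace_diff subspace_add inv)
  ultimately show "x \<in> penta_relations A S P"
    using commuting_normal_family_normal[OF family, of 1]
        commuting_normal_family_normal[OF family, of 3]
    by (simp add: penta_relations_def normal_on_UNIV_iff)
qed

end

context
  fixes A S P :: "'a::chilbert \<Rightarrow> 'a"
  assumes A: "bounded_clinear A" and S: "bounded_clinear S" and P: "bounded_clinear P"
begin

lemma relations_of_penta_unitary:
  assumes M: "jointly_reducing (triple A S P) M" and unitary: "penta_unitary_on M A S P"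
  shows "M \<subseteq> penta_relations A S P"
proof -
  note T = bounded_clinear_triple[OF A S P] and Mc = jointly_reducingD(1)[OF M]
    and red = jointly_reducingD(2)[OF M]
  let ?C = "compress M"
  have C_triple: "(\<lambda>i. ?C (triple A S P i)) = triple (?C A) (?C S) (?C P)"
    by (auto simp: triple_def)
  have "normal_on M (triple A S P i)" for i
    using unitary exhaust_3[of i] by (auto simp: penta_unitary_on_def)
  moreover have "triple A S P i (triple A S P j x) = triple A S P j (triple A S P i x)" if "x \<in> M"
    for i j x
    using unitary exhaust_3[of i] exhaust_3[of j] that
    by (auto simp: penta_unitary_on_def commuting_on_def)
  ultimately have C: "commuting_normal_family (triple (?C A) (?C S) (?C P))"
    using commuting_normal_family_compress[OF T M] by (simp add: C_triple)
  have C_red: "jointly_reducing (triple (?C A) (?C S) (?C P)) M"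
    using jointly_reducing_compress[OF T M] by (simp add: C_triple)
  have "taylor_spectrum M (?C A) (?C S) (?C P) = taylor_spectrum M A S P"
    by (rule taylor_spectrum_cong) (simp_all add: compress_eq[OF Mc])
  then have "M \<subseteq> penta_relations (?C A) (?C S) (?C P)"
    using unitary
    by (intro penta_relations_of_commuting_normal_family bounded_clinear_compress A S P Mc C C_red)
      (simp add: penta_unitary_on_def)
  moreover have "(?C A)\<^sup>\<dagger> = ?C (A\<^sup>\<dagger>)" "(?C S)\<^sup>\<dagger> = ?C (S\<^sup>\<dagger>)" "(?C P)\<^sup>\<dagger> = ?C (P\<^sup>\<dagger>)"
    using red[of 1] red[of 2] red[of 3] by (simp_all add: adj_compress A S P Mc)
  moreover have "A x \<in> M" "S x \<in> M" "P x \<in> M" "A\<^sup>\<dagger> x \<in> M" "S\<^sup>\<dagger> x \<in> M" "P\<^sup>\<dagger> x \<in> M" if "x \<in> M" for x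
    using red[of 1] red[of 2] red[of 3] that by (auto simp: reduces_in_UNIV_iff A S P Mc)
  ultimately show ?thesis by (auto simp: penta_relations_def compress_eq[OF Mc])
qed

corollary penta_unitary_on_iff:
  assumes M: "jointly_reducing (triple A S P) M" and comm: "commuting_on M A S P"
  shows "penta_unitary_on M A S P \<longleftrightarrow> M \<subseteq> penta_relations A S P"
  using penta_unitary_of_relations[OF A S P assms] relations_of_penta_unitary[OF M] by blast

end

section \<open>Restriction to reducing subspaces\<close>

lemma taylor_regular_restrict:
  fixes T :: "3 \<Rightarrow> 'a::chilbert \<Rightarrow> 'a"
  assumes T: "\<And>i. bounded_clinear (T i)" and M: "jointly_reducing T M"
    and regular: "taylor_regular UNIV (T 1) (T 2) (T 3)"
  shows "taylor_regular M (T 1) (T 2) (T 3)"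
proof -
  note Mc = jointly_reducingD(1)[OF M]
  have comm: "T i (proj M x) = proj M (T i x)" for i x
    by (rule proj_commute[OF T Mc jointly_reducingD(2)[OF M], symmetric])
  note proj = proj_in[OF Mc] proj_id[OF Mc] bounded_clinear_simps[OF bounded_clinear_proj[OF Mc]]
  show ?thesis
    unfolding taylor_regular_def
  proof (intro conjI ballI impI)
    show "x = 0" if "T 1 x = 0 \<and> T 2 x = 0 \<and> T 3 x = 0" for x
      using regular that unfolding taylor_regular_def by (elim conjE) blast
  next
    fix x1 x2 x3 assume x: "x1 \<in> M" "x2 \<in> M" "x3 \<in> M"
      and "T 2 x3 - T 3 x2 = 0 \<and> T 3 x1 - T 1 x3 = 0 \<and> T 1 x2 - T 2 x1 = 0"
    then obtain x where "x1 = T 1 x" "x2 = T 2 x" "x3 = T 3 x"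
      using regular unfolding taylor_regular_def by blast
    then have "x1 = T 1 (proj M x) \<and> x2 = T 2 (proj M x) \<and> x3 = T 3 (proj M x)"
      using x by (metis comm proj(2))
    then show "\<exists>x\<in>M. x1 = T 1 x \<and> x2 = T 2 x \<and> x3 = T 3 x" using proj(1) by blast
  next
    fix y1 y2 y3 assume y: "y1 \<in> M" "y2 \<in> M" "y3 \<in> M" and "T 1 y1 + T 2 y2 + T 3 y3 = 0"
    then obtain x1 x2 x3 where "y1 = T 2 x3 - T 3 x2" "y2 = T 3 x1 - T 1 x3" "y3 = T 1 x2 - T 2 x1"
      using regular unfolding taylor_regular_def by blast
    then have "y1 = T 2 (proj M x3) - T 3 (proj M x2) \<and> y2 = T 3 (proj M x1) - T 1 (proj M x3)
        \<and> y3 = T 1 (proj M x2) - T 2 (proj M x1)"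
      using y by (metis comm proj(2,4))
    then show "\<exists>x1\<in>M. \<exists>x2\<in>M. \<exists>x3\<in>M. y1 = T 2 x3 - T 3 x2 \<and> y2 = T 3 x1 - T 1 x3
        \<and> y3 = T 1 x2 - T 2 x1"
      using proj(1) by blast
  next
    fix w assume w: "w \<in> M"
    have "\<forall>w\<in>UNIV. \<exists>y1\<in>UNIV. \<exists>y2\<in>UNIV. \<exists>y3\<in>UNIV. w = T 1 y1 + T 2 y2 + T 3 y3"
      using regular unfolding taylor_regular_def by (elim conjE)
    then obtain y1 y2 y3 where "w = T 1 y1 + T 2 y2 + T 3 y3" by blast
    then have "w = T 1 (proj M y1) + T 2 (proj M y2) + T 3 (proj M y3)"
      using w by (metis comm proj(2,3))
    then show "\<exists>y1\<in>M. \<exists>y2\<in>M. \<exists>y3\<in>M. w = T 1 y1 + T 2 y2 + T 3 y3" using proj(1) by blast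
  qed
qed

lemma taylor_spectrum_restrict:
  fixes T :: "3 \<Rightarrow> 'a::chilbert \<Rightarrow> 'a"
  assumes T: "\<And>i. bounded_clinear (T i)" and M: "jointly_reducing T M"
  shows "taylor_spectrum M (T 1) (T 2) (T 3) \<subseteq> taylor_spectrum UNIV (T 1) (T 2) (T 3)"
proof -
  have "taylor_regular M (shift (T 1) a) (shift (T 2) b) (shift (T 3) c)"
    if "taylor_regular UNIV (shift (T 1) a) (shift (T 2) b) (shift (T 3) c)" for a b c
  proof -
    note Mc = jointly_reducingD(1)[OF M]
    have "jointly_reducing (\<lambda>i. shift (T i) (triple a b c i)) M"
      using Mc reduces_in_UNIV_shift[OF closed_csubspaceD(1)[OF Mc] jointly_reducingD(2)[OF M]]
      by (simp add: jointly_reducing_def)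
    from taylor_regular_restrict[OF bounded_clinear_shift[OF T] this] show ?thesis
      using that by simp
  qed
  then show ?thesis unfolding taylor_spectrum_def by blast
qed

lemma poly3_op_commute:
  assumes X: "bounded_clinear X"
    and comm: "\<And>x. X (A x) = A (X x)" "\<And>x. X (S x) = S (X x)" "\<And>x. X (P x) = P (X x)"
  shows "X (poly3_op c A S P x) = poly3_op c A S P (X x)"
proof -
  have "X ((A ^^ i) ((S ^^ j) ((P ^^ l) x))) = (A ^^ i) ((S ^^ j) ((P ^^ l) (X x)))" for i j l
    by (simp only: funpow_commute_apply[of X A, OF comm(1)] funpow_commute_apply[of X S, OF comm(2)]
        funpow_commute_apply[of X P, OF comm(3)])
  then show ?thesis
    unfolding poly3_op_def
        linear_sum[OF bounded_linear.linear[OF bounded_clinear_bounded_linear[OF X]]]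
    by (intro sum.cong) (auto simp: bounded_clinear_simps[OF X])
qed

context
  fixes M :: "'a::chilbert set" and f :: "'a \<Rightarrow> 'a"
  assumes M: "closed_csubspace M" and f: "bij f" and comm: "\<And>x. proj M (f x) = f (proj M x)"
begin

lemma bij_betw_restrict: "bij_betw f M M"
proof -
  have "f x \<in> M" if "x \<in> M" for x
    using comm[of x] proj_in[OF M, of "f x"] that by (simp add: proj_id[OF M])
  moreover have "\<exists>x\<in>M. f x = y" if "y \<in> M" for y
  proof -
    obtain x where "f x = y" using f by (metis bij_pointE)
    then have "f (proj M x) = y" using comm[of x] that by (simp add: proj_id[OF M])
    then show ?thesis using proj_in[OF M] by blast
  qed
  moreover have "inj_on f M" using f by (simp add: bij_def inj_on_def)
  ultimately show ?thesis by (auto simp: bij_betw_def)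
qed

lemma the_inv_into_restrict:
  assumes "y \<in> M"
  shows "the_inv_into M f y = the_inv_into UNIV f y"
proof -
  obtain x where "x \<in> M" "f x = y"
    using bij_betw_imp_surj_on[OF bij_betw_restrict] assms by (metis imageE)
  then show ?thesis
    using the_inv_into_f_f[of f M x] the_inv_into_f_f[of f UNIV x] bij_betw_restrict f
    by (simp add: bij_betw_def)
qed

end

lemma penta_contraction_restrict:
  assumes contraction: "penta_contraction_on UNIV A S P" and M: "jointly_reducing (triple A S P) M"
  shows "penta_contraction_on M A S P"
proof -
  note Mc = jointly_reducingD(1)[OF M] and red = jointly_reducingD(2)[OF M]
  have bounded: "bounded_clinear A" "bounded_clinear S" "bounded_clinear P"
    using contraction by (simp_all add: penta_contraction_on_def)
  have "bounded_clinear_on M (triple A S P i)" for i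
    using bounded_clinear_triple[OF bounded, of i] reduces_in_UNIV_D(1)[OF red, of _ i]
    by (auto simp: bounded_clinear_on_def)
  from this[of 1] this[of 2] this[of 3]
  have "bounded_clinear_on M A" "bounded_clinear_on M S" "bounded_clinear_on M P" by simp_all
  moreover have "commuting_on M A S P"
    using contraction by (simp add: penta_contraction_on_def commuting_on_def)
  moreover have "taylor_spectrum M A S P \<subseteq> closure pentablock"
    using taylor_spectrum_restrict[OF bounded_clinear_triple[OF bounded] M] contraction
    by (auto simp: penta_contraction_on_def)
  moreover have "bij_betw (poly3_op q A S P) M M \<and>
      (\<forall>y\<in>M. norm (poly3_op p A S P (the_inv_into M (poly3_op q A S P) y))
             \<le> (SUP z\<in>closure pentablock. cmod (poly3_eval p z / poly3_eval q z)) * norm y)"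
    if "poly3 p" "poly3 q" "\<forall>z\<in>closure pentablock. poly3_eval q z \<noteq> 0" for p q
  proof -
    have proj_comm: "proj M (triple A S P i x) = triple A S P i (proj M x)" for i x
      by (rule proj_commute[OF bounded_clinear_triple[OF bounded] Mc red])
    have "bij (poly3_op q A S P)"
      and bound: "norm (poly3_op p A S P (the_inv_into UNIV (poly3_op q A S P) y))
        \<le> (SUP z\<in>closure pentablock. cmod (poly3_eval p z / poly3_eval q z)) * norm y" for y
      using contraction that unfolding penta_contraction_on_def by blast+
    note restrict = Mc \<open>bij (poly3_op q A S P)\<close>
      poly3_op_commute[of "proj M" A S P, OF bounded_clinear_proj[OF Mc]
        proj_comm[of 1, simplified] proj_comm[of 2, simplified] proj_comm[of 3, simplified]]
    show ?thesis
      using bij_betw_restrict[OF restrict] the_inv_into_restrict[OF restrict] bound by simp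
  qed
  ultimately show ?thesis unfolding penta_contraction_on_def by blast
qed

section \<open>The unitary part\<close>

definition largest_invariant_subspace :: "('a::chilbert \<Rightarrow> 'a) set \<Rightarrow> 'a set \<Rightarrow> 'a set" where
  "largest_invariant_subspace F K = {x. \<forall>Ts\<in>lists F. fold (\<lambda>T. T) Ts x \<in> K}"

lemma largest_invariant_subspace_subset: "largest_invariant_subspace F K \<subseteq> K"
  unfolding largest_invariant_subspace_def by (force dest: bspec[of _ _ "[]"])

lemma largest_invariant_subspace_invariant:
  assumes "T \<in> F" "x \<in> largest_invariant_subspace F K"
  shows "T x \<in> largest_invariant_subspace F K"
proof -
  have "fold (\<lambda>T. T) Ts (T x) \<in> K" if "Ts \<in> lists F" for Ts
  proof -
    have "T # Ts \<in> lists F" using assms(1) that by simp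
    then have "fold (\<lambda>T. T) (T # Ts) x \<in> K"
      using assms(2) unfolding largest_invariant_subspace_def by blast
    then show ?thesis by simp
  qed
  then show ?thesis by (simp add: largest_invariant_subspace_def)
qed

lemma largest_invariant_subspace_greatest:
  assumes "M \<subseteq> K" "\<And>T x. T \<in> F \<Longrightarrow> x \<in> M \<Longrightarrow> T x \<in> M"
  shows "M \<subseteq> largest_invariant_subspace F K"
proof -
  have "fold (\<lambda>T. T) Ts x \<in> M" if "x \<in> M" "Ts \<in> lists F" for Ts x
    using that(2,1) by (induction Ts arbitrary: x) (auto simp: assms(2))
  then show ?thesis using assms(1) by (auto simp: largest_invariant_subspace_def)
qed

lemma closed_csubspace_largest_invariant_subspace:
  assumes K: "closed_csubspace K" and F: "\<And>T. T \<in> F \<Longrightarrow> bounded_clinear T"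
  shows "closed_csubspace (largest_invariant_subspace F K)"
proof -
  have word: "bounded_clinear (fold (\<lambda>T. T) Ts)" if "Ts \<in> lists F" for Ts
    using that
  proof (induction Ts)
    case Nil
    show ?case using bounded_clinear_ident by (simp add: id_def)
  next
    case (Cons T Ts)
    then show ?case using bounded_clinear_compose[of "fold (\<lambda>T. T) Ts" T] F by (simp add: comp_def)
  qed
  have "closed (fold (\<lambda>T. T) Ts -` K)" if "Ts \<in> lists F" for Ts
    using closed_vimage[OF closed_csubspaceD(3)[OF K]] bounded_linear.continuous_on[OF
        bounded_clinear_bounded_linear[OF word[OF that]] continuous_on_id] by blast
  then have "closed (\<Inter>Ts\<in>lists F. fold (\<lambda>T. T) Ts -` K)" by (intro closed_INT ballI)
  also have "(\<Inter>Ts\<in>lists F. fold (\<lambda>T. T) Ts -` K) = largest_invariant_subspace F K"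
    by (auto simp: largest_invariant_subspace_def)
  finally have "closed (largest_invariant_subspace F K)" .
  moreover have "csubspace (largest_invariant_subspace F K)"
    using closed_csubspaceD(1)[OF K] bounded_clinear_simps[OF word]
    by (simp add: csubspace_def largest_invariant_subspace_def)
  ultimately show ?thesis by (simp add: closed_csubspace_def)
qed

definition penta_unitary_part :: "('a::chilbert \<Rightarrow> 'a) \<Rightarrow> ('a \<Rightarrow> 'a) \<Rightarrow> ('a \<Rightarrow> 'a) \<Rightarrow> 'a set" where
  "penta_unitary_part A S P =
     largest_invariant_subspace {A, S, P, A\<^sup>\<dagger>, S\<^sup>\<dagger>, P\<^sup>\<dagger>} (penta_relations A S P)"

context
  fixes A S P :: "'a::chilbert \<Rightarrow> 'a"
  assumes A: "bounded_clinear A" and S: "bounded_clinear S" and P: "bounded_clinear P"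
begin

lemma jointly_reducing_triple_iff:
  "jointly_reducing (triple A S P) M \<longleftrightarrow> closed_csubspace M
      \<and> (\<forall>T\<in>{A, S, P, A\<^sup>\<dagger>, S\<^sup>\<dagger>, P\<^sup>\<dagger>}. \<forall>x\<in>M. T x \<in> M)"
proof (cases "closed_csubspace M")
  case True
  then show ?thesis
    by (auto simp: jointly_reducing_def forall_3 reduces_in_UNIV_iff A S P)
qed (simp add: jointly_reducing_def)

lemma jointly_reducing_penta_unitary_part:
    "jointly_reducing (triple A S P) (penta_unitary_part A S P)"
  unfolding jointly_reducing_triple_iff penta_unitary_part_def
proof (intro conjI ballI)
  show "closed_csubspace
      (largest_invariant_subspace {A, S, P, A\<^sup>\<dagger>, S\<^sup>\<dagger>, P\<^sup>\<dagger>} (penta_relations A S P))"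
    by (rule closed_csubspace_largest_invariant_subspace[OF
          closed_csubspace_penta_relations[OF A S P]])
      (use A S P bounded_clinear_adj in auto)
qed (rule largest_invariant_subspace_invariant)

lemma penta_unitary_on_penta_unitary_part:
  assumes "commuting_on UNIV A S P"
  shows "penta_unitary_on (penta_unitary_part A S P) A S P"
proof -
  have "commuting_on (penta_unitary_part A S P) A S P" using assms by (simp add: commuting_on_def)
  from penta_unitary_on_iff[OF A S P jointly_reducing_penta_unitary_part this]
  show ?thesis by (simp add: penta_unitary_part_def largest_invariant_subspace_subset)
qed

lemma penta_unitary_part_greatest:
  assumes N: "jointly_reducing (triple A S P) N" and unitary: "penta_unitary_on N A S P"
  shows "N \<subseteq> penta_unitary_part A S P"
proof -
  have "N \<subseteq> penta_relations A S P"
    using penta_unitary_on_iff[OF A S P N] unitary by (simp add: penta_unitary_on_def)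
  then show ?thesis
    using N unfolding penta_unitary_part_def jointly_reducing_triple_iff
    by (intro largest_invariant_subspace_greatest) blast+
qed

end

lemma penta_cnu_on_orth_penta_unitary_part:
  assumes contraction: "penta_contraction_on UNIV A S P"
  shows "penta_cnu_on (orth (penta_unitary_part A S P)) A S P"
proof -
  have bounded: "bounded_clinear A" "bounded_clinear S" "bounded_clinear P"
    using contraction by (simp_all add: penta_contraction_on_def)
  let ?Hu = "penta_unitary_part A S P"
  note Hc_red = jointly_reducing_orth[OF jointly_reducing_penta_unitary_part[OF bounded]]
  have "N = {0}" if N: "closed_csubspace N" "reduces_in (orth ?Hu) N A" "reduces_in (orth ?Hu) N S"
      "reduces_in (orth ?Hu) N P" and unitary: "penta_unitary_on N A S P" for N
  proof -
    have "reduces_in UNIV N (triple A S P i)" for i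
    proof (rule reduces_in_trans[OF
           bounded_clinear_triple[OF bounded] jointly_reducingD[OF Hc_red]])
      show "reduces_in (orth ?Hu) N (triple A S P i)" using N exhaust_3[of i] by auto
    qed
    then have "jointly_reducing (triple A S P) N" using N(1) by (simp add: jointly_reducing_def)
    then have "N \<subseteq> ?Hu" using unitary by (rule penta_unitary_part_greatest[OF bounded])
    moreover have "N \<subseteq> orth ?Hu" using N(2) by (simp add: reduces_in_def)
    ultimately have "x = 0" if "x \<in> N" for x using orthD[of x ?Hu x] that by auto
    moreover have "0 \<in> N" using closed_csubspaceD(2)[OF N(1)] by (rule subspace_0)
    ultimately show ?thesis by blast
  qed
  then show ?thesis
    unfolding penta_cnu_on_def using penta_contraction_restrict[OF contraction Hc_red] by blast
qed

theorem mainTheorem4: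
  fixes A S P :: "'a::chilbert \<Rightarrow> 'a"
  assumes "penta_contraction_on UNIV A S P"
  shows "\<exists>Hu Hc. closed_csubspace Hu \<and> closed_csubspace Hc
    \<and> (\<forall>u\<in>Hu. \<forall>c\<in>Hc. cinner u c = 0)
    \<and> (\<forall>h. \<exists>u\<in>Hu. \<exists>c\<in>Hc. h = u + c)
    \<and> reduces_in UNIV Hu A \<and> reduces_in UNIV Hu S \<and> reduces_in UNIV Hu P
    \<and> reduces_in UNIV Hc A \<and> reduces_in UNIV Hc S \<and> reduces_in UNIV Hc P
    \<and> penta_unitary_on Hu A S P
    \<and> penta_contraction_on Hc A S P \<and> penta_cnu_on Hc A S P"
proof -
  have bounded: "bounded_clinear A" "bounded_clinear S" "bounded_clinear P"
    and comm: "commuting_on UNIV A S P"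
    using assms by (simp_all add: penta_contraction_on_def)
  define Hu where "Hu = penta_unitary_part A S P"
  have Hu: "jointly_reducing (triple A S P) Hu" and Hc: "jointly_reducing (triple A S P) (orth Hu)"
    unfolding Hu_def using jointly_reducing_penta_unitary_part[OF bounded] jointly_reducing_orth
    by blast+
  have reducing: "reduces_in UNIV M A \<and> reduces_in UNIV M S \<and> reduces_in UNIV M P"
    if "jointly_reducing (triple A S P) M" for M
    using that by (simp add: jointly_reducing_def forall_3)
  have "\<exists>u\<in>Hu. \<exists>c\<in>orth Hu. h = u + c" for h
    using orthogonal_decomposition[OF jointly_reducingD(1)[OF Hu], of h]
    by (metis add.commute diff_add_cancel)
  moreover have "penta_unitary_on Hu A S P"
    unfolding Hu_def by (rule penta_unitary_on_penta_unitary_part[OF bounded comm])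
  moreover have "penta_cnu_on (orth Hu) A S P"
    unfolding Hu_def by (rule penta_cnu_on_orth_penta_unitary_part[OF assms])
  ultimately show ?thesis
    using jointly_reducingD(1)[OF Hu] jointly_reducingD(1)[OF Hc] reducing[OF Hu] reducing[OF Hc]
        orthD
    by (intro exI[of _ Hu] exI[of _ "orth Hu"]) (auto simp: penta_cnu_on_def)
qed

end
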